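(* For every $m\ge 1$ the Hamiltonian vector field $Y_{K_m}$ of the mKdV hierarchy and the Hamiltonian vector field $X_{S_{2m}}$ of the NLS hierarchy satisfy $$X_{S_{2m}}^{\sharp} = (Y_{K_m},Y_{K_m})\quad\text{on } H^m_c,$$ that is, $X_{S_{2m}}(u,u)=(Y_{K_m}(u),Y_{K_m}(u))$ for all $u\in H^m_c$. In addition, $S_{2m}^{\sharp}=0$ on $H^m_c$ for every $m\ge 1$.
   Context: Let $\mathbb T=\mathbb R/\mathbb Z$, $H^m_c=H^m(\mathbb T,\mathbb C)$ and $\mathcal H^m_c=H^m_c\times H^m_c$ with elements $\varphi=(\varphi_1,\varphi_2)$. The gradient $\partial F=(\partial_{\varphi_1}F,\partial_{\varphi_2}F)$ of a functional $F$ of $\varphi$ is defined by $dF(\varphi)h=\int_{\mathbb T}(\partial_{\varphi_1}F\,h_1+\partial_{\varphi_2}F\,h_2)\,dx$, and the gradient $\nabla G$ of a functional $G$ of $u$ by $dG(u)h=\int_{\mathbb T}\nabla G\, h\,dx$ (in low regularity these are understood as distributions). Vector fields: $X_F=-iJ\,\partial F$ with $J=\begin{pmatrix}0&1\\-1&0\end{pmatrix}$, and $Y_G=\partial_x\nabla G$. Restriction: for a functional $F$ (or vector field $X$) of $\varphi$, $F^\sharp(u)=F(u,u)$ and $X^\sharp(u)=X(u,u)$. NLS hierarchy: for smooth $\varphi$ put $r_1=\varphi_2$, $r_{n+1}=-i\partial_x r_n+\varphi_1\sum_{j=1}^{n-1}r_jr_{n-j}$ for $n\ge1$, and $S_n(\varphi)=\int_{\mathbb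 T}\varphi_1 r_n\,dx$. Thus $S_1=\int\varphi_1\varphi_2$, $S_2=\frac i2\int(\varphi_2\partial_x\varphi_1-\varphi_1\partial_x\varphi_2)$, $S_3=\int(\partial_x\varphi_1\partial_x\varphi_2+\varphi_1^2\varphi_2^2)$, $S_4=i\int(\varphi_1\partial_{xxx}\varphi_2-3\varphi_1^2\varphi_2\partial_x\varphi_2)$, and so on. After integration by parts, $S_{2m}$ is defined (by continuous extension) on $\mathcal H^m_c$ and $S_{2m-1}$ on $\mathcal H^{m-1}_c$. mKdV hierarchy: for smooth $u$ put $B=u_x+u^2$, $q_1=B$, $q_{n+1}=-i\partial_xq_n+\sum_{j=1}^{n-1}q_jq_{n-j}$ for $n\ge1$, and $K_m(u)=\frac12\int_{\mathbb T}q_{2m-1}\,dx$. Thus $K_1=\frac12\int u^2$, $K_2=\frac12\int(u_x^2+u^4)$, and so on. $K_m$ is defined (by continuous extension) on $H^{m-1}_c$. *)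

theory Defs
  imports "HOL-Analysis.Analysis" "HOL-Library.Function_Algebras" "HOL-Library.FuncSet"
begin

text \<open>Functions on the torus \<open>\<real>/\<int>\<close> are 1-periodic functions on \<open>\<real>\<close>. Almost everywhere equal
  functions are not identified; the Sobolev norms below are therefore only seminorms, and
  everything built from them is insensitive to the choice of representative.\<close>

type_synonym tfun = "real \<Rightarrow> complex"

definition torus :: "real measure" where
  "torus = lebesgue_on {0..1}"

definition periodic :: "tfun \<Rightarrow> bool" where
  "periodic u \<longleftrightarrow> (\<forall>x. u (x + 1) = u x)"

definition Dx :: "tfun \<Rightarrow> tfun" where
  "Dx u = (\<lambda>x. vector_derivative u (at x))"

definition smooth_per :: "tfun set" where
  "smooth_per = {u. periodic u \<and> (\<forall>n x. (Dx ^^ n) u differentiable (at x))}"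

definition fourier :: "tfun \<Rightarrow> int \<Rightarrow> complex" where
  "fourier u n = (LINT x|torus. u x * cis (- 2 * pi * of_int n * x))"

definition sob_term :: "nat \<Rightarrow> tfun \<Rightarrow> int \<Rightarrow> real" where
  "sob_term m u n = (1 + (of_int n)\<^sup>2) ^ m * (cmod (fourier u n))\<^sup>2"

definition sobolev :: "nat \<Rightarrow> tfun set" where
  "sobolev m = {u. periodic u \<and> u \<in> borel_measurable torus \<and>
     integrable torus (\<lambda>x. (cmod (u x))\<^sup>2) \<and> sob_term m u summable_on UNIV}"

definition sob_norm :: "nat \<Rightarrow> tfun \<Rightarrow> real" where
  "sob_norm m u = sqrt (\<Sum>\<^sub>\<infinity>n. sob_term m u n)"

definition sob_norm2 :: "nat \<Rightarrow> tfun \<times> tfun \<Rightarrow> real" where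
  "sob_norm2 m \<phi> = sqrt ((sob_norm m (fst \<phi>))\<^sup>2 + (sob_norm m (snd \<phi>))\<^sup>2)"

definition cscale :: "complex \<Rightarrow> ('a \<Rightarrow> complex) \<Rightarrow> ('a \<Rightarrow> complex)" where
  "cscale c u = (\<lambda>x. c * u x)"

definition cscale2 :: "complex \<Rightarrow> ('a \<Rightarrow> complex) \<times> ('b \<Rightarrow> complex)
    \<Rightarrow> ('a \<Rightarrow> complex) \<times> ('b \<Rightarrow> complex)" where
  "cscale2 c = map_prod (cscale c) (cscale c)"


text \<open>Calculus on a complex vector space \<open>V\<close> with scalar multiplication \<open>sc\<close> and seminorm \<open>N\<close>.
  Since the regularity index is a variable, these are sets and not types.\<close>

definition continuous_wrt ::
  "'v::ab_group_add set \<Rightarrow> ('v \<Rightarrow> real) \<Rightarrow> ('v \<Rightarrow> complex) \<Rightarrow> bool" where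
  "continuous_wrt V N F \<longleftrightarrow>
     (\<forall>v\<in>V. \<forall>e>0. \<exists>d>0. \<forall>w\<in>V. N (w - v) < d \<longrightarrow> cmod (F w - F v) < e)"

text \<open>The continuous extension to \<open>V\<close> of a function given on a dense subset \<open>A\<close> of \<open>V\<close>.\<close>

definition cont_extension ::
  "'v::ab_group_add set \<Rightarrow> ('v \<Rightarrow> real) \<Rightarrow> 'v set \<Rightarrow> ('v \<Rightarrow> complex) \<Rightarrow> 'v \<Rightarrow> complex" where
  "cont_extension V N A F =
     (THE G. G \<in> extensional V \<and> continuous_wrt V N G \<and> (\<forall>v\<in>A. G v = F v))"

definition has_differential ::
  "(complex \<Rightarrow> 'v \<Rightarrow> 'v) \<Rightarrow> 'v::ab_group_add set \<Rightarrow> ('v \<Rightarrow> real)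
    \<Rightarrow> ('v \<Rightarrow> complex) \<Rightarrow> 'v \<Rightarrow> ('v \<Rightarrow> complex) \<Rightarrow> bool" where
  "has_differential sc V N F v D \<longleftrightarrow>
     (\<forall>h\<in>V. \<forall>k\<in>V. D (h + k) = D h + D k) \<and>
     (\<forall>c. \<forall>h\<in>V. D (sc c h) = c * D h) \<and>
     (\<exists>C. \<forall>h\<in>V. cmod (D h) \<le> C * N h) \<and>
     (\<forall>e>0. \<exists>d>0. \<forall>h\<in>V. N h < d \<longrightarrow> cmod (F (v + h) - F v - D h) \<le> e * N h)"

definition differential ::
  "(complex \<Rightarrow> 'v \<Rightarrow> 'v) \<Rightarrow> 'v::ab_group_add set \<Rightarrow> ('v \<Rightarrow> real)
    \<Rightarrow> ('v \<Rightarrow> complex) \<Rightarrow> 'v \<Rightarrow> ('v \<Rightarrow> complex)" where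
  "differential sc V N F v = (THE D. D \<in> extensional V \<and> has_differential sc V N F v D)"


text \<open>A distribution is a functional on \<^const>\<open>smooth_per\<close>, taken to be 0 off that set so that
  equality of distributions is equality of functions. A function \<open>g\<close> corresponds to
  \<open>h \<mapsto> \<integral> g h\<close>, without complex conjugation.\<close>

type_synonym tdist = "tfun \<Rightarrow> complex"

definition as_dist :: "(tfun \<Rightarrow> complex) \<Rightarrow> tdist" where
  "as_dist T = (\<lambda>h. if h \<in> smooth_per then T h else 0)"

definition dist_Dx :: "tdist \<Rightarrow> tdist" where
  "dist_Dx T = as_dist (\<lambda>h. - T (Dx h))"

text \<open>In the gradients and Hamiltonian vector fields the first argument is the index of the Sobolev
  space on which the functional is defined and differentiated.\<close>

definition grad :: "nat \<Rightarrow> (tfun \<Rightarrow> complex) \<Rightarrow> tfun \<Rightarrow> tdist" where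
  "grad m G u = as_dist (differential cscale (sobolev m) (sob_norm m) G u)"

definition grad2 :: "nat \<Rightarrow> (tfun \<times> tfun \<Rightarrow> complex) \<Rightarrow> tfun \<times> tfun \<Rightarrow> tdist \<times> tdist" where
  "grad2 m F \<phi> =
     (let dF = differential cscale2 (sobolev m \<times> sobolev m) (sob_norm2 m) F \<phi>
      in (as_dist (\<lambda>h. dF (h, 0)), as_dist (\<lambda>h. dF (0, h))))"

definition J_mult :: "tdist \<times> tdist \<Rightarrow> tdist \<times> tdist" where
  "J_mult g = (snd g, - fst g)"

definition ham_X :: "nat \<Rightarrow> (tfun \<times> tfun \<Rightarrow> complex) \<Rightarrow> tfun \<times> tfun \<Rightarrow> tdist \<times> tdist" where
  "ham_X m F \<phi> = cscale2 (- \<i>) (J_mult (grad2 m F \<phi>))"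

definition ham_Y :: "nat \<Rightarrow> (tfun \<Rightarrow> complex) \<Rightarrow> tfun \<Rightarrow> tdist" where
  "ham_Y m G u = dist_Dx (grad m G u)"

definition sharp :: "(tfun \<times> tfun \<Rightarrow> 'b) \<Rightarrow> tfun \<Rightarrow> 'b" where
  "sharp F u = F (u, u)"


text \<open>The two hierarchies. The sequences start at index 1; index 0 is a dummy that is never used.\<close>

fun nls_r :: "tfun \<times> tfun \<Rightarrow> nat \<Rightarrow> tfun" where
  "nls_r \<phi> 0 = 0"
| "nls_r \<phi> (Suc 0) = snd \<phi>"
| "nls_r \<phi> (Suc (Suc n)) = (\<lambda>x. - \<i> * Dx (nls_r \<phi> (Suc n)) x
     + fst \<phi> x * (\<Sum>j\<in>{1..n}. nls_r \<phi> j x * nls_r \<phi> (Suc n - j) x))"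

fun mkdv_q :: "tfun \<Rightarrow> nat \<Rightarrow> tfun" where
  "mkdv_q u 0 = 0"
| "mkdv_q u (Suc 0) = (\<lambda>x. Dx u x + (u x)\<^sup>2)"
| "mkdv_q u (Suc (Suc n)) = (\<lambda>x. - \<i> * Dx (mkdv_q u (Suc n)) x
     + (\<Sum>j\<in>{1..n}. mkdv_q u j x * mkdv_q u (Suc n - j) x))"

definition S_smooth :: "nat \<Rightarrow> tfun \<times> tfun \<Rightarrow> complex" where
  "S_smooth n \<phi> = (LINT x|torus. fst \<phi> x * nls_r \<phi> n x)"

definition K_smooth :: "nat \<Rightarrow> tfun \<Rightarrow> complex" where
  "K_smooth m u = 1 / 2 * (LINT x|torus. mkdv_q u (2 * m - 1) x)"

text \<open>The index \<open>n div 2\<close> is \<open>m\<close> for \<open>n = 2m\<close> and \<open>m - 1\<close> for \<open>n = 2m - 1\<close>.\<close>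

definition nls_S :: "nat \<Rightarrow> tfun \<times> tfun \<Rightarrow> complex" where
  "nls_S n = cont_extension (sobolev (n div 2) \<times> sobolev (n div 2)) (sob_norm2 (n div 2))
     (smooth_per \<times> smooth_per) (S_smooth n)"

definition mkdv_K :: "nat \<Rightarrow> tfun \<Rightarrow> complex" where
  "mkdv_K m = cont_extension (sobolev (m - 1)) (sob_norm (m - 1)) smooth_per (K_smooth m)"

end

theory Submission imports Defs begin

text \<open>Both recursions are Riccati equations for generating series. Write \<open>\<phi> = (p, s)\<close>, \<open>r = \<Sum> r_n z^n\<close> and
  \<open>q = \<Sum> q_n z^n\<close>; then
  \<open>r = z (s - \<i> r' + p r^2)\<close> and \<open>q = z (B - \<i> q' + q^2)\<close>. The theorem is a comparison of these two
  equations on the diagonal \<open>p = s = u\<close>, where \<open>B = u' + u^2\<close>.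

  \<^emph>\<open>Gradients.\<close> Linearise the first equation and let \<open>b\<close> solve the adjoint linear equation
  \<open>b = z (p + \<i> b' + 2 p r b)\<close>. Then the series of gradients of \<open>\<Sum> S_n z^n\<close> are
  \<open>a = r + r^2 b\<close> (with respect to \<open>p\<close>) and \<open>b\<close> (with respect to \<open>s\<close>), see \<open>gradient_formula\<close>.
  With \<open>w = 1 + 2 r b\<close> they satisfy
  \<open>a = z (s w - \<i> a')\<close>, \<open>b = z (p w + \<i> b')\<close> and \<open>w^2 = 1 + 4 a b\<close>.
  On the diagonal the substitution of \<open>-z\<close> for \<open>z\<close> exchanges \<open>a\<close> with \<open>-b\<close> and fixes \<open>w\<close>. Hence \<open>w\<close> has no odd
  coefficients, \<open>a_n = b_n\<close> for odd \<open>n\<close>, and \<open>a_(n+1) = - \<i> a_n'\<close>, \<open>b_(n+1) = \<i> a_n'\<close> for odd \<open>n\<close>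
  (\<open>diagonal_gradients\<close>). So both components of the Hamiltonian vector field of \<open>S_(2m)\<close> are \<open>a_(2m-1)'\<close>.

  \<^emph>\<open>The mKdV Hamiltonians.\<close> Factorising the Schroedinger operator with potential \<open>B\<close> turns the second
  Riccati equation into the first one by a fractional linear map. The result is
  \<open>q = u r + r' / (1 + \<i> r)\<close> (\<open>mkdv_s_conv_nls_s\<close>). The last term is a logarithmic derivative and integrates
  to 0, so \<open>K_m\<close> is one half of the restriction of \<open>S_(2m-1)\<close>, with gradient
  \<open>(a_(2m-1) + b_(2m-1)) / 2 = a_(2m-1)\<close>. This is the asserted identity. The even part of \<open>q\<close> is also a
  logarithmic derivative, hence \<open>S_(2m)\<close> vanishes on the diagonal (\<open>I_mkdv_even\<close>).

  \<^emph>\<open>Low regularity.\<close> All this is algebra for smooth \<open>u\<close>. It passes to Sobolev spaces because a functional on a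
  dense subspace that is differentiable with locally Lipschitz differential extends continuously together with
  its differential (\<open>C11_extension\<close>). The functionals qualify since they are integrals of differential
  polynomials: integrating by parts one arranges that one factor carries \<open>m\<close> derivatives and is measured
  in \<open>L^2\<close>, while all other factors carry fewer and are measured in the supremum norm
  (\<open>C11_integral_diffpoly\<close>). The two inequalities needed, \<open>L^2\<close> and supremum norm against weighted sums of Fourier
  coefficients, come from Bessel's inequality and Chernoff's proof that Fourier series of
  smooth functions converge pointwise (\<open>sup_norm_le_sob_norm\<close>).\<close>

unbundle no vec_syntax
unbundle fps_syntax

section \<open>Differential rings and the two recursions\<close>

text \<open>The algebra of the hierarchies takes place in any commutative ring with a derivation, a square root of \<open>-1\<close> that is
  constant, and an additive functional that annihilates derivatives.\<close>

locale differential_ring =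
  fixes D :: "'a::comm_ring_1 \<Rightarrow> 'a" and i :: 'a and I :: "'a \<Rightarrow> complex"
  assumes D_add: "D (f + g) = D f + D g"
    and D_mult: "D (f * g) = D f * g + f * D g"
    and D_i: "D i = 0"
    and i_sq: "i * i = - 1"
    and I_add: "I (f + g) = I f + I g"
    and I_i: "I (i * f) = \<i> * I f"
    and I_D: "I (D f) = 0"
begin

lemma D_0 [simp]: "D 0 = 0"
  using D_add[of 0 0] by simp

lemma D_1 [simp]: "D 1 = 0"
  using D_mult[of 1 1] by simp

lemma D_minus: "D (- f) = - D f"
  using D_add[of f "- f"] by (simp add: eq_neg_iff_add_eq_0 add.commute)

lemma D_diff: "D (f - g) = D f - D g"
  using D_add[of f "- g"] by (simp add: D_minus)

lemma D_sum: "D (sum f A) = (\<Sum>x\<in>A. D (f x))"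
  by (induction A rule: infinite_finite_induct) (auto simp: D_add)

lemma I_0 [simp]: "I 0 = 0"
  using I_add[of 0 0] by simp

lemma I_minus: "I (- f) = - I f"
  using I_add[of f "- f"] by (simp add: eq_neg_iff_add_eq_0 add.commute)

lemma I_diff: "I (f - g) = I f - I g"
  using I_add[of f "- g"] by (simp add: I_minus)

lemma I_sum: "I (sum f A) = (\<Sum>x\<in>A. I (f x))"
  by (induction A rule: infinite_finite_induct) (auto simp: I_add)

lemma I_of_nat_mult: "I (of_nat k * f) = of_nat k * I f"
  by (induction k) (auto simp: I_add algebra_simps)

lemma I_parts: "I (D f * g) = - I (f * D g)"
  using I_D[of "f * g"] by (simp add: D_mult I_add eq_neg_iff_add_eq_0)

text \<open>Coefficientwise derivation. The variable of the power series is the spectral parameter, on which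
  the derivation does not act.\<close>

definition Ds :: "'a fps \<Rightarrow> 'a fps" where
  "Ds F = Abs_fps (\<lambda>n. D (F $ n))"

lemma Ds_nth [simp]: "Ds F $ n = D (F $ n)"
  by (simp add: Ds_def)

lemma Ds_add: "Ds (F + G) = Ds F + Ds G"
  by (simp add: fps_eq_iff D_add)

lemma Ds_minus: "Ds (- F) = - Ds F"
  by (simp add: fps_eq_iff D_minus)

lemma Ds_diff: "Ds (F - G) = Ds F - Ds G"
  by (simp add: fps_eq_iff D_diff)

lemma Ds_mult: "Ds (F * G) = Ds F * G + F * Ds G"
  by (simp add: fps_eq_iff fps_mult_nth D_sum D_mult sum.distrib)

lemma Ds_1 [simp]: "Ds 1 = 0"
  by (simp add: fps_eq_iff)

lemma Ds_const: "Ds (fps_const c) = fps_const (D c)"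
  by (simp add: fps_eq_iff)

lemma Ds_X [simp]: "Ds fps_X = 0"
  by (simp add: fps_eq_iff fps_X_def)

abbreviation ii :: "'a fps" where "ii \<equiv> fps_const i"

lemma ii_sq: "ii * ii = - 1"
  by (simp add: i_sq flip: fps_const_neg)

lemma ii_ii: "ii * (ii * F) = - F"
  by (metis ii_sq mult.assoc mult_minus1)

lemma Ds_2 [simp]: "Ds 2 = 0"
  using Ds_add[of 1 1] by simp

lemma Ds_ii [simp]: "Ds ii = 0"
  by (simp add: Ds_const D_i)

lemma Ds_power_Suc: "Ds (F ^ Suc k) = of_nat (Suc k) * (Ds F * F ^ k)"
  by (induction k) (auto simp: Ds_mult algebra_simps)

text \<open>The coefficients of a logarithmic derivative are derivatives of the coefficients of the series \<open>log (1 + F)\<close>.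
  Modulo terms of order above \<open>n\<close>, the factor \<open>T = 1 / (1 + F)\<close> is a geometric sum, and \<open>F' F^k\<close> is the
  derivative of \<open>F^(k+1) / (k + 1)\<close>; multiplying by \<open>k + 1\<close> avoids division in the ring.\<close>

lemma I_log_derivative:
  assumes F0: "F $ 0 = 0" and T: "T * (1 + F) = 1"
  shows "I ((Ds F * T) $ n) = 0"
proof -
  have pw: "I ((Ds F * F ^ k) $ n) = 0" for k
  proof -
    have "of_nat (Suc k) * (Ds F * F ^ k) $ n = D ((F ^ Suc k) $ n)"
      by (metis Ds_nth Ds_power_Suc fps_mult_left_const_nth fps_of_nat)
    then have "of_nat (Suc k) * I ((Ds F * F ^ k) $ n) = 0"
      by (metis I_D I_of_nat_mult)
    then show ?thesis by (simp del: of_nat_Suc)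
  qed
  have expand: "T = (\<Sum>k<N. (-1) ^ k * F ^ k) + (-1) ^ N * F ^ N * T" for N
  proof (induction N)
    case (Suc N)
    have "(-1) ^ N * F ^ N * T = (-1) ^ N * F ^ N * (T * (1 + F) - F * T)"
      by (simp add: algebra_simps)
    also have "\<dots> = (-1) ^ N * F ^ N + (-1) ^ Suc N * F ^ Suc N * T"
      unfolding T by (simp add: algebra_simps)
    finally show ?case using Suc by (simp add: add.assoc del: power_Suc)
  qed simp
  have low: "(F ^ Suc n * G) $ n = 0" for G
  proof -
    have "(F ^ Suc n) $ k = 0" if "k \<le> n" for k
      using that F0 by (intro startsby_zero_power_prefix[rule_format]) auto
    then show ?thesis by (simp add: fps_mult_nth)
  qed
  have "Ds F * T = (\<Sum>k<Suc n. (-1) ^ k * (Ds F * F ^ k)) + F ^ Suc n * ((-1) ^ Suc n * T * Ds F)"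
    using arg_cong[OF expand[of "Suc n"], of "\<lambda>x. Ds F * x"]
    by (simp add: algebra_simps sum_distrib_left)
  then have "(Ds F * T) $ n = (\<Sum>k<Suc n. ((-1) ^ k * (Ds F * F ^ k)) $ n)"
    by (simp add: fps_sum_nth low del: sum.lessThan_Suc power_Suc)
  moreover have "I (((-1) ^ k * (Ds F * F ^ k)) $ n) = 0" for k
    by (cases "even k") (simp_all add: I_minus pw)
  ultimately show ?thesis by (simp add: I_sum del: sum.lessThan_Suc)
qed

text \<open>The recursions of the two hierarchies over an abstract ring. For smooth functions they are identified with
  \<^const>\<open>nls_r\<close> and \<^const>\<open>mkdv_q\<close> in \<open>nls_r_eq\<close> and \<open>mkdv_q_eq\<close>.\<close>

fun nls :: "'a \<times> 'a \<Rightarrow> nat \<Rightarrow> 'a" where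
  "nls v 0 = 0"
| "nls v (Suc 0) = snd v"
| "nls v (Suc (Suc n)) = - i * D (nls v (Suc n))
     + fst v * (\<Sum>j\<in>{1..n}. nls v j * nls v (Suc n - j))"

text \<open>The recursion differentiated at \<open>v\<close> in direction \<open>h\<close>.\<close>

fun dnls :: "'a \<times> 'a \<Rightarrow> 'a \<times> 'a \<Rightarrow> nat \<Rightarrow> 'a" where
  "dnls v h 0 = 0"
| "dnls v h (Suc 0) = snd h"
| "dnls v h (Suc (Suc n)) = - i * D (dnls v h (Suc n))
     + (fst h * (\<Sum>j\<in>{1..n}. nls v j * nls v (Suc n - j))
     + fst v * (\<Sum>j\<in>{1..n}. dnls v h j * nls v (Suc n - j) + nls v j * dnls v h (Suc n - j)))"

fun mkdv :: "'a \<Rightarrow> nat \<Rightarrow> 'a" where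
  "mkdv u 0 = 0"
| "mkdv u (Suc 0) = D u + u\<^sup>2"
| "mkdv u (Suc (Suc n)) = - i * D (mkdv u (Suc n))
     + (\<Sum>j\<in>{1..n}. mkdv u j * mkdv u (Suc n - j))"

text \<open>Coefficients of the solution of the adjoint of the linearised recursion. They turn out to be the gradients
  with respect to the second component.\<close>

fun adjoint_b :: "'a \<times> 'a \<Rightarrow> nat \<Rightarrow> 'a" where
  "adjoint_b v 0 = 0"
| "adjoint_b v (Suc n) = (if n = 0 then fst v else 0) + i * D (adjoint_b v n)
     + 2 * fst v * (\<Sum>j\<in>{0..n}. adjoint_b v j * nls v (n - j))"

definition nls_s :: "'a \<times> 'a \<Rightarrow> 'a fps" where "nls_s v = Abs_fps (nls v)"
definition dnls_s :: "'a \<times> 'a \<Rightarrow> 'a \<times> 'a \<Rightarrow> 'a fps" where "dnls_s v h = Abs_fps (dnls v h)"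
definition b_s :: "'a \<times> 'a \<Rightarrow> 'a fps" where "b_s v = Abs_fps (adjoint_b v)"
definition mkdv_s :: "'a \<Rightarrow> 'a fps" where "mkdv_s u = Abs_fps (mkdv u)"

text \<open>The gradients with respect to the first component (see \<open>gradient_formula\<close>).\<close>

definition a_s :: "'a \<times> 'a \<Rightarrow> 'a fps" where
  "a_s v = nls_s v + nls_s v * nls_s v * b_s v"

text \<open>In spectral terms \<open>a\<close> and \<open>b\<close> are the off-diagonal entries and \<open>w\<close> the diagonal entry of a traceless matrix of
  products of eigenfunctions of the Zakharov--Shabat operator; \<open>w_s_sq\<close> below normalises its determinant.\<close>

definition w_s :: "'a \<times> 'a \<Rightarrow> 'a fps" where
  "w_s v = 1 + 2 * nls_s v * b_s v"

lemma fps_mult_nth_Suc: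
  fixes F G :: "'a fps"
  assumes "F $ 0 = 0" "G $ 0 = 0"
  shows "(F * G) $ Suc n = (\<Sum>j\<in>{1..n}. F $ j * G $ (Suc n - j))"
proof -
  have "(F * G) $ Suc n = (\<Sum>j\<in>{0..n}. F $ j * G $ (Suc n - j))"
    using assms by (simp add: fps_mult_nth)
  also have "\<dots> = (\<Sum>j\<in>{1..n}. F $ j * G $ (Suc n - j))"
    by (rule sum.mono_neutral_right) (use assms in \<open>auto simp: not_le\<close>)
  finally show ?thesis .
qed

lemma fps_X_cancel: "F = G" if "fps_X * F = fps_X * G" for F G :: "'a fps"
proof (rule fps_ext)
  fix n show "F $ n = G $ n" using arg_cong[OF that, of "\<lambda>F. F $ Suc n"] by simp
qed

lemma fps_X_eqI:
  fixes F G :: "'a fps"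
  assumes "F $ 0 = 0" and "\<And>n. F $ Suc n = G $ n"
  shows "F = fps_X * G"
proof (rule fps_ext)
  fix n show "F $ n = (fps_X * G) $ n"
    using assms by (cases n) auto
qed

lemma fps_two_nth: "(2 * F) $ n = 2 * (F $ n)" for F :: "'a fps"
  by (metis fps_mult_left_const_nth numeral_fps_const)

lemma fps_four_nth: "(4 * F) $ n = 4 * (F $ n)" for F :: "'a fps"
  by (metis fps_mult_left_const_nth numeral_fps_const)

lemma nls_s_eq:
  "nls_s v = fps_X * (fps_const (snd v) - ii * Ds (nls_s v) + fps_const (fst v) * (nls_s v * nls_s v))"
proof (rule fps_X_eqI)
  fix n show "nls_s v $ Suc n = (fps_const (snd v) - ii * Ds (nls_s v)
      + fps_const (fst v) * (nls_s v * nls_s v)) $ n"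
  proof (cases n)
    case (Suc k)
    have "(nls_s v * nls_s v) $ Suc k = (\<Sum>j\<in>{1..k}. nls v j * nls v (Suc k - j))"
      by (subst fps_mult_nth_Suc) (simp_all add: nls_s_def)
    then show ?thesis by (simp add: Suc) (simp add: nls_s_def)
  qed (simp add: nls_s_def)
qed (simp add: nls_s_def)

lemma dnls_s_eq:
  "dnls_s v h = fps_X * (fps_const (snd h) - ii * Ds (dnls_s v h)
     + fps_const (fst h) * (nls_s v * nls_s v) + 2 * (fps_const (fst v) * (nls_s v * dnls_s v h)))"
proof (rule fps_X_eqI)
  fix n
  show "dnls_s v h $ Suc n = (fps_const (snd h) - ii * Ds (dnls_s v h)
     + fps_const (fst h) * (nls_s v * nls_s v) + 2 * (fps_const (fst v) * (nls_s v * dnls_s v h))) $ n"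
  proof (cases n)
    case (Suc k)
    have 1: "(nls_s v * nls_s v) $ Suc k = (\<Sum>j\<in>{1..k}. nls v j * nls v (Suc k - j))"
      by (subst fps_mult_nth_Suc) (simp_all add: nls_s_def)
    have 2: "(nls_s v * dnls_s v h) $ Suc k = (\<Sum>j\<in>{1..k}. nls v j * dnls v h (Suc k - j))"
      by (subst fps_mult_nth_Suc) (simp_all add: nls_s_def dnls_s_def)
    have 3: "(dnls_s v h * nls_s v) $ Suc k = (\<Sum>j\<in>{1..k}. dnls v h j * nls v (Suc k - j))"
      by (subst fps_mult_nth_Suc) (simp_all add: nls_s_def dnls_s_def)
    have "2 * (nls_s v * dnls_s v h) $ Suc k
      = (\<Sum>j\<in>{1..k}. dnls v h j * nls v (Suc k - j) + nls v j * dnls v h (Suc k - j))"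
      unfolding mult_2 sum.distrib using 2 3 by (simp add: mult.commute)
    then have "dnls v h (Suc (Suc k)) = - i * D (dnls v h (Suc k))
       + (fst h * (nls_s v * nls_s v) $ Suc k + fst v * (2 * (nls_s v * dnls_s v h) $ Suc k))"
      by (simp only: dnls.simps 1)
    then show ?thesis
      by (simp only: Suc fps_add_nth fps_sub_nth fps_two_nth fps_mult_left_const_nth Ds_nth)
         (simp add: dnls_s_def algebra_simps del: dnls.simps)
  qed (simp add: nls_s_def dnls_s_def fps_two_nth)
qed (simp add: dnls_s_def)

lemma mkdv_s_eq:
  "mkdv_s u = fps_X * (fps_const (D u + u * u) - ii * Ds (mkdv_s u) + mkdv_s u * mkdv_s u)"
proof (rule fps_X_eqI)
  fix n show "mkdv_s u $ Suc n = (fps_const (D u + u * u) - ii * Ds (mkdv_s u)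
      + mkdv_s u * mkdv_s u) $ n"
  proof (cases n)
    case (Suc k)
    have "(mkdv_s u * mkdv_s u) $ Suc k = (\<Sum>j\<in>{1..k}. mkdv u j * mkdv u (Suc k - j))"
      by (subst fps_mult_nth_Suc) (simp_all add: mkdv_s_def)
    then show ?thesis by (simp add: Suc) (simp add: mkdv_s_def)
  qed (simp add: mkdv_s_def power2_eq_square)
qed (simp add: mkdv_s_def)

lemma b_s_eq:
  "b_s v = fps_X * (fps_const (fst v) * w_s v + ii * Ds (b_s v))"
proof (rule fps_X_eqI)
  fix n
  have "fps_const (fst v) * w_s v + ii * Ds (b_s v)
     = fps_const (fst v) + ii * Ds (b_s v) + 2 * (fps_const (fst v) * (b_s v * nls_s v))"
    by (simp add: w_s_def algebra_simps)
  moreover have "(b_s v * nls_s v) $ n = (\<Sum>j\<in>{0..n}. adjoint_b v j * nls v (n - j))"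
    by (simp add: fps_mult_nth b_s_def nls_s_def)
  ultimately show "b_s v $ Suc n = (fps_const (fst v) * w_s v + ii * Ds (b_s v)) $ n"
    by (simp only: fps_add_nth fps_two_nth fps_mult_left_const_nth Ds_nth fps_nth_fps_const)
       (simp add: b_s_def mult.assoc)
qed (simp add: b_s_def)

text \<open>The right-hand side of the Riccati equation determines each coefficient from the preceding ones.\<close>

lemma mkdv_unique:
  fixes Q :: "'a fps"
  assumes Q: "Q = fps_X * (fps_const (D u + u * u) - ii * Ds Q + Q * Q)"
  shows "Q = mkdv_s u"
proof -
  have "Q $ n = mkdv_s u $ n" for n
  proof (induction n rule: less_induct)
    case (less n)
    show ?case
    proof (cases n)
      case 0
      show ?thesis by (subst Q, subst mkdv_s_eq) (simp add: 0)
    next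
      case (Suc k)
      have "(Q * Q) $ k = (mkdv_s u * mkdv_s u) $ k"
        unfolding fps_mult_nth using less Suc by (intro sum.cong) auto
      moreover have "Q $ k = mkdv_s u $ k" using less Suc by auto
      ultimately show ?thesis
        by (subst Q, subst mkdv_s_eq) (simp add: Suc)
    qed
  qed
  then show ?thesis by (simp add: fps_eq_iff)
qed

text \<open>Pairing the linearised equation with \<open>b\<close> and the adjoint equation with \<open>\<rho>\<close>, the terms without derivative
  cancel and the terms with a derivative combine to \<open>- \<i> (b \<rho>)'\<close>.\<close>

lemma I_adjoint:
  "I (fst v * dnls v h n) = I ((b_s v * fps_const (snd h) + nls_s v * nls_s v * b_s v * fps_const (fst h)) $ n)"
proof -
  define p where "p = fps_const (fst v)"
  define r where "r = nls_s v"
  define \<rho> where "\<rho> = dnls_s v h"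
  define g where "g = b_s v"
  define h1 h2 where "h1 = fps_const (fst h)" and "h2 = fps_const (snd h)"
  let ?X = "fps_X :: 'a fps"
  have \<rho>: "\<rho> = ?X * (h2 - ii * Ds \<rho> + h1 * (r * r) + 2 * (p * (r * \<rho>)))"
    unfolding \<rho>_def h2_def h1_def r_def p_def by (rule dnls_s_eq)
  have g: "g = ?X * (p * (1 + 2 * r * g) + ii * Ds g)"
    using b_s_eq[of v] unfolding g_def p_def r_def w_s_def .
  have "?X * (p * \<rho> - g * (h2 + h1 * (r * r)))
     = \<rho> * (?X * (p * (1 + 2 * r * g) + ii * Ds g)) - g * (?X * (h2 - ii * Ds \<rho> + h1 * (r * r) + 2 * (p * (r * \<rho>))))
       - ?X * (ii * (Ds g * \<rho> + g * Ds \<rho>))"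
    by (simp add: algebra_simps)
  also have "\<dots> = ?X * (- (ii * Ds (g * \<rho>)))"
    unfolding g[symmetric] \<rho>[symmetric] Ds_mult by (simp add: algebra_simps)
  finally have "p * \<rho> - g * (h2 + h1 * (r * r)) = - (ii * Ds (g * \<rho>))"
    by (rule fps_X_cancel)
  then have "I ((p * \<rho> - g * (h2 + h1 * (r * r))) $ n) = 0"
    by (simp add: I_minus I_i I_D)
  then show ?thesis
    by (simp add: I_diff p_def \<rho>_def dnls_s_def g_def h1_def h2_def r_def algebra_simps)
qed

lemma gradient_formula:
  "I (fst h * nls v n + fst v * dnls v h n) = I (a_s v $ n * fst h) + I (b_s v $ n * snd h)"
proof -
  have "I (fst h * nls v n + fst v * dnls v h n) = I (fst h * nls v n)
     + I (b_s v $ n * snd h) + I ((nls_s v * nls_s v * b_s v) $ n * fst h)"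
    by (simp add: I_add I_adjoint)
  then show ?thesis
    by (simp add: a_s_def nls_s_def algebra_simps I_add)
qed

text \<open>The first component obeys the same kind of equation as \<open>b_s_eq\<close>, with the opposite sign of the derivative:
  insert the equations for \<open>r\<close> and \<open>b\<close> into the derivative of \<open>r + r^2 b\<close>.\<close>

lemma a_s_eq: "a_s v = fps_X * (fps_const (snd v) * w_s v - ii * Ds (a_s v))"
proof -
  define p where "p = fps_const (fst v)"
  define s where "s = fps_const (snd v)"
  define r where "r = nls_s v"
  define g where "g = b_s v"
  let ?X = "fps_X :: 'a fps"
  have r: "r = ?X * (s - ii * Ds r + p * (r * r))"
    unfolding s_def r_def p_def by (rule nls_s_eq)
  have g: "g = ?X * (p * (1 + 2 * r * g) + ii * Ds g)"
    using b_s_eq[of v] unfolding g_def p_def r_def w_s_def .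
  have "?X * (s * (1 + 2 * r * g) - ii * Ds (r + r * r * g))
      = (1 + 2 * r * g) * (?X * (s - ii * Ds r + p * (r * r)))
        - r * r * (?X * (p * (1 + 2 * r * g) + ii * Ds g))"
    by (simp add: algebra_simps Ds_mult Ds_add)
  also have "\<dots> = r + r * r * g"
    unfolding g[symmetric] r[symmetric] by (simp add: algebra_simps)
  finally show ?thesis
    by (simp add: a_s_def w_s_def p_def s_def r_def g_def)
qed

lemma w_s_sq: "w_s v * w_s v = 1 + 4 * a_s v * b_s v"
  by (simp add: w_s_def a_s_def algebra_simps)

lemma a_s_0 [simp]: "a_s v $ 0 = 0"
  by (subst a_s_eq) simp

lemma b_s_0 [simp]: "b_s v $ 0 = 0"
  by (subst b_s_eq) simp

lemma w_s_0 [simp]: "w_s v $ 0 = 1"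
  by (simp add: w_s_def nls_s_def)

text \<open>Since \<open>w\<close> has constant term 1, the relation \<open>w^2 = 1 + 4 a b\<close> determines \<open>w\<close> from \<open>a b\<close>. This replaces the
  nonlocal formula for \<open>w\<close> that results from integrating its derivative.\<close>

lemma w_s_nth:
  assumes "n > 0"
  shows "2 * w_s v $ n = 4 * (\<Sum>j=0..n. a_s v $ j * b_s v $ (n - j)) - (\<Sum>j\<in>{0<..<n}. w_s v $ j * w_s v $ (n - j))"
proof -
  have "(w_s v * w_s v) $ n = 4 * (a_s v * b_s v) $ n"
    unfolding w_s_sq mult.assoc using assms by (simp add: fps_four_nth)
  moreover have "{0..n} = insert 0 (insert n {0<..<n})" using assms by auto
  then have "(w_s v * w_s v) $ n = 2 * w_s v $ n + (\<Sum>j\<in>{0<..<n}. w_s v $ j * w_s v $ (n - j))"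
    using assms by (simp add: fps_mult_nth algebra_simps)
  ultimately show ?thesis by (simp add: fps_mult_nth algebra_simps)
qed

text \<open>The equations for \<open>a\<close>, \<open>b\<close> and \<open>w\<close> on the diagonal are invariant under the substitution
  \<open>(a, b, w) (z) \<mapsto> (- b, - a, w) (- z)\<close>, and they have only one solution.\<close>

lemma diagonal_parity:
  assumes half: "\<And>f::'a. 2 * f = 0 \<Longrightarrow> f = 0"
  shows "a_s (u, u) $ n = - ((-1) ^ n) * b_s (u, u) $ n \<and> (odd n \<longrightarrow> w_s (u, u) $ n = 0)"
proof (induction n rule: less_induct)
  case (less n)
  let ?a = "a_s (u, u)" and ?b = "b_s (u, u)" and ?w = "w_s (u, u)"
  have ab: "?a $ n = - ((-1) ^ n) * ?b $ n"
  proof (cases n)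
    case (Suc k)
    have IH: "?a $ k = - ((-1) ^ k) * ?b $ k" "odd k \<Longrightarrow> ?w $ k = 0"
      using less.IH[of k] Suc by auto
    have "?a $ n = u * ?w $ k - i * D (?a $ k)"
      by (subst a_s_eq) (simp add: Suc)
    moreover have "?b $ n = u * ?w $ k + i * D (?b $ k)"
      by (subst b_s_eq) (simp add: Suc)
    ultimately show ?thesis
      using IH by (cases "even k") (auto simp: Suc D_minus)
  qed simp
  have IH: "?a $ k = - ((-1) ^ k) * ?b $ k" if "k \<le> n" for k
    using less.IH[of k] ab that by (cases "k = n") auto
  have w0: "?w $ n = 0" if odd: "odd n"
  proof -
    \<comment> \<open>the summands at \<open>j\<close> and \<open>n - j\<close> cancel, as exactly one of the two indices is even\<close>
    have "2 * (\<Sum>j=0..n. ?a $ j * ?b $ (n - j)) =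
       (\<Sum>j=0..n. ?a $ j * ?b $ (n - j)) + (\<Sum>j=0..n. ?a $ (n - j) * ?b $ j)"
      using sum.atLeastAtMost_rev[of "\<lambda>j. ?a $ j * ?b $ (n - j)" 0 n] by simp
    also have "\<dots> = (\<Sum>j=0..n. ?a $ j * ?b $ (n - j) + ?a $ (n - j) * ?b $ j)"
      by (simp add: sum.distrib)
    also have "\<dots> = 0"
    proof (rule sum.neutral, safe)
      fix j assume "j \<in> {0..n}"
      then show "?a $ j * ?b $ (n - j) + ?a $ (n - j) * ?b $ j = 0"
        using IH[of j] IH[of "n - j"] odd by (cases "even j") auto
    qed
    finally have s1: "(\<Sum>j=0..n. ?a $ j * ?b $ (n - j)) = 0" by (rule half)
    have s2: "(\<Sum>j\<in>{0<..<n}. ?w $ j * ?w $ (n - j)) = 0"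
    proof (rule sum.neutral, safe)
      fix j assume "j \<in> {0<..<n}"
      then show "?w $ j * ?w $ (n - j) = 0"
        using less.IH[of j] less.IH[of "n - j"] odd by (cases "even j") auto
    qed
    have "n > 0" using odd by (cases n) auto
    from w_s_nth[OF this, of "(u, u)"] s1 s2 show ?thesis by (simp add: half)
  qed
  show ?case by (intro conjI impI ab w0)
qed

text \<open>At odd \<open>n\<close> the multiplication by \<open>w\<close> contributes nothing, so that the next gradient is just a derivative.\<close>

lemma diagonal_gradients:
  assumes half: "\<And>f::'a. 2 * f = 0 \<Longrightarrow> f = 0" and n: "odd n"
  shows "b_s (u, u) $ n = a_s (u, u) $ n"
    and "a_s (u, u) $ Suc n = - i * D (a_s (u, u) $ n)"
    and "b_s (u, u) $ Suc n = i * D (a_s (u, u) $ n)"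
proof -
  show ba: "b_s (u, u) $ n = a_s (u, u) $ n"
    using diagonal_parity[OF half, of u n] n by simp
  have w: "w_s (u, u) $ n = 0" using diagonal_parity[OF half, of u n] n by simp
  show "a_s (u, u) $ Suc n = - i * D (a_s (u, u) $ n)"
    by (subst a_s_eq) (simp add: w)
  show "b_s (u, u) $ Suc n = i * D (a_s (u, u) $ n)"
    by (subst b_s_eq) (simp add: w ba)
qed

text \<open>The Miura factorisation of \<open>y'' = (B - \<beta>^2) y\<close>, where \<open>2 \<beta> z = 1\<close>, into \<open>y' = u y + \<i> \<beta> p\<close> and
  \<open>p' = - u p + \<i> \<beta> y\<close> makes \<open>f = y + p\<close> and \<open>g = y - p\<close> a solution of the Zakharov--Shabat system with
  potential \<open>(u, u)\<close>, and \<open>\<i> r = f / g\<close>. Since \<open>q = \<beta> - \<i> y' / y\<close>, this gives the formula; equivalently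
  \<open>z q = 1 - \<i> z u - 1 / (1 + \<i> r)\<close>. The proof verifies that the right-hand side solves the Riccati equation for
  \<open>q\<close>, in which \<open>T\<close> stands for \<open>1 / (1 + \<i> r)\<close>.\<close>

lemma mkdv_s_conv_nls_s:
  fixes r :: "'a fps"
  assumes r_def: "r = nls_s (u, u)" and T: "T * (1 + ii * r) = 1"
  shows "mkdv_s u = fps_const u * r + Ds r * T"
proof -
  \<comment> \<open>keeps \<open>ii * ii\<close> from being merged into a constant\<close>
  note [simp del] = fps_const_mult fps_const_neg
  define U where "U = fps_const u"
  let ?X = "fps_X :: 'a fps"
  have r: "r = ?X * (U - ii * Ds r + U * (r * r))"
    using nls_s_eq[of "(u, u)"] by (simp add: U_def r_def)
  define Q where "Q = U * r + Ds r * T"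
  have irt: "ii * r * T = 1 - T" using T by (simp add: algebra_simps)
  have rt: "r * T = ii * T - ii"
  proof -
    have "r * T = - (ii * (ii * r * T))" by (simp add: mult.assoc ii_ii)
    then show ?thesis unfolding irt by (simp add: algebra_simps)
  qed
  have XDr: "?X * Ds r = ii * (r - ?X * U - ?X * U * (r * r))"
  proof -
    have "ii * (r - ?X * U - ?X * U * (r * r)) = ii * (- (?X * (ii * Ds r)))"
      by (subst (1) r) (simp add: algebra_simps)
    also have "\<dots> = - (ii * (ii * (?X * Ds r)))" by (simp add: algebra_simps)
    finally show ?thesis by (simp add: ii_ii)
  qed
  have XQ: "?X * Q = 1 - ii * ?X * U - T"
  proof -
    have "?X * Q = ?X * U * r + (?X * Ds r) * T" by (simp add: Q_def algebra_simps)
    also have "\<dots> = ?X * U * r + (ii * r * T) - ii * ?X * U * T - ?X * U * r * (ii * r * T)"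
      unfolding XDr by (simp add: algebra_simps)
    also have "\<dots> = 1 - T - ii * ?X * U * T + ?X * U * (r * T)"
      unfolding irt by (simp add: algebra_simps)
    also have "\<dots> = 1 - ii * ?X * U - T"
      unfolding rt by (simp add: algebra_simps)
    finally show ?thesis .
  qed
  have DT: "Ds T = - (ii * (Ds r * T) * T)"
  proof -
    have "Ds (T * (1 + ii * r)) * T = 0" by (simp add: T)
    moreover have "Ds (T * (1 + ii * r)) * T = Ds T * (T * (1 + ii * r)) + ii * (Ds r * T) * T"
      by (simp add: Ds_mult Ds_add algebra_simps)
    ultimately show ?thesis by (simp add: T eq_neg_iff_add_eq_0)
  qed
  have XDrTT: "?X * Ds r * T * T = T - T * T + ii * ?X * U * (1 - 2 * T)"
  proof -
    have "?X * Ds r * T * T = ii * (r * T * T - ?X * U * T * T - ?X * U * (r * T) * (r * T))"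
      unfolding XDr by (simp add: algebra_simps)
    also have "\<dots> = T - T * T + ii * ?X * U * (1 - 2 * T)"
      unfolding rt by (simp add: algebra_simps ii_ii ii_sq)
    finally show ?thesis .
  qed
  have "?X * Q = ?X * (?X * (fps_const (D u + u * u) - ii * Ds Q + Q * Q))"
  proof -
    have "?X * (?X * (fps_const (D u + u * u) - ii * Ds Q + Q * Q))
      = ?X * ?X * (Ds U + U * U) - ii * ?X * Ds (?X * Q) + (?X * Q) * (?X * Q)"
      by (simp add: Ds_mult U_def Ds_const algebra_simps flip: fps_const_add fps_const_mult)
    also have "\<dots> = ?X * ?X * (Ds U + U * U) + (ii * ii) * ?X * ?X * Ds U
        - (?X * Ds r * T * T) * (ii * ii) + (1 - ii * ?X * U - T) * (1 - ii * ?X * U - T)"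
      unfolding XQ by (simp add: Ds_mult Ds_diff Ds_add DT algebra_simps)
    also have "\<dots> = ?X * ?X * (U * U) + (T - T * T) + ii * ?X * U * (1 - 2 * T)
        + (1 - T) * (1 - T) - 2 * ii * ?X * U * (1 - T) + (ii * ii) * ?X * ?X * U * U"
      unfolding XDrTT ii_sq by (simp add: algebra_simps ii_sq ii_ii)
    also have "\<dots> = 1 - ii * ?X * U - T"
      unfolding ii_sq by (simp add: algebra_simps)
    finally show ?thesis using XQ by simp
  qed
  then have "Q = mkdv_s u"
    by (rule mkdv_unique[OF fps_X_cancel])
  then show ?thesis by (simp add: Q_def U_def)
qed

lemma I_nls_diagonal: "I (u * nls (u, u) n) = I (mkdv u n)"
proof -
  let ?r = "nls_s (u, u)"
  define T where "T = fps_right_inverse (1 + ii * ?r) 1"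
  have r0: "?r $ 0 = 0" by (simp add: nls_s_def)
  have T: "T * (1 + ii * ?r) = 1"
    using fps_right_inverse[of "1 + ii * ?r" 1] r0 by (simp add: T_def mult.commute)
  have "I ((Ds (ii * ?r) * T) $ n) = 0"
    by (rule I_log_derivative) (use T r0 in auto)
  then have "I ((Ds ?r * T) $ n) = 0"
    by (simp add: Ds_mult mult.assoc I_i)
  then have "I (mkdv_s u $ n) = I ((fps_const u * ?r) $ n)"
    unfolding mkdv_s_conv_nls_s[OF refl T] by (simp add: I_add)
  then show ?thesis by (simp add: mkdv_s_def nls_s_def)
qed

text \<open>Let \<open>e\<close> and \<open>p\<close> be the even and odd parts of \<open>q\<close>. The part of the Riccati equation that is odd after division by
  \<open>z\<close> is linear in \<open>e\<close>: \<open>e = z (2 e p - \<i> p')\<close>. Therefore \<open>2 e = \<i> F' / (1 + F)\<close> with \<open>F = - 2 z p\<close>.\<close>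

lemma I_mkdv_even:
  assumes "even n"
  shows "I (mkdv u n) = 0"
proof -
  define e where "e = Abs_fps (\<lambda>n. if even n then mkdv u n else 0)"
  define p where "p = Abs_fps (\<lambda>n. if odd n then mkdv u n else 0)"
  let ?X = "fps_X :: 'a fps"
  have p0: "p $ 0 = 0" by (simp add: p_def)
  have e_eq: "e = ?X * (2 * e * p - ii * Ds p)"
  proof (rule fps_X_eqI)
    fix k
    show "e $ Suc k = (2 * e * p - ii * Ds p) $ k"
    proof (cases "even k")
      case True
      have "e $ j * p $ (k - j) = 0" if "j \<le> k" for j
        using True that by (cases "even j") (auto simp: e_def p_def)
      then have "(e * p) $ k = 0" by (simp add: fps_mult_nth)
      then show ?thesis using True by (simp add: mult.assoc fps_two_nth) (simp add: e_def p_def)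
    next
      case False
      have split: "mkdv_s u = e + p" by (simp add: mkdv_s_def e_def p_def fps_eq_iff)
      have "e $ j * e $ (k - j) = 0" if "j \<le> k" for j
        using False that by (cases "even j") (auto simp: e_def)
      then have ee: "(e * e) $ k = 0" by (simp add: fps_mult_nth)
      have "p $ j * p $ (k - j) = 0" if "j \<le> k" for j
        using False that by (cases "even j") (auto simp: p_def)
      then have pp: "(p * p) $ k = 0" by (simp add: fps_mult_nth)
      have sq: "mkdv_s u * mkdv_s u = e * e + p * p + 2 * (e * p)" unfolding split by (simp add: algebra_simps)
      have "mkdv_s u $ Suc k = 2 * (e * p) $ k - i * D (mkdv u k)"
        using False ee pp by (subst mkdv_s_eq) (auto simp: sq fps_two_nth, simp add: mkdv_s_def)
      moreover have "e $ Suc k = mkdv_s u $ Suc k" "p $ k = mkdv u k"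
         using False by (simp_all add: e_def p_def mkdv_s_def)
      ultimately show ?thesis by (simp add: mult.assoc fps_two_nth)
    qed
  qed (simp add: e_def)
  define F where "F = - (2 * ?X * p)"
  define T where "T = fps_right_inverse (1 + F) 1"
  have F0: "F $ 0 = 0" by (simp add: F_def mult.assoc fps_two_nth)
  have T: "T * (1 + F) = 1"
    using fps_right_inverse[of "1 + F" 1] F0 by (simp add: T_def mult.commute)
  have "2 * e * (1 + F) = 2 * (e - ?X * (2 * e * p))" by (simp add: F_def algebra_simps)
  also have "e - ?X * (2 * e * p) = - (?X * (ii * Ds p))"
    by (subst (1) e_eq) (simp add: algebra_simps)
  also have "2 * (- (?X * (ii * Ds p))) = ii * Ds F"
    unfolding F_def mult_2 by (simp add: Ds_minus Ds_add Ds_mult algebra_simps)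
  finally have eF: "2 * e * (1 + F) = ii * Ds F" .
  have "2 * e = 2 * e * (T * (1 + F))" by (simp only: T mult_1_right)
  also have "\<dots> = 2 * e * (1 + F) * T" by (simp only: ac_simps)
  finally have "2 * e = ii * (Ds F * T)" unfolding eF by (simp only: mult.assoc)
  then have "2 * e $ n = i * (Ds F * T) $ n"
    by (metis fps_mult_left_const_nth fps_two_nth)
  then have "I (e $ n + e $ n) = I (i * (Ds F * T) $ n)"
    by (simp only: mult_2)
  then show ?thesis
    unfolding I_add I_i I_log_derivative[OF F0 T] using assms by (simp add: e_def)
qed

end

section \<open>Extension of functionals from a dense subspace\<close>

text \<open>The spaces on which the functionals live are sets of functions, and their seminorms do not separate
  points.\<close>

locale seminormed_space =
  fixes sc :: "complex \<Rightarrow> 'v::ab_group_add \<Rightarrow> 'v" and V :: "'v::ab_group_add set" and N :: "'v \<Rightarrow> real"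
  assumes V_0: "0 \<in> V"
    and V_add: "\<lbrakk>v \<in> V; w \<in> V\<rbrakk> \<Longrightarrow> v + w \<in> V"
    and V_sc: "v \<in> V \<Longrightarrow> sc c v \<in> V"
    and sc_add: "sc c (v + w) = sc c v + sc c w"
    and sc_0: "sc 0 v = 0"
    and sc_minus1: "sc (-1) v = - v"
    and N_nonneg: "0 \<le> N v"
    and N_triangle: "\<lbrakk>v \<in> V; w \<in> V\<rbrakk> \<Longrightarrow> N (v + w) \<le> N v + N w"
    and N_sc: "v \<in> V \<Longrightarrow> N (sc c v) = cmod c * N v"
begin

lemma sc_diff: "sc c (v - w) = sc c v - sc c w"
  using sc_add[of c "v - w" w] by simp

lemma V_minus: "v \<in> V \<Longrightarrow> - v \<in> V"
  using V_sc[of v "-1"] by (simp add: sc_minus1)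

lemma V_diff: "\<lbrakk>v \<in> V; w \<in> V\<rbrakk> \<Longrightarrow> v - w \<in> V"
  using V_add[of v "- w"] V_minus[of w] by simp

lemma N_0 [simp]: "N 0 = 0"
  using N_sc[OF V_0, of 0] by (simp add: sc_0)

lemma N_minus: "v \<in> V \<Longrightarrow> N (- v) = N v"
  using N_sc[of v "-1"] by (simp add: sc_minus1)

lemma N_commute: "\<lbrakk>v \<in> V; w \<in> V\<rbrakk> \<Longrightarrow> N (v - w) = N (w - v)"
  using N_minus[OF V_diff, of v w] by simp

lemma N_diff_le: "\<lbrakk>v \<in> V; w \<in> V\<rbrakk> \<Longrightarrow> N (v - w) \<le> N v + N w"
  using N_triangle[of v "- w"] V_minus[of w] N_minus[of w] by simp

lemma N_triangle2: "\<lbrakk>u \<in> V; v \<in> V; w \<in> V\<rbrakk> \<Longrightarrow> N (u - w) \<le> N (u - v) + N (v - w)"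
  using N_triangle[OF V_diff V_diff, of u v v w] by simp

lemma N_triangle3: "\<lbrakk>v \<in> V; w \<in> V\<rbrakk> \<Longrightarrow> \<bar>N v - N w\<bar> \<le> N (v - w)"
  using N_triangle[OF V_diff, of v w w] N_triangle[OF V_diff, of w v v] N_commute[of v w]
  by (simp add: abs_le_iff)

lemma continuous_wrt_unique:
  assumes G: "continuous_wrt V N G" and H: "continuous_wrt V N H"
    and eq: "\<And>a. a \<in> A \<Longrightarrow> G a = H a" and A: "A \<subseteq> V"
    and dense: "\<And>e. e > 0 \<Longrightarrow> \<exists>a\<in>A. N (a - v) < e" and v: "v \<in> V"
  shows "G v = H v"
proof -
  have "dist (G v) (H v) < e" if "e > 0" for e
  proof -
    obtain d1 where d1: "d1 > 0" "\<And>w. w \<in> V \<Longrightarrow> N (w - v) < d1 \<Longrightarrow> cmod (G w - G v) < e / 2"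
      using G v \<open>e > 0\<close> unfolding continuous_wrt_def by (meson half_gt_zero)
    obtain d2 where d2: "d2 > 0" "\<And>w. w \<in> V \<Longrightarrow> N (w - v) < d2 \<Longrightarrow> cmod (H w - H v) < e / 2"
      using H v \<open>e > 0\<close> unfolding continuous_wrt_def by (meson half_gt_zero)
    obtain a where a: "a \<in> A" "N (a - v) < min d1 d2"
      using dense[of "min d1 d2"] d1 d2 by auto
    have "dist (G a) (G v) < e / 2" "dist (G a) (H v) < e / 2"
      using d1(2)[of a] d2(2)[of a] a A eq[of a] by (auto simp: dist_norm)
    then show ?thesis by (rule dist_triangle_half_r)
  qed
  then show ?thesis by (metis dist_self less_irrefl zero_less_dist_iff)
qed

text \<open>Two candidates differ by a linear map that is \<open>o (N h)\<close>, hence by 0 after rescaling \<open>h\<close>; where the seminorm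
  vanishes, boundedness by \<open>e N h\<close> suffices. The differential is therefore determined on the whole space.\<close>

lemma differential_eqI:
  assumes D: "has_differential sc V N F v D" and h: "h \<in> V"
  shows "differential sc V N F v h = D h"
proof -
  have unique: "D1 h = D2 h"
    if D1: "has_differential sc V N F v D1" and D2: "has_differential sc V N F v D2" and h: "h \<in> V" for D1 D2 h
  proof -
    have "cmod (D1 h - D2 h) \<le> e * (2 * N h)" if "e > 0" for e
    proof -
      obtain d1 where d1: "d1 > 0" "\<And>h. h \<in> V \<Longrightarrow> N h < d1 \<Longrightarrow> cmod (F (v + h) - F v - D1 h) \<le> e * N h"
        using D1 \<open>e > 0\<close> unfolding has_differential_def by meson
      obtain d2 where d2: "d2 > 0" "\<And>h. h \<in> V \<Longrightarrow> N h < d2 \<Longrightarrow> cmod (F (v + h) - F v - D2 h) \<le> e * N h"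
        using D2 \<open>e > 0\<close> unfolding has_differential_def by meson
      \<comment> \<open>adding 1 avoids a case distinction, since \<open>N h\<close> may be 0\<close>
      define t where "t = min d1 d2 / (2 * (N h + 1))"
      have t: "t > 0" using d1 d2 N_nonneg[of h] by (simp add: t_def)
      define k where "k = sc (of_real t) h"
      have k: "k \<in> V" "N k = t * N h" using h t by (simp_all add: k_def V_sc N_sc)
      have "t * N h < min d1 d2"
      proof -
        have "t * N h \<le> t * (N h + 1)" using t by simp
        also have "\<dots> = min d1 d2 / 2" using N_nonneg[of h] by (simp add: t_def field_simps)
        finally show ?thesis using d1 d2 by linarith
      qed
      then have "cmod (F (v + k) - F v - D1 k) \<le> e * N k" "cmod (F (v + k) - F v - D2 k) \<le> e * N k"
        using d1(2)[of k] d2(2)[of k] k by auto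
      then have "cmod (D1 k - D2 k) \<le> e * N k + e * N k"
        by (smt (verit) norm_triangle_ineq4 diff_diff_eq2 add_diff_cancel_left diff_add_cancel norm_minus_commute)
      moreover have "D1 k = of_real t * D1 h" "D2 k = of_real t * D2 h"
        using D1 D2 h unfolding has_differential_def k_def by meson+
      ultimately have "cmod (of_real t * (D1 h - D2 h)) \<le> t * (e * (2 * N h))"
        by (simp add: algebra_simps k)
      then show ?thesis using t by (simp add: norm_mult)
    qed
    note small = this
    have "cmod (D1 h - D2 h) \<le> 0 + e" if "e > 0" for e
    proof -
      have "cmod (D1 h - D2 h) \<le> e / (2 * N h + 1) * (2 * N h)"
        using small[of "e / (2 * N h + 1)"] that N_nonneg[of h] by simp
      also have "\<dots> \<le> e" using that N_nonneg[of h] by (simp add: field_simps)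
      finally show ?thesis by simp
    qed
    then have "cmod (D1 h - D2 h) \<le> 0" by (rule field_le_epsilon)
    then show ?thesis by simp
  qed
  have hd: "has_differential sc V N F v (restrict D V)"
    using D V_add V_sc unfolding has_differential_def by auto
  have "differential sc V N F v = restrict D V"
    unfolding differential_def
  proof (rule the_equality)
    fix D' assume D': "D' \<in> extensional V \<and> has_differential sc V N F v D'"
    then show "D' = restrict D V"
      by (intro extensionalityI[of _ V]) (use unique[OF _ hd] in auto)
  qed (use hd in auto)
  then show ?thesis using h by simp
qed

end

text \<open>Differentiability with locally Lipschitz differential, with all bounds uniform on bounded sets. Uniformity is what
  survives the passage from a dense subspace to the whole space. Both seminorms are parameters, so that functions with
  values in several spaces are covered.\<close>

definition C11 :: "('b::ab_group_add \<Rightarrow> real) \<Rightarrow> ('z::ab_group_add \<Rightarrow> real)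
    \<Rightarrow> ('b \<Rightarrow> 'z) \<Rightarrow> ('b \<Rightarrow> 'b \<Rightarrow> 'z) \<Rightarrow> bool" where
  "C11 M p G G' \<longleftrightarrow> (\<forall>R. \<exists>C\<ge>0. \<forall>v w h. M v \<le> R \<longrightarrow> M w \<le> R \<longrightarrow>
     p (G v) \<le> C \<and> p (G' v h) \<le> C * M h \<and> p (G' v h - G' w h) \<le> C * M (v - w) * M h \<and>
     p (G w - G v - G' v (w - v)) \<le> C * (M (w - v))\<^sup>2)"

text \<open>The dense subspace is given as the image of a type, so that its elements form a group as a type; below this type is the
  ring of smooth functions, or pairs of them.\<close>

locale dense_embedding = seminormed_space sc V N
  for sc :: "complex \<Rightarrow> 'v::ab_group_add \<Rightarrow> 'v" and V :: "'v::ab_group_add set" and N :: "'v \<Rightarrow> real" +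
  fixes sb :: "complex \<Rightarrow> 'b::ab_group_add \<Rightarrow> 'b" and j :: "'b::ab_group_add \<Rightarrow> 'v"
  assumes j_in: "j b \<in> V"
    and j_add: "j (a + b) = j a + j b"
    and j_sc: "j (sb c b) = sc c (j b)"
    and dense: "\<lbrakk>v \<in> V; e > 0\<rbrakk> \<Longrightarrow> \<exists>b. N (j b - v) < e"
begin

definition M :: "'b \<Rightarrow> real" where "M b = N (j b)"

lemma j_diff: "j (a - b) = j a - j b"
  using j_add[of "a - b" b] by simp

definition conv :: "(nat \<Rightarrow> 'b) \<Rightarrow> 'v \<Rightarrow> bool" where
  "conv x v \<longleftrightarrow> (\<lambda>k. N (j (x k) - v)) \<longlonglongrightarrow> 0"

lemma conv_exists: assumes "v \<in> V" obtains x where "conv x v"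
proof -
  have "\<forall>k. \<exists>b. N (j b - v) < 1 / real (Suc k)"
    using dense[OF assms] by simp
  then obtain x where x: "\<And>k. N (j (x k) - v) < 1 / real (Suc k)" by metis
  have "conv x v" unfolding conv_def
  proof (rule tendsto_sandwich[OF _ _ tendsto_const LIMSEQ_inverse_real_of_nat])
    show "\<forall>\<^sub>F k in sequentially. 0 \<le> N (j (x k) - v)" by (simp add: N_nonneg)
    show "\<forall>\<^sub>F k in sequentially. N (j (x k) - v) \<le> inverse (real (Suc k))"
      using x by (intro always_eventually allI) (simp add: inverse_eq_divide less_imp_le)
  qed
  then show thesis by (rule that)
qed

lemma conv_const: "conv (\<lambda>_. b) (j b)"
  by (simp add: conv_def)

lemma conv_add:
  assumes "conv x v" "conv y w" "v \<in> V" "w \<in> V"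
  shows "conv (\<lambda>k. x k + y k) (v + w)"
  unfolding conv_def
proof (rule tendsto_sandwich[OF _ _ tendsto_const])
  show "(\<lambda>k. N (j (x k) - v) + N (j (y k) - w)) \<longlonglongrightarrow> 0"
    using tendsto_add[OF assms(1,2)[unfolded conv_def]] by simp
  have "N (j (x k + y k) - (v + w)) \<le> N (j (x k) - v) + N (j (y k) - w)" for k
    using N_triangle[OF V_diff V_diff, OF j_in assms(3) j_in assms(4)]
    by (metis j_add add_diff_add)
  then show "\<forall>\<^sub>F k in sequentially. N (j (x k + y k) - (v + w)) \<le> N (j (x k) - v) + N (j (y k) - w)"
    by simp
qed (simp add: N_nonneg)

lemma sc_conv:
  assumes "conv x v" "v \<in> V"
  shows "conv (\<lambda>k. sb c (x k)) (sc c v)"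
proof -
  have "N (j (sb c (x k)) - sc c v) = cmod c * N (j (x k) - v)" for k
    using N_sc[OF V_diff[OF j_in assms(2)], of c "x k"] by (simp add: j_sc sc_diff)
  then show ?thesis
    using tendsto_mult_right_zero[OF assms(1)[unfolded conv_def]] by (simp add: conv_def)
qed

lemma conv_norm:
  assumes "conv x v" "v \<in> V"
  shows "(\<lambda>k. M (x k)) \<longlonglongrightarrow> N v"
proof (rule Lim_transform2[OF tendsto_const])
  show "(\<lambda>k. N v - M (x k)) \<longlonglongrightarrow> 0"
  proof (rule Lim_null_comparison[OF _ assms(1)[unfolded conv_def]])
    show "\<forall>\<^sub>F k in sequentially. norm (N v - M (x k)) \<le> N (j (x k) - v)"
      using N_triangle3[OF j_in assms(2)] by (simp add: M_def abs_minus_commute)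
  qed
qed

lemma conv_diff:
  assumes "conv x v" "conv y w" "v \<in> V" "w \<in> V"
  shows "conv (\<lambda>k. x k - y k) (v - w)"
  unfolding conv_def
proof (rule tendsto_sandwich[OF _ _ tendsto_const])
  show "(\<lambda>k. N (j (x k) - v) + N (j (y k) - w)) \<longlonglongrightarrow> 0"
    using tendsto_add[OF assms(1,2)[unfolded conv_def]] by simp
  have "N (j (x k - y k) - (v - w)) \<le> N (j (x k) - v) + N (j (y k) - w)" for k
    using N_diff_le[OF V_diff V_diff, OF j_in assms(3) j_in assms(4)]
    by (simp add: j_diff algebra_simps)
  then show "\<forall>\<^sub>F k in sequentially. N (j (x k - y k) - (v - w)) \<le> N (j (x k) - v) + N (j (y k) - w)"
    by simp
qed (simp add: N_nonneg)

text \<open>Functions that are Lipschitz on bounded sets map convergent sequences to Cauchy sequences, which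
  yields the continuous extension.\<close>

definition loc_lip :: "('b \<Rightarrow> complex) \<Rightarrow> bool" where
  "loc_lip f \<longleftrightarrow> (\<forall>R. \<exists>C\<ge>0. \<forall>a b. M a \<le> R \<longrightarrow> M b \<le> R \<longrightarrow> cmod (f a - f b) \<le> C * M (a - b))"

definition ext :: "('b \<Rightarrow> complex) \<Rightarrow> 'v \<Rightarrow> complex" where
  "ext f v = lim (\<lambda>k. f ((SOME x. conv x v) k))"

lemma conv_bounded:
  assumes "conv x v" "v \<in> V"
  obtains R where "\<And>k. M (x k) \<le> R"
  using conv_norm[OF assms] convergent_imp_Bseq[of "\<lambda>k. M (x k)"]
  by (metis BseqE abs_le_D1 convergent_def real_norm_def)

lemma loc_lip_conv_diff:
  assumes f: "loc_lip f" and v: "v \<in> V" and x: "conv x v" and y: "conv y v"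
  shows "(\<lambda>k. f (x k) - f (y k)) \<longlonglongrightarrow> 0"
proof -
  obtain R1 R2 where R: "\<And>k. M (x k) \<le> R1" "\<And>k. M (y k) \<le> R2"
    using conv_bounded[OF x v] conv_bounded[OF y v] by metis
  obtain C where C: "\<And>a b. M a \<le> max R1 R2 \<Longrightarrow> M b \<le> max R1 R2 \<Longrightarrow> cmod (f a - f b) \<le> C * M (a - b)"
    using f unfolding loc_lip_def by blast
  have "(\<lambda>k. C * M (x k - y k)) \<longlonglongrightarrow> C * N (v - v)"
    by (intro tendsto_mult_left conv_norm conv_diff x y v V_diff)
  then have lim: "(\<lambda>k. C * M (x k - y k)) \<longlonglongrightarrow> 0" by simp
  show ?thesis
    by (rule Lim_null_comparison[OF _ lim])
       (use C R in \<open>intro always_eventually allI, simp add: max.coboundedI1 max.coboundedI2\<close>)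
qed

lemma ext_conv:
  assumes f: "loc_lip f" and v: "v \<in> V" and x: "conv x v"
  shows "(\<lambda>k. f (x k)) \<longlonglongrightarrow> ext f v"
proof -
  define y where "y = (SOME x. conv x v)"
  have y: "conv y v" unfolding y_def by (rule someI[of "\<lambda>x. conv x v", OF x])
  have "Cauchy (\<lambda>k. f (y k))"
  proof (rule CauchyI)
    fix e :: real assume "e > 0"
    obtain R where R: "\<And>k. M (y k) \<le> R" using conv_bounded[OF y v] by blast
    obtain C where C: "C \<ge> 0" "\<And>a b. M a \<le> R \<Longrightarrow> M b \<le> R \<Longrightarrow> cmod (f a - f b) \<le> C * M (a - b)"
      using f unfolding loc_lip_def by blast
    define d where "d = e / (2 * (C + 1))"
    have "d > 0" using \<open>e > 0\<close> C by (simp add: d_def)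
    then obtain K where K: "\<And>k. k \<ge> K \<Longrightarrow> N (j (y k) - v) < d"
      using order_tendstoD(2)[OF y[unfolded conv_def]] unfolding eventually_sequentially by blast
    have "norm (f (y m) - f (y n)) < e" if "m \<ge> K" "n \<ge> K" for m n
    proof -
      have "M (y m - y n) \<le> N (j (y m) - v) + N (j (y n) - v)"
        using N_triangle2[OF j_in v j_in, of "y m" "y n"] N_commute[OF v j_in, of "y n"] by (simp add: M_def j_diff)
      also have "\<dots> \<le> 2 * d" using K[OF that(1)] K[OF that(2)] by simp
      finally have "C * M (y m - y n) \<le> C * (2 * d)" using C by (intro mult_left_mono) auto
      also have "\<dots> < e" using \<open>e > 0\<close> C by (simp add: d_def field_simps)
      finally show ?thesis using C(2)[OF R R, of m n] by linarith
    qed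
    then show "\<exists>K. \<forall>m\<ge>K. \<forall>n\<ge>K. norm (f (y m) - f (y n)) < e" by blast
  qed
  then have "(\<lambda>k. f (y k)) \<longlonglongrightarrow> ext f v"
    by (simp add: ext_def y_def Cauchy_convergent_iff convergent_LIMSEQ_iff)
  from tendsto_add[OF loc_lip_conv_diff[OF f v x y] this] show ?thesis by simp
qed

lemma ext_j: "loc_lip f \<Longrightarrow> ext f (j b) = f b"
  using ext_conv[OF _ j_in conv_const, of f b] LIMSEQ_unique tendsto_const by blast

lemma ext_lipschitz:
  assumes f: "loc_lip f"
  obtains C where "C \<ge> 0" "\<And>v w. \<lbrakk>v \<in> V; w \<in> V; N v \<le> R; N w \<le> R\<rbrakk> \<Longrightarrow> cmod (ext f v - ext f w) \<le> C * N (v - w)"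
proof -
  obtain C where C: "C \<ge> 0" "\<And>a b. M a \<le> R + 1 \<Longrightarrow> M b \<le> R + 1 \<Longrightarrow> cmod (f a - f b) \<le> C * M (a - b)"
    using f unfolding loc_lip_def by blast
  have "cmod (ext f v - ext f w) \<le> C * N (v - w)"
    if v: "v \<in> V" and w: "w \<in> V" and R: "N v \<le> R" "N w \<le> R" for v w
  proof -
    obtain x y where x: "conv x v" and y: "conv y w" using conv_exists v w by metis
    have "\<forall>\<^sub>F k in sequentially. M (x k) < R + 1" "\<forall>\<^sub>F k in sequentially. M (y k) < R + 1"
      using order_tendstoD(2)[OF conv_norm[OF x v]] order_tendstoD(2)[OF conv_norm[OF y w]] R by auto
    then have ev: "\<forall>\<^sub>F k in sequentially. cmod (f (x k) - f (y k)) \<le> C * M (x k - y k)"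
      by eventually_elim (use C in auto)
    have "(\<lambda>k. cmod (f (x k) - f (y k))) \<longlonglongrightarrow> cmod (ext f v - ext f w)"
      by (intro tendsto_norm tendsto_diff ext_conv f x y v w)
    moreover have "(\<lambda>k. C * M (x k - y k)) \<longlonglongrightarrow> C * N (v - w)"
      by (intro tendsto_mult_left conv_norm conv_diff x y v w V_diff)
    ultimately show ?thesis using tendsto_le[OF _ _ _ ev] by simp
  qed
  with C that show thesis by blast
qed

lemma continuous_wrt_ext:
  assumes f: "loc_lip f"
  shows "continuous_wrt V N (restrict (ext f) V)"
  unfolding continuous_wrt_def
proof (intro ballI allI impI)
  fix v and e :: real assume v: "v \<in> V" and e: "e > 0"
  obtain C where C: "C \<ge> 0" "\<And>u w. \<lbrakk>u \<in> V; w \<in> V; N u \<le> N v + 1; N w \<le> N v + 1\<rbrakk> \<Longrightarrow> cmod (ext f u - ext f w) \<le> C * N (u - w)"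
    using ext_lipschitz[OF f, of "N v + 1"] by blast
  have "cmod (ext f w - ext f v) < e" if w: "w \<in> V" and d: "N (w - v) < min 1 (e / (C + 1))" for w
  proof -
    have "N w \<le> N v + 1" using N_triangle3[OF w v] d by auto
    then have "cmod (ext f w - ext f v) \<le> C * N (w - v)" using C v w by auto
    also have "\<dots> \<le> C * (e / (C + 1))" using d C by (intro mult_left_mono) auto
    also have "\<dots> < e" using C e by (simp add: field_simps)
    finally show ?thesis .
  qed
  then show "\<exists>d>0. \<forall>w\<in>V. N (w - v) < d \<longrightarrow> cmod (restrict (ext f) V w - restrict (ext f) V v) < e"
    using C e v by (intro exI[of _ "min 1 (e / (C + 1))"]) auto
qed

lemma cont_extension_eq:
  assumes f: "loc_lip f" and F: "\<And>b. F (j b) = f b"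
  shows "cont_extension V N (range j) F = restrict (ext f) V"
  unfolding cont_extension_def
proof (rule the_equality)
  show "restrict (ext f) V \<in> extensional V \<and> continuous_wrt V N (restrict (ext f) V) \<and>
      (\<forall>v\<in>range j. restrict (ext f) V v = F v)"
    using continuous_wrt_ext[OF f] by (auto simp: j_in ext_j[OF f] F)
next
  fix G assume G: "G \<in> extensional V \<and> continuous_wrt V N G \<and> (\<forall>v\<in>range j. G v = F v)"
  show "G = restrict (ext f) V"
  proof (rule extensionalityI[of _ V])
    fix v assume v: "v \<in> V"
    show "G v = restrict (ext f) V v"
    proof (rule continuous_wrt_unique[OF _ continuous_wrt_ext[OF f] _ _ _ v, where A = "range j"])
      show "\<exists>a\<in>range j. N (a - v) < e" if "e > 0" for e using dense[OF v that] by auto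
    qed (use G in \<open>auto simp: j_in ext_j[OF f] F\<close>)
  qed (use G in auto)
qed

end

context dense_embedding begin

text \<open>A differential is a function of the base point and the direction. It is extended in both variables at once, by
  applying the extension of functions to the product space.\<close>

lemma pair: "dense_embedding (\<lambda>c. map_prod (sc c) (sc c)) (V \<times> V) (\<lambda>v. N (fst v) + N (snd v))
   (\<lambda>c. map_prod (sb c) (sb c)) (map_prod j j)"
proof
  fix v and e :: real assume "v \<in> V \<times> V" "e > 0"
  then obtain a b where "N (j a - fst v) < e / 2" "N (j b - snd v) < e / 2"
    using dense[of "fst v" "e / 2"] dense[of "snd v" "e / 2"] by auto
  then have "N (fst (map_prod j j (a, b) - v)) + N (snd (map_prod j j (a, b) - v)) < e" by auto
  then show "\<exists>b. N (fst (map_prod j j b - v)) + N (snd (map_prod j j b - v)) < e" by blast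
next
  fix v w assume "v \<in> V \<times> V" "w \<in> V \<times> V"
  then show "N (fst (v + w)) + N (snd (v + w)) \<le> N (fst v) + N (snd v) + (N (fst w) + N (snd w))"
    using N_triangle[of "fst v" "fst w"] N_triangle[of "snd v" "snd w"] by auto
qed (auto simp: V_0 V_add V_sc sc_0 sc_minus1 N_nonneg N_sc j_in j_add j_sc zero_prod_def sc_add algebra_simps)

lemma C11_loc_lip:
  assumes f: "C11 M cmod f f'"
  shows "loc_lip f"
  unfolding loc_lip_def
proof
  fix R
  obtain C where C: "C \<ge> 0" "\<And>v w h. M v \<le> R \<Longrightarrow> M w \<le> R \<Longrightarrow> cmod (f' v h) \<le> C * M h \<and>
      cmod (f w - f v - f' v (w - v)) \<le> C * (M (w - v))\<^sup>2"
    using f unfolding C11_def by meson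
  have "cmod (f a - f b) \<le> (C + C * (2 * \<bar>R\<bar>)) * M (a - b)" if "M a \<le> R" "M b \<le> R" for a b
  proof -
    have "M (a - b) \<le> 2 * \<bar>R\<bar>" using N_diff_le[OF j_in j_in, of a b] that by (simp add: M_def j_diff)
    then have "M (a - b) * M (a - b) \<le> 2 * \<bar>R\<bar> * M (a - b)"
      by (rule mult_right_mono) (simp add: M_def N_nonneg)
    then have 1: "C * (M (a - b))\<^sup>2 \<le> C * (2 * \<bar>R\<bar> * M (a - b))"
      using C by (intro mult_left_mono) (auto simp: power2_eq_square)
    have "cmod (f a - f b) \<le> cmod (f a - f b - f' b (a - b)) + cmod (f' b (a - b))"
      by (metis diff_add_cancel norm_triangle_ineq)
    also have "\<dots> \<le> C * (M (a - b))\<^sup>2 + C * M (a - b)"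
      using C(2)[of b a "a - b"] that by (intro add_mono) auto
    finally show ?thesis using 1 by (simp add: algebra_simps)
  qed
  then show "\<exists>C\<ge>0. \<forall>a b. M a \<le> R \<longrightarrow> M b \<le> R \<longrightarrow> cmod (f a - f b) \<le> C * M (a - b)"
    using C by (intro exI[of _ "C + C * (2 * \<bar>R\<bar>)"]) auto
qed

text \<open>All conditions on a differential are closed (in)equalities that hold on the dense subspace with constants uniform
  on bounded sets, so they persist in the limit.\<close>

lemma C11_extension:
  assumes f: "C11 M cmod f f'"
    and add: "\<And>v h k. f' v (h + k) = f' v h + f' v k"
    and hom: "\<And>v c h. f' v (sb c h) = c * f' v h"
    and F: "\<And>b. F (j b) = f b"
    and v: "v \<in> V" and x: "conv x v"
  shows "(\<lambda>k. f (x k)) \<longlonglongrightarrow> cont_extension V N (range j) F v"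
    and "(\<lambda>k. f' (x k) h) \<longlonglongrightarrow> differential sc V N (cont_extension V N (range j) F) v (j h)"
proof -
  note ll = C11_loc_lip[OF f]
  have ce: "cont_extension V N (range j) F = restrict (ext f) V"
    by (rule cont_extension_eq[OF ll F])
  show "(\<lambda>k. f (x k)) \<longlonglongrightarrow> cont_extension V N (range j) F v"
    using ext_conv[OF ll v x] v by (simp add: ce)
  interpret P: dense_embedding "\<lambda>c. map_prod (sc c) (sc c)" "V \<times> V" "\<lambda>v. N (fst v) + N (snd v)"
    "\<lambda>c. map_prod (sb c) (sb c)" "map_prod j j"
    by (rule pair)
  have PM: "P.M (a, b) = M a + M b" for a b by (simp add: P.M_def M_def)
  have M0: "M a \<ge> 0" for a by (simp add: M_def N_nonneg)
  let ?g = "\<lambda>(a, b). f' a b"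
  have llg: "P.loc_lip ?g"
    unfolding P.loc_lip_def
  proof
    fix R
    obtain C where C: "C \<ge> 0" "\<And>v w h. M v \<le> R \<Longrightarrow> M w \<le> R \<Longrightarrow> cmod (f' v h) \<le> C * M h \<and>
        cmod (f' v h - f' w h) \<le> C * M (v - w) * M h"
      using f unfolding C11_def by meson
    have "cmod (?g p - ?g q) \<le> (C * \<bar>R\<bar> + C) * P.M (p - q)" if "P.M p \<le> R" "P.M q \<le> R" for p q
    proof -
      obtain a b c d where pq: "p = (a, b)" "q = (c, d)" by (cases p, cases q)
      have R: "M a \<le> R" "M b \<le> \<bar>R\<bar>" "M c \<le> R"
        using that M0[of a] M0[of b] M0[of c] M0[of d] by (auto simp: pq PM)
      have "f' c (b - d) = f' c b - f' c d"
        using add[of c "b - d" d] by simp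
      then have "cmod (?g p - ?g q) = cmod ((f' a b - f' c b) + f' c (b - d))"
        by (simp add: pq)
      also have "\<dots> \<le> C * M (a - c) * M b + C * M (b - d)"
        using C(2)[OF R(1) R(3), of b] C(2)[OF R(3) R(3), of "b - d"]
        by (intro order_trans[OF norm_triangle_ineq] add_mono) auto
      also have "\<dots> \<le> C * M (a - c) * \<bar>R\<bar> + C * M (b - d)"
        using C R M0[of "a - c"] by (intro add_mono mult_left_mono) auto
      also have "\<dots> \<le> (C * \<bar>R\<bar> + C) * (M (a - c) + M (b - d))"
        using C(1) M0[of "a - c"] M0[of "b - d"] by (simp add: algebra_simps)
      finally show ?thesis by (simp add: pq PM)
    qed
    then show "\<exists>C\<ge>0. \<forall>p q. P.M p \<le> R \<longrightarrow> P.M q \<le> R \<longrightarrow> cmod (?g p - ?g q) \<le> C * P.M (p - q)"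
      using C by (intro exI[of _ "C * \<bar>R\<bar> + C"]) auto
  qed
  have Pconv: "P.conv (\<lambda>k. (x k, y k)) (v, w)" if "conv x v" "conv y w" for x y v w
    using tendsto_add[OF that[unfolded conv_def]] by (simp add: P.conv_def)
  define D where "D h = P.ext ?g (v, h)" for h
  have D: "(\<lambda>k. f' (x k) (y k)) \<longlonglongrightarrow> D h" if "conv x v" "conv y h" "h \<in> V" for x y h
    using P.ext_conv[OF llg _ Pconv[OF that(1,2)]] v that by (simp add: D_def)
  have "has_differential sc V N (restrict (ext f) V) v D"
    unfolding has_differential_def
  proof (intro conjI ballI allI impI)
    fix h k assume hk: "h \<in> V" "k \<in> V"
    then obtain y z where y: "conv y h" and z: "conv z k" using conv_exists by metis
    have "(\<lambda>n. f' (x n) (y n + z n)) \<longlonglongrightarrow> D h + D k"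
      unfolding add by (intro tendsto_add D x y z hk)
    moreover have "(\<lambda>n. f' (x n) (y n + z n)) \<longlonglongrightarrow> D (h + k)"
      by (intro D conv_add x y z hk V_add)
    ultimately show "D (h + k) = D h + D k" by (metis LIMSEQ_unique)
  next
    fix c h assume h: "h \<in> V"
    then obtain y where y: "conv y h" using conv_exists by metis
    have "(\<lambda>n. f' (x n) (sb c (y n))) \<longlonglongrightarrow> c * D h"
      unfolding hom by (intro tendsto_mult tendsto_const D x y h)
    moreover have "(\<lambda>n. f' (x n) (sb c (y n))) \<longlonglongrightarrow> D (sc c h)"
      by (intro D sc_conv x y h V_sc)
    ultimately show "D (sc c h) = c * D h" by (metis LIMSEQ_unique)
  next
    obtain R where R: "\<And>k. M (x k) \<le> R" using conv_bounded[OF x v] by blast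
    obtain C where C: "\<And>v h. M v \<le> R \<Longrightarrow> cmod (f' v h) \<le> C * M h"
      using f unfolding C11_def by meson
    have "cmod (D h) \<le> C * N h" if h: "h \<in> V" for h
    proof -
      obtain y where y: "conv y h" using conv_exists h by metis
      show ?thesis
        using tendsto_le[OF sequentially_bot tendsto_mult_left[OF conv_norm[OF y h]] tendsto_norm[OF D[OF x y h]], of C]
          C[OF R] by simp
    qed
    then show "\<exists>C. \<forall>h\<in>V. cmod (D h) \<le> C * N h" by blast
  next
    fix e :: real assume e: "e > 0"
    obtain R where R: "\<And>k. M (x k) \<le> R" using conv_bounded[OF x v] by blast
    obtain C where C: "C \<ge> 0" "\<And>v w. M v \<le> R + 1 \<Longrightarrow> M w \<le> R + 1 \<Longrightarrow> cmod (f w - f v - f' v (w - v)) \<le> C * (M (w - v))\<^sup>2"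
      using f unfolding C11_def by meson
    have "cmod (restrict (ext f) V (v + h) - restrict (ext f) V v - D h) \<le> e * N h"
      if h: "h \<in> V" and d: "N h < min 1 (e / (C + 1))" for h
    proof -
      obtain y where y: "conv y h" using conv_exists h by metis
      have "\<forall>\<^sub>F k in sequentially. M (y k) < 1"
        using order_tendstoD(2)[OF conv_norm[OF y h], of 1] d by auto
      then have ev: "\<forall>\<^sub>F k in sequentially. cmod (f (x k + y k) - f (x k) - f' (x k) (y k)) \<le> C * (M (y k))\<^sup>2"
      proof eventually_elim
        case (elim k)
        have "M (x k + y k) \<le> R + 1"
          using N_triangle[OF j_in j_in, of "x k" "y k"] R[of k] elim by (simp add: M_def j_add)
        then show ?case using C(2)[of "x k" "x k + y k"] R[of k] by simp
      qed
      have "(\<lambda>k. cmod (f (x k + y k) - f (x k) - f' (x k) (y k))) \<longlonglongrightarrow> cmod (ext f (v + h) - ext f v - D h)"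
        by (intro tendsto_norm tendsto_diff ext_conv ll conv_add D V_add x y v h)
      moreover have "(\<lambda>k. C * (M (y k))\<^sup>2) \<longlonglongrightarrow> C * (N h)\<^sup>2"
        by (intro tendsto_mult_left tendsto_power conv_norm y h)
      ultimately have "cmod (ext f (v + h) - ext f v - D h) \<le> C * (N h)\<^sup>2"
        using tendsto_le[OF _ _ _ ev] by simp
      also have "\<dots> = (C * N h) * N h" by (simp add: power2_eq_square)
      also have "\<dots> \<le> e * N h"
      proof (rule mult_right_mono[OF _ N_nonneg])
        have "C * N h \<le> C * (e / (C + 1))" using d C by (intro mult_left_mono) auto
        also have "\<dots> \<le> e" using C e by (simp add: field_simps)
        finally show "C * N h \<le> e" .
      qed
      finally show ?thesis using v h by (simp add: V_add)
    qed
    then show "\<exists>d>0. \<forall>h\<in>V. N h < d \<longrightarrow> cmod (restrict (ext f) V (v + h) - restrict (ext f) V v - D h) \<le> e * N h"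
      using C e by (intro exI[of _ "min 1 (e / (C + 1))"]) auto
  qed
  then have "differential sc V N (cont_extension V N (range j) F) v (j h) = D (j h)"
    unfolding ce by (rule differential_eqI) (rule j_in)
  then show "(\<lambda>k. f' (x k) h) \<longlonglongrightarrow> differential sc V N (cont_extension V N (range j) F) v (j h)"
    using D[OF x conv_const j_in, of h] by simp
qed

end

section \<open>The ring of smooth periodic functions\<close>

lemma Dx_has_derivative: "u differentiable at x \<Longrightarrow> (u has_vector_derivative Dx u x) (at x)"
  by (simp add: Dx_def vector_derivative_works)

lemma Dx_eqI: "(\<And>x. (u has_vector_derivative u' x) (at x)) \<Longrightarrow> Dx u = u'"
  by (auto simp: Dx_def fun_eq_iff vector_derivative_at)

lemma periodic_Dx: assumes "periodic u" "\<And>x. u differentiable at x" shows "periodic (Dx u)"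
  unfolding periodic_def
proof
  fix x
  have "((\<lambda>x. x + 1 :: real) has_vector_derivative 1) (at x)"
    by (auto intro!: derivative_eq_intros)
  then have "((u \<circ> (\<lambda>x. x + 1)) has_vector_derivative 1 *\<^sub>R Dx u (x + 1)) (at x)"
    by (rule vector_diff_chain_at) (rule Dx_has_derivative[OF assms(2)])
  moreover have "u \<circ> (\<lambda>x. x + 1) = u" using assms(1) by (auto simp: periodic_def)
  ultimately show "Dx u (x + 1) = Dx u x"
    by (simp add: Dx_def vector_derivative_at)
qed

text \<open>Finite differentiability, which unlike membership in \<^const>\<open>smooth_per\<close> is amenable to induction on the order.\<close>

definition diffable :: "nat \<Rightarrow> tfun \<Rightarrow> bool" where
  "diffable n u \<longleftrightarrow> (\<forall>k\<le>n. \<forall>x. (Dx ^^ k) u differentiable at x)"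

lemma diffable_0: "diffable 0 u \<longleftrightarrow> (\<forall>x. u differentiable at x)"
  by (simp add: diffable_def)

lemma diffable_Suc: "diffable (Suc n) u \<longleftrightarrow> (\<forall>x. u differentiable at x) \<and> diffable n (Dx u)"
proof -
  have "diffable (Suc n) u \<longleftrightarrow> (\<forall>k\<in>{..Suc n}. \<forall>x. (Dx ^^ k) u differentiable at x)"
    by (auto simp: diffable_def)
  also have "\<dots> \<longleftrightarrow> (\<forall>x. u differentiable at x) \<and> diffable n (Dx u)"
    unfolding atMost_Suc_eq_insert_0 diffable_def by (auto simp: funpow_swap1)
  finally show ?thesis .
qed

lemma smooth_per_iff: "u \<in> smooth_per \<longleftrightarrow> periodic u \<and> (\<forall>n. diffable n u)"
  by (auto simp: smooth_per_def diffable_def)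

lemma smooth_per_differentiable: "u \<in> smooth_per \<Longrightarrow> u differentiable at x"
  unfolding smooth_per_iff using diffable_0 by blast

lemma smooth_per_Dx: "u \<in> smooth_per \<Longrightarrow> Dx u \<in> smooth_per"
  using periodic_Dx smooth_per_differentiable unfolding smooth_per_iff by (metis diffable_Suc)

lemma smooth_per_has_derivative: "u \<in> smooth_per \<Longrightarrow> (u has_vector_derivative Dx u x) (at x)"
  by (simp add: smooth_per_differentiable Dx_has_derivative)

lemma differentiable_fun_plus: "\<lbrakk>u differentiable at x; v differentiable at x\<rbrakk> \<Longrightarrow> (u + v) differentiable at x"
  for u v :: tfun
  by (simp add: plus_fun_def)

lemma differentiable_fun_times: "\<lbrakk>u differentiable at x; v differentiable at x\<rbrakk> \<Longrightarrow> (u * v) differentiable at x"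
  for u v :: tfun
  by (simp add: times_fun_def)

lemma Dx_add: "\<lbrakk>\<And>x. u differentiable at x; \<And>x. v differentiable at x\<rbrakk> \<Longrightarrow> Dx (u + v) = Dx u + Dx v"
  by (rule Dx_eqI) (auto simp: plus_fun_def intro!: has_vector_derivative_add Dx_has_derivative)

lemma Dx_mult: "\<lbrakk>\<And>x. u differentiable at x; \<And>x. v differentiable at x\<rbrakk> \<Longrightarrow> Dx (u * v) = Dx u * v + u * Dx v"
  by (rule Dx_eqI)
     (auto simp: plus_fun_def times_fun_def add.commute intro!: has_vector_derivative_mult Dx_has_derivative)

lemma Dx_const: "Dx (\<lambda>x. c) = 0"
  by (rule Dx_eqI) simp

lemma diffable_add: "diffable n u \<Longrightarrow> diffable n v \<Longrightarrow> diffable n (u + v)"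
proof (induction n arbitrary: u v)
  case (Suc n)
  then show ?case
    unfolding diffable_Suc by (metis Dx_add differentiable_fun_plus)
qed (auto simp: diffable_0 differentiable_fun_plus)

lemma diffable_Suc_imp: "diffable (Suc n) u \<Longrightarrow> diffable n u"
  by (auto simp: diffable_def)

lemma diffable_mult: "diffable n u \<Longrightarrow> diffable n v \<Longrightarrow> diffable n (u * v)"
proof (induction n arbitrary: u v)
  case (Suc n)
  from Suc.prems have uv: "u differentiable at x" "v differentiable at x" for x
    by (auto simp: diffable_Suc)
  from Suc.prems have "diffable n (Dx u * v + u * Dx v)"
    using Suc.prems[THEN diffable_Suc_imp] by (intro diffable_add Suc.IH) (auto simp: diffable_Suc)
  then show ?case
    unfolding diffable_Suc using uv Dx_mult[of u v] differentiable_fun_times by metis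
qed (auto simp: diffable_0 differentiable_fun_times)

lemma diffable_const: "diffable n (\<lambda>x. c)"
proof (induction n arbitrary: c)
  case (Suc n)
  from Suc[of 0] show ?case by (simp add: diffable_Suc Dx_const zero_fun_def)
qed (simp add: diffable_0)

lemma smooth_per_add: "u \<in> smooth_per \<Longrightarrow> v \<in> smooth_per \<Longrightarrow> u + v \<in> smooth_per"
  by (auto simp: smooth_per_iff periodic_def diffable_add)

lemma smooth_per_mult: "u \<in> smooth_per \<Longrightarrow> v \<in> smooth_per \<Longrightarrow> u * v \<in> smooth_per"
  by (auto simp: smooth_per_iff periodic_def diffable_mult)

lemma smooth_per_const: "(\<lambda>x. c) \<in> smooth_per"
  by (auto simp: smooth_per_iff periodic_def diffable_const)

text \<open>As a type the smooth periodic functions form a commutative ring, to which the algebra of differential rings and power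
  series applies literally.\<close>

typedef smooth = smooth_per
  morphisms app Abs_smooth
  using smooth_per_const by blast

setup_lifting type_definition_smooth

lift_definition cst :: "complex \<Rightarrow> smooth" is "\<lambda>c x. c"
  by (rule smooth_per_const)

lift_definition ddx :: "smooth \<Rightarrow> smooth" is Dx
  by (rule smooth_per_Dx)

instantiation smooth :: comm_ring_1
begin

lift_definition zero_smooth :: smooth is 0
  using smooth_per_const[of 0] by (simp add: zero_fun_def)

lift_definition one_smooth :: smooth is 1
  using smooth_per_const[of 1] by (simp add: one_fun_def)

lift_definition plus_smooth :: "smooth \<Rightarrow> smooth \<Rightarrow> smooth" is "(+)"
  by (rule smooth_per_add)

lift_definition times_smooth :: "smooth \<Rightarrow> smooth \<Rightarrow> smooth" is "(*)"
  by (rule smooth_per_mult)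

lift_definition uminus_smooth :: "smooth \<Rightarrow> smooth" is "\<lambda>u. - u"
proof -
  fix u :: tfun assume "u \<in> smooth_per"
  from smooth_per_mult[OF smooth_per_const[of "-1"] this] show "- u \<in> smooth_per"
    by (simp add: times_fun_def fun_Compl_def)
qed

definition minus_smooth :: "smooth \<Rightarrow> smooth \<Rightarrow> smooth" where
  "minus_smooth u v = u + - v"

instance
proof
  show "(0::smooth) \<noteq> 1" by transfer (simp add: fun_eq_iff)
qed (unfold minus_smooth_def, (transfer, simp add: fun_eq_iff algebra_simps)+)

end

lemma app_add [simp]: "app (f + g) x = app f x + app g x"
  by (simp add: plus_smooth.rep_eq)

lemma app_mult [simp]: "app (f * g) x = app f x * app g x"
  by (simp add: times_smooth.rep_eq)

lemma app_minus [simp]: "app (- f) x = - app f x"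
  by (simp add: uminus_smooth.rep_eq)

lemma app_diff [simp]: "app (f - g) x = app f x - app g x"
  unfolding minus_smooth_def app_add app_minus by (rule add_uminus_conv_diff)

lemma app_0 [simp]: "app 0 x = 0"
  by (simp add: zero_smooth.rep_eq)

lemma app_1 [simp]: "app 1 x = 1"
  by (simp add: one_smooth.rep_eq)

lemma app_cst [simp]: "app (cst c) x = c"
  by (simp add: cst.rep_eq)

lemma app_sum [simp]: "app (sum f A) x = (\<Sum>a\<in>A. app (f a) x)"
  by (induction A rule: infinite_finite_induct) auto

lemma app_ddx: "app (ddx f) = Dx (app f)"
  by (simp add: ddx.rep_eq)

lemma app_power [simp]: "app (f ^ n) x = app f x ^ n"
  by (induction n) auto

lemma smooth_eqI: "(\<And>x. app f x = app g x) \<Longrightarrow> f = g"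
  by (auto simp: app_inject[symmetric] fun_eq_iff)

lemma app_smooth_per [simp]: "app f \<in> smooth_per"
  by (rule app)

lemma app_periodic: "app f (x + 1) = app f x"
  using app[of f] by (auto simp: smooth_per_def periodic_def)

lemma app_has_derivative: "(app f has_vector_derivative app (ddx f) x) (at x)"
  by (simp add: app_ddx smooth_per_has_derivative)

lemma app_continuous [continuous_intros]: "continuous_on S g \<Longrightarrow> continuous_on S (\<lambda>x. app f (g x))"
  by (rule continuous_on_compose2[of UNIV "app f"])
     (auto intro!: has_vector_derivative_continuous app_has_derivative simp: continuous_on_eq_continuous_at)

lemma torus_integrable_continuous: "continuous_on {0..1} f \<Longrightarrow> integrable torus (f :: real \<Rightarrow> 'b::euclidean_space)"
  unfolding torus_def by (rule continuous_imp_integrable_real)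

lemma torus_integral: "continuous_on {0..1} f \<Longrightarrow> integral\<^sup>L torus f = integral {0..1} f" for f :: "real \<Rightarrow> 'b::euclidean_space"
  unfolding torus_def by (intro lebesgue_integral_eq_integral continuous_imp_integrable_real) auto

lemma finite_measure_torus: "finite_measure torus"
  unfolding torus_def by (intro finite_measureI) (simp add: emeasure_restrict_space)

interpretation torus: finite_measure torus
  by (rule finite_measure_torus)

lemma space_torus: "space torus = {0..1}"
  by (simp add: torus_def)

lemma measure_torus: "measure torus {0..1} = 1"
  by (simp add: torus_def measure_restrict_space)

lemma integral_torus_const: "integral\<^sup>L torus (\<lambda>x. c) = c" for c :: complex
  using measure_torus by (simp add: space_torus)

definition torus_int :: "smooth \<Rightarrow> complex" where
  "torus_int f = (LINT x|torus. app f x)"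

lemma app_integrable: "integrable torus (app f)"
  by (intro torus_integrable_continuous app_continuous) auto

text \<open>The fundamental theorem of calculus and periodicity make the mean value annihilate derivatives.\<close>

interpretation smooth: differential_ring ddx "cst \<i>" torus_int
proof
  fix f g
  show "ddx (f + g) = ddx f + ddx g"
    by transfer (simp add: Dx_add smooth_per_differentiable)
  show "ddx (f * g) = ddx f * g + f * ddx g"
    by transfer (simp add: Dx_mult smooth_per_differentiable)
  show "ddx (cst \<i>) = 0" by transfer (rule Dx_const)
  show "cst \<i> * cst \<i> = - 1" by (rule smooth_eqI) simp
  show "torus_int (f + g) = torus_int f + torus_int g" by (simp add: torus_int_def plus_fun_def app_integrable)
  show "torus_int (cst \<i> * f) = \<i> * torus_int f" by (simp add: torus_int_def app_integrable)
  have "((\<lambda>x. app (ddx f) x) has_integral app f 1 - app f 0) {0..1}"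
    by (intro fundamental_theorem_of_calculus) (auto intro: has_vector_derivative_at_within app_has_derivative)
  then have "integral {0..1} (\<lambda>x. app (ddx f) x) = 0"
    using app_periodic[of f 0] by (simp add: integral_unique)
  then show "torus_int (ddx f) = 0"
    unfolding torus_int_def by (subst torus_integral) (auto intro!: continuous_intros)
qed

lemma torus_int_cst_mult: "torus_int (cst c * f) = c * torus_int f"
  by (simp add: torus_int_def app_integrable)

lemma ddx_cst [simp]: "ddx (cst c) = 0"
  by transfer (rule Dx_const)

lemma nls_r_eq: "nls_r (app f, app g) n = app (smooth.nls (f, g) n)"
proof (induction "(app f, app g)" n rule: nls_r.induct)
  case (3 n)
  show ?case by (rule ext) (simp add: 3 app_ddx del: sum.cl_ivl_Suc)
qed (simp_all add: zero_smooth.rep_eq)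

lemma mkdv_q_eq: "mkdv_q (app f) n = app (smooth.mkdv f n)"
proof (induction "app f" n rule: mkdv_q.induct)
  case (3 n)
  show ?case by (rule ext) (simp add: 3 app_ddx del: sum.cl_ivl_Suc)
qed (simp_all add: zero_smooth.rep_eq fun_eq_iff app_ddx)

lemma S_smooth_eq: "S_smooth n (app f, app g) = torus_int (f * smooth.nls (f, g) n)"
  by (simp add: S_smooth_def torus_int_def nls_r_eq)

lemma K_smooth_eq: "K_smooth m (app f) = 1 / 2 * torus_int (smooth.mkdv f (2 * m - 1))"
  by (simp add: K_smooth_def torus_int_def mkdv_q_eq)

section \<open>Fourier coefficients and Sobolev seminorms\<close>

lemma Dx_cis: "Dx (\<lambda>x. c * cis (a * x)) = (\<lambda>x. (c * \<i> * of_real a) * cis (a * x))"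
proof (rule Dx_eqI)
  fix x
  have "((\<lambda>x. c * exp (\<i> * (of_real a * of_real x))) has_vector_derivative
     c * \<i> * of_real a * exp (\<i> * (of_real a * of_real x))) (at x)"
    by (rule has_vector_derivative_eq_rhs, rule has_vector_derivative_real_field)
       (auto intro!: derivative_eq_intros)
  then show "((\<lambda>x. c * cis (a * x)) has_vector_derivative c * \<i> * of_real a * cis (a * x)) (at x)"
    by (simp add: cis_conv_exp)
qed

lemma cis_differentiable: "(\<lambda>x. c * cis (a * x)) differentiable at (x :: real)"
proof -
  have "((\<lambda>x. c * exp (\<i> * (of_real a * of_real x))) has_vector_derivative
     c * \<i> * of_real a * exp (\<i> * (of_real a * of_real x))) (at x)"
    by (rule has_vector_derivative_eq_rhs, rule has_vector_derivative_real_field)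
       (auto intro!: derivative_eq_intros)
  then have "(\<lambda>x. c * exp (\<i> * (of_real a * of_real x))) differentiable at x"
    by (rule differentiableI_vector)
  then show ?thesis by (simp add: cis_conv_exp)
qed

lemma diffable_cis: "diffable n (\<lambda>x. c * cis (a * x))"
proof (induction n arbitrary: c)
  case (Suc n)
  then show ?case unfolding diffable_Suc Dx_cis using cis_differentiable by blast
next
  case 0
  show ?case unfolding diffable_0 using cis_differentiable by blast
qed

lemma cis_periodic: "cis (2 * pi * of_int n * (x + 1)) = cis (2 * pi * of_int n * x)"
proof -
  have "cis (2 * pi * of_int n * (x + 1)) = cis (2 * pi * of_int n * x) * cis (2 * pi * of_int n)"
    by (simp add: cis_mult algebra_simps)
  also have "cis (2 * pi * of_int n) = 1" by (rule cis_multiple_2pi) simp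
  finally show ?thesis by simp
qed

lift_definition expo :: "int \<Rightarrow> smooth" is "\<lambda>n x. cis (2 * pi * of_int n * x)"
  using diffable_cis[of _ 1] by (auto simp: smooth_per_iff periodic_def cis_periodic)

lemma app_expo: "app (expo n) x = cis (2 * pi * of_int n * x)"
  by (simp add: expo.rep_eq)

lemma expo_add: "expo (m + n) = expo m * expo n"
  by (rule smooth_eqI) (simp add: app_expo cis_mult algebra_simps)

lemma expo_0: "expo 0 = 1"
  by (rule smooth_eqI) (simp add: app_expo)

lemma norm_expo [simp]: "cmod (app (expo n) x) = 1"
  by (simp add: app_expo)

lemma cnj_expo: "cnj (app (expo n) x) = app (expo (- n)) x"
  by (simp add: app_expo cis_cnj)

lemma ddx_expo: "ddx (expo n) = cst (2 * pi * \<i> * of_int n) * expo n"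
proof (rule smooth_eqI)
  fix x
  have "app (ddx (expo n)) = Dx (\<lambda>x. 1 * cis (2 * pi * of_int n * x))"
    by (simp add: app_ddx expo.rep_eq)
  then show "app (ddx (expo n)) x = app (cst (2 * pi * \<i> * of_int n) * expo n) x"
    by (simp only: Dx_cis) (simp add: app_expo)
qed

lemma torus_int_expo: "torus_int (expo n) = (if n = 0 then 1 else 0)"
proof (cases "n = 0")
  case True
  then show ?thesis using integral_torus_const[of 1] by (simp add: expo_0 torus_int_def)
next
  case False
  have "2 * pi * \<i> * of_int n * torus_int (expo n) = 0"
    using smooth.I_D[of "expo n"] by (simp only: ddx_expo torus_int_cst_mult)
  with False show ?thesis by simp
qed

text \<open>Membership in \<open>L^2\<close> as a condition on one period. It covers the elements of \<^const>\<open>sobolev\<close> and the quotient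
  in Chernoff's argument below.\<close>

definition sq_int :: "tfun \<Rightarrow> bool" where
  "sq_int u \<longleftrightarrow> u \<in> borel_measurable torus \<and> integrable torus (\<lambda>x. (cmod (u x))\<^sup>2)"

lemma app_measurable [measurable]: "app f \<in> borel_measurable torus"
  by (rule borel_measurable_integrable[OF app_integrable])

lemma sq_int_bounded:
  assumes "u \<in> borel_measurable torus" "\<And>x. x \<in> {0..1} \<Longrightarrow> cmod (u x) \<le> B"
  shows "sq_int u"
proof -
  have "integrable torus (\<lambda>x. (cmod (u x))\<^sup>2)"
  proof (rule torus.integrable_const_bound[of _ "B\<^sup>2"])
    show "AE x in torus. norm ((cmod (u x))\<^sup>2) \<le> B\<^sup>2"
      using assms(2) by (intro AE_I2) (auto simp: space_torus intro!: power_mono)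
  qed (use assms in measurable)
  with assms show ?thesis by (simp add: sq_int_def)
qed

lemma sq_int_smooth: "sq_int (app f)"
  unfolding sq_int_def by (auto intro!: torus_integrable_continuous continuous_intros app_measurable)

lemma sq_int_integrable: assumes "sq_int u" shows "integrable torus u"
proof -
  have [measurable]: "u \<in> borel_measurable torus" using assms by (simp add: sq_int_def)
  have "integrable torus (\<lambda>x. cmod (u x))"
  proof (rule torus.square_integrable_imp_integrable)
    show "integrable torus (\<lambda>x. (cmod (u x))\<^sup>2)" using assms unfolding sq_int_def by (rule conjunct2)
  qed measurable
  then show ?thesis by (rule iffD1[OF integrable_norm_iff, rotated]) measurable
qed

lemma sq_int_add: assumes "sq_int u" "sq_int v" shows "sq_int (\<lambda>x. u x + v x)"
proof -
  have [measurable]: "u \<in> borel_measurable torus" "v \<in> borel_measurable torus"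
    using assms by (auto simp: sq_int_def)
  have "integrable torus (\<lambda>x. (cmod (u x + v x))\<^sup>2)"
  proof (rule Bochner_Integration.integrable_bound)
    show "integrable torus (\<lambda>x. 2 * (cmod (u x))\<^sup>2 + 2 * (cmod (v x))\<^sup>2)"
      using assms by (auto simp: sq_int_def)
    show "AE x in torus. norm ((cmod (u x + v x))\<^sup>2) \<le> norm (2 * (cmod (u x))\<^sup>2 + 2 * (cmod (v x))\<^sup>2)"
    proof (rule AE_I2)
      fix x
      have "(cmod (u x + v x))\<^sup>2 \<le> (cmod (u x) + cmod (v x))\<^sup>2"
        by (intro power_mono norm_triangle_ineq) auto
      also have "\<dots> \<le> 2 * (cmod (u x))\<^sup>2 + 2 * (cmod (v x))\<^sup>2"
        using zero_le_power2[of "cmod (u x) - cmod (v x)"] by (simp add: power2_eq_square algebra_simps)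
      finally show "norm ((cmod (u x + v x))\<^sup>2) \<le> norm (2 * (cmod (u x))\<^sup>2 + 2 * (cmod (v x))\<^sup>2)"
        by simp
    qed
  qed measurable
  then show ?thesis by (simp add: sq_int_def)
qed

lemma sq_int_cmult: assumes "sq_int u" shows "sq_int (\<lambda>x. c * u x)"
  using assms by (auto simp: sq_int_def norm_mult power_mult_distrib)

lemma integrable_mult_bounded_smooth:
  assumes "integrable torus u" shows "integrable torus (\<lambda>x. u x * app (expo n) x)"
proof (rule Bochner_Integration.integrable_bound[OF assms])
  show "(\<lambda>x. u x * app (expo n) x) \<in> borel_measurable torus"
    using assms by measurable
qed (simp add: norm_mult)

lemma fourier_expo: "fourier u n = (LINT x|torus. u x * app (expo (- n)) x)"
  by (simp add: fourier_def app_expo)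

lemma fourier_app: "fourier (app f) n = torus_int (f * expo (- n))"
  by (simp add: fourier_expo torus_int_def)

lemma fourier_add: "\<lbrakk>sq_int u; sq_int v\<rbrakk> \<Longrightarrow> fourier (u + v) n = fourier u n + fourier v n"
  by (simp add: fourier_expo ring_distribs integrable_mult_bounded_smooth sq_int_integrable)

lemma fourier_cmult: "fourier (\<lambda>x. c * u x) n = c * fourier u n"
  by (simp add: fourier_expo mult.assoc)

lemma fourier_uminus: "fourier (- u) n = - fourier u n"
  by (simp add: fourier_expo)

lemma fourier_D: "fourier (app (ddx f)) n = 2 * pi * \<i> * of_int n * fourier (app f) n"
proof -
  have "torus_int (ddx f * expo (- n)) = - torus_int (f * (cst (2 * pi * \<i> * of_int (- n)) * expo (- n)))"
    by (simp only: smooth.I_parts ddx_expo)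
  also have "f * (cst (2 * pi * \<i> * of_int (- n)) * expo (- n)) = cst (2 * pi * \<i> * of_int (- n)) * (f * expo (- n))"
    by (simp only: ac_simps)
  finally show ?thesis by (simp only: fourier_app torus_int_cst_mult) simp
qed

lemma fourier_Dpow: "cmod (fourier (app ((ddx ^^ k) f)) n) = (2 * pi * \<bar>of_int n\<bar>) ^ k * cmod (fourier (app f) n)"
  by (induction k) (auto simp: fourier_D norm_mult)

definition trunc :: "nat \<Rightarrow> tfun \<Rightarrow> smooth" where
  "trunc N u = (\<Sum>n\<in>{- int N..int N}. cst (fourier u n) * expo n)"

lemma fourier_trunc: "fourier (app (trunc N u)) n = (if \<bar>n\<bar> \<le> int N then fourier u n else 0)"
proof -
  have "fourier (app (trunc N u)) n = (\<Sum>k\<in>{- int N..int N}. fourier u k * torus_int (expo (k - n)))"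
    by (simp add: fourier_app trunc_def sum_distrib_right smooth.I_sum mult.assoc torus_int_cst_mult flip: expo_add)
  also have "\<dots> = (\<Sum>k\<in>{- int N..int N}. if k = n then fourier u k else 0)"
    by (intro sum.cong) (auto simp: torus_int_expo)
  finally show ?thesis by (auto simp: abs_le_iff)
qed

lemma LINT_mult_cnj_trunc:
  assumes "sq_int u"
  shows "(LINT x|torus. u x * cnj (app (trunc N v) x)) = (\<Sum>n\<in>{- int N..int N}. fourier u n * cnj (fourier v n))"
proof -
  have "(LINT x|torus. u x * cnj (app (trunc N v) x))
     = (LINT x|torus. (\<Sum>n\<in>{- int N..int N}. cnj (fourier v n) * (u x * app (expo (- n)) x)))"
    by (simp add: trunc_def cnj_expo sum_distrib_left algebra_simps)
  also have "\<dots> = (\<Sum>n\<in>{- int N..int N}. cnj (fourier v n) * fourier u n)"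
    using assms by (simp add: fourier_expo integrable_mult_bounded_smooth sq_int_integrable)
  finally show ?thesis by (simp add: mult.commute)
qed

lemma mult_cnj_eq: "z * cnj z = of_real ((cmod z)\<^sup>2)"
  by (rule complex_norm_square[symmetric])

text \<open>Pythagoras: the truncated Fourier series is the orthogonal projection.\<close>

lemma bessel_identity:
  assumes u: "sq_int u"
  shows "(LINT x|torus. (cmod (u x))\<^sup>2) = (LINT x|torus. (cmod (u x - app (trunc N u) x))\<^sup>2)
     + (\<Sum>n\<in>{- int N..int N}. (cmod (fourier u n))\<^sup>2)"
proof -
  let ?p = "app (trunc N u)" and ?S = "\<Sum>n\<in>{- int N..int N}. (cmod (fourier u n))\<^sup>2"
  have ue: "integrable torus (\<lambda>x. u x * app (expo n) x)" for n
    by (intro integrable_mult_bounded_smooth sq_int_integrable u)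
  have "(\<lambda>x. u x * cnj (?p x)) = (\<lambda>x. (\<Sum>n\<in>{- int N..int N}. cnj (fourier u n) * (u x * app (expo (- n)) x)))"
    by (simp add: trunc_def cnj_expo sum_distrib_left algebra_simps)
  then have up: "integrable torus (\<lambda>x. u x * cnj (?p x))"
    using ue by simp
  have upS: "(LINT x|torus. u x * cnj (?p x)) = of_real ?S"
    by (simp add: LINT_mult_cnj_trunc[OF u] mult_cnj_eq)
  have ppS: "(LINT x|torus. ?p x * cnj (?p x)) = of_real ?S"
    unfolding LINT_mult_cnj_trunc[OF sq_int_smooth] of_real_sum
    by (intro sum.cong) (auto simp: fourier_trunc mult_cnj_eq abs_le_iff)
  have "(LINT x|torus. (cmod (?p x))\<^sup>2) = Re (LINT x|torus. ?p x * cnj (?p x))"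
    by (subst integral_Re[symmetric])
       (auto intro!: torus_integrable_continuous continuous_intros simp: mult_cnj_eq)
  then have pp: "(LINT x|torus. (cmod (?p x))\<^sup>2) = ?S" by (simp add: ppS)
  have up': "(LINT x|torus. Re (u x * cnj (?p x))) = ?S"
    by (subst integral_Re[OF up]) (simp add: upS)
  have iu: "integrable torus (\<lambda>x. (cmod (u x))\<^sup>2)" using u by (simp add: sq_int_def)
  have ip: "integrable torus (\<lambda>x. (cmod (?p x))\<^sup>2)" using sq_int_smooth by (simp add: sq_int_def)
  have "(cmod (u x - ?p x))\<^sup>2 = (cmod (u x))\<^sup>2 + (cmod (?p x))\<^sup>2 - 2 * Re (u x * cnj (?p x))" for x
    by (simp add: cmod_power2) (simp add: power2_eq_square algebra_simps)
  then have "(LINT x|torus. (cmod (u x - ?p x))\<^sup>2) = (LINT x|torus. (cmod (u x))\<^sup>2) + ?S - 2 * ?S"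
    using iu ip integrable_Re[OF up] by (simp add: pp up' del: times_complex.sel)
  then show ?thesis by simp
qed

lemma finite_int_subset: "finite F \<Longrightarrow> \<exists>N. F \<subseteq> {- int N..int N}"
proof (induction F rule: finite_induct)
  case (insert n F)
  then obtain N where "F \<subseteq> {- int N..int N}" by blast
  moreover have "{- int N..int N} \<subseteq> {- int (max N (nat \<bar>n\<bar>))..int (max N (nat \<bar>n\<bar>))}"
    "n \<in> {- int (max N (nat \<bar>n\<bar>))..int (max N (nat \<bar>n\<bar>))}" by auto
  ultimately have "insert n F \<subseteq> {- int (max N (nat \<bar>n\<bar>))..int (max N (nat \<bar>n\<bar>))}" by blast
  then show ?case by blast
qed simp

lemma bessel:
  assumes "sq_int u" "finite F"
  shows "(\<Sum>n\<in>F. (cmod (fourier u n))\<^sup>2) \<le> (LINT x|torus. (cmod (u x))\<^sup>2)"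
proof -
  obtain N where "F \<subseteq> {- int N..int N}" using finite_int_subset assms(2) by blast
  then have "(\<Sum>n\<in>F. (cmod (fourier u n))\<^sup>2) \<le> (\<Sum>n\<in>{- int N..int N}. (cmod (fourier u n))\<^sup>2)"
    by (intro sum_mono2) auto
  also have "\<dots> \<le> (LINT x|torus. (cmod (u x))\<^sup>2)"
    unfolding bessel_identity[OF assms(1), of N] by (simp add: integral_nonneg_AE)
  finally show ?thesis .
qed

lemma finite_sums_le_imp:
  fixes f :: "'i \<Rightarrow> real"
  assumes "\<And>F. finite F \<Longrightarrow> sum f F \<le> B" "\<And>n. f n \<ge> 0"
  shows "f summable_on UNIV" "infsum f UNIV \<le> B"
proof -
  show s: "f summable_on UNIV"
    using assms by (intro nonneg_bdd_above_summable_on bdd_aboveI[of _ B]) auto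
  show "infsum f UNIV \<le> B"
    by (rule infsum_le_finite_sums[OF s]) (use assms in auto)
qed

lemma sob_term_nonneg [simp]: "sob_term m u n \<ge> 0"
  by (simp add: sob_term_def)

lemma sobolev_iff: "u \<in> sobolev m \<longleftrightarrow> periodic u \<and> sq_int u \<and> sob_term m u summable_on UNIV"
  by (auto simp: sobolev_def sq_int_def)

lemma weight_le: "(1 + x\<^sup>2) ^ m \<le> 2 ^ m * (1 + (2 * pi * \<bar>x\<bar>) ^ (2 * m))" for x :: real
proof (cases "\<bar>x\<bar> \<le> 1")
  case True
  then have "x\<^sup>2 \<le> 1" by (simp add: abs_square_le_1)
  then have "(1 + x\<^sup>2) ^ m \<le> 2 ^ m" by (intro power_mono) auto
  also have "\<dots> \<le> 2 ^ m * (1 + (2 * pi * \<bar>x\<bar>) ^ (2 * m))" by simp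
  finally show ?thesis .
next
  case False
  then have "1 \<le> x\<^sup>2" using power_mono[of 1 "\<bar>x\<bar>" 2] by simp
  then have "(1 + x\<^sup>2) ^ m \<le> (2 * x\<^sup>2) ^ m" by (intro power_mono) auto
  also have "\<dots> = 2 ^ m * \<bar>x\<bar> ^ (2 * m)" by (simp add: power_mult_distrib power_mult)
  also have "\<dots> \<le> 2 ^ m * (2 * pi * \<bar>x\<bar>) ^ (2 * m)"
    using pi_ge_two by (intro mult_left_mono power_mono) (auto simp: mult_le_cancel_right1)
  also have "\<dots> \<le> 2 ^ m * (1 + (2 * pi * \<bar>x\<bar>) ^ (2 * m))" by simp
  finally show ?thesis .
qed

text \<open>Derivatives multiply the coefficients by \<open>2 \<pi> \<i> n\<close>, so Bessel's inequality for the \<open>m\<close>-th derivative bounds the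
  weighted sum.\<close>

lemma smooth_in_sobolev: "app f \<in> sobolev m"
proof -
  let ?B = "2 ^ m * ((LINT x|torus. (cmod (app f x))\<^sup>2) + (LINT x|torus. (cmod (app ((ddx ^^ m) f) x))\<^sup>2))"
  have le: "sob_term m (app f) n \<le> 2 ^ m * ((cmod (fourier (app f) n))\<^sup>2 + (cmod (fourier (app ((ddx ^^ m) f)) n))\<^sup>2)" for n
  proof -
    have "sob_term m (app f) n \<le> 2 ^ m * (1 + (2 * pi * \<bar>of_int n\<bar>) ^ (2 * m)) * (cmod (fourier (app f) n))\<^sup>2"
      unfolding sob_term_def by (intro mult_right_mono weight_le) auto
    moreover have "(cmod (fourier (app ((ddx ^^ m) f)) n))\<^sup>2
      = (2 * pi * \<bar>of_int n\<bar>) ^ (2 * m) * (cmod (fourier (app f) n))\<^sup>2"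
      unfolding fourier_Dpow power_even_eq by (rule power_mult_distrib)
    ultimately show ?thesis by (simp only: ring_distribs mult_1_left mult_1_right mult.assoc)
  qed
  have "sum (sob_term m (app f)) F \<le> ?B" if "finite F" for F
  proof -
    have "sum (sob_term m (app f)) F \<le> 2 ^ m * ((\<Sum>n\<in>F. (cmod (fourier (app f) n))\<^sup>2) + (\<Sum>n\<in>F. (cmod (fourier (app ((ddx ^^ m) f)) n))\<^sup>2))"
      using sum_mono[of F, OF le] by (simp add: sum_distrib_left[symmetric] sum.distrib)
    also have "\<dots> \<le> ?B"
      by (intro mult_left_mono add_mono bessel sq_int_smooth that) auto
    finally show ?thesis .
  qed
  then have "sob_term m (app f) summable_on UNIV"
    by (rule finite_sums_le_imp) auto
  then show ?thesis
    by (simp add: sobolev_iff sq_int_smooth periodic_def app_periodic)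
qed

lemma sob_norm_nonneg [simp]: "sob_norm m u \<ge> 0"
  by (simp add: sob_norm_def infsum_nonneg)

lemma sob_norm_sq: "(sob_norm m u)\<^sup>2 = (\<Sum>\<^sub>\<infinity>n. sob_term m u n)"
  by (simp add: sob_norm_def infsum_nonneg)

lemma sum_sob_term_le:
  assumes "u \<in> sobolev m" "finite F"
  shows "sum (sob_term m u) F \<le> (sob_norm m u)\<^sup>2"
  unfolding sob_norm_sq using assms by (intro finite_sum_le_infsum) (auto simp: sobolev_iff)

text \<open>The Sobolev seminorm is the \<open>l^2\<close> norm of these numbers, so that its triangle inequality is Minkowski's.\<close>

definition wcoeff :: "nat \<Rightarrow> tfun \<Rightarrow> int \<Rightarrow> real" where
  "wcoeff m u n = sqrt ((1 + (of_int n)\<^sup>2) ^ m) * cmod (fourier u n)"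

lemma sob_term_eq_sq: "sob_term m u n = (wcoeff m u n)\<^sup>2"
  by (simp add: sob_term_def wcoeff_def power_mult_distrib)

lemma L2_set_wcoeff_le:
  assumes "u \<in> sobolev m" "finite F"
  shows "L2_set (wcoeff m u) F \<le> sob_norm m u"
proof -
  have "L2_set (wcoeff m u) F = sqrt (sum (sob_term m u) F)"
    by (simp add: L2_set_def sob_term_eq_sq)
  also have "\<dots> \<le> sqrt ((sob_norm m u)\<^sup>2)"
    using sum_sob_term_le[OF assms] by (rule real_sqrt_le_mono)
  finally show ?thesis by simp
qed

lemma sob_norm_leI:
  assumes "\<And>F. finite F \<Longrightarrow> L2_set (wcoeff m u) F \<le> B"
  shows "sob_term m u summable_on UNIV" "sob_norm m u \<le> B"
proof -
  have B: "B \<ge> 0" using assms[of "{}"] by simp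
  have "sum (sob_term m u) F \<le> B\<^sup>2" if "finite F" for F
    using assms[OF that] B unfolding L2_set_def sob_term_eq_sq by (simp add: real_sqrt_le_iff' sum_nonneg sqrt_le_D)
  note fs = finite_sums_le_imp[of "sob_term m u", OF this]
  from fs show "sob_term m u summable_on UNIV" by simp
  show "sob_norm m u \<le> B"
    unfolding sob_norm_def using fs(2) B by (intro real_le_lsqrt) (auto simp: infsum_nonneg)
qed

lemma sob_add_aux:
  assumes u: "u \<in> sobolev m" and v: "v \<in> sobolev m" and F: "finite F"
  shows "L2_set (wcoeff m (u + v)) F \<le> sob_norm m u + sob_norm m v"
proof -
  have "L2_set (wcoeff m (u + v)) F \<le> L2_set (\<lambda>n. wcoeff m u n + wcoeff m v n) F"
  proof (rule L2_set_mono)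
    fix n
    have "cmod (fourier (u + v) n) \<le> cmod (fourier u n) + cmod (fourier v n)"
      using u v by (simp add: fourier_add sobolev_iff norm_triangle_ineq)
    then have "wcoeff m (u + v) n \<le> sqrt ((1 + (of_int n)\<^sup>2) ^ m) * (cmod (fourier u n) + cmod (fourier v n))"
      unfolding wcoeff_def by (intro mult_left_mono) auto
    then show "wcoeff m (u + v) n \<le> wcoeff m u n + wcoeff m v n"
      by (simp add: wcoeff_def ring_distribs)
  qed (simp add: wcoeff_def)
  also have "\<dots> \<le> L2_set (wcoeff m u) F + L2_set (wcoeff m v) F"
    by (rule L2_set_triangle_ineq)
  also have "\<dots> \<le> sob_norm m u + sob_norm m v"
    by (intro add_mono L2_set_wcoeff_le u v F)
  finally show ?thesis .
qed

lemma sob_term_cscale: "sob_term m (cscale c u) n = (cmod c)\<^sup>2 * sob_term m u n"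
  by (simp add: sob_term_def cscale_def fourier_cmult norm_mult power_mult_distrib)

lemma zero_in_sobolev: "0 \<in> sobolev m"
  using smooth_in_sobolev[of 0 m] by (simp add: zero_smooth.rep_eq)

lemma seminormed_sobolev: "seminormed_space cscale (sobolev m) (sob_norm m)"
proof
  show "0 \<in> sobolev m" by (rule zero_in_sobolev)
next
  fix u v assume u: "u \<in> sobolev m" and v: "v \<in> sobolev m"
  note s = sob_norm_leI[OF sob_add_aux[OF u v]]
  show "sob_norm m (u + v) \<le> sob_norm m u + sob_norm m v" by (rule s)
  have "sq_int (u + v)" using u v sq_int_add[of u v] by (simp add: sobolev_iff plus_fun_def)
  moreover have "periodic (u + v)" using u v by (simp add: sobolev_iff periodic_def)
  ultimately show "u + v \<in> sobolev m" using s by (simp add: sobolev_iff)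
next
  fix u c assume u: "u \<in> sobolev m"
  show "sob_norm m (cscale c u) = cmod c * sob_norm m u"
    unfolding sob_norm_def sob_term_cscale infsum_cmult_right' real_sqrt_mult by simp
  have "sob_term m (cscale c u) summable_on UNIV"
    unfolding sob_term_cscale[abs_def] using u by (intro summable_on_cmult_right) (simp add: sobolev_iff)
  moreover have "sq_int (cscale c u)" using u sq_int_cmult[of u c] by (simp add: sobolev_iff cscale_def)
  moreover have "periodic (cscale c u)" using u by (simp add: sobolev_iff periodic_def cscale_def)
  ultimately show "cscale c u \<in> sobolev m" by (simp add: sobolev_iff)
qed (auto simp: cscale_def fun_eq_iff algebra_simps)

interpretation sob: seminormed_space cscale "sobolev m" "sob_norm m" for m
  by (rule seminormed_sobolev)

text \<open>The coefficients of the truncation error are the tail of a convergent series. This is the density of the smooth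
  functions.\<close>

lemma sob_norm_trunc_diff:
  assumes u: "u \<in> sobolev m" and e: "e > 0"
  shows "\<exists>N. sob_norm m (app (trunc N u) - u) < e"
proof -
  have s: "sob_term m u summable_on UNIV" using u by (simp add: sobolev_iff)
  have "(sum (sob_term m u) \<longlongrightarrow> infsum (sob_term m u) UNIV) (finite_subsets_at_top UNIV)"
    using infsum_tendsto[OF s] .
  then have "\<forall>\<^sub>F F in finite_subsets_at_top UNIV. infsum (sob_term m u) UNIV - (e / 2)\<^sup>2 < sum (sob_term m u) F"
    using e by (intro order_tendstoD) auto
  then obtain F where F: "finite F" "infsum (sob_term m u) UNIV - (e / 2)\<^sup>2 < sum (sob_term m u) F"
    by (metis eventually_finite_subsets_at_top subset_UNIV order_refl)
  obtain N where N: "F \<subseteq> {- int N..int N}" using finite_int_subset[OF F(1)] by blast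
  have squ: "sq_int u" using u by (simp add: sobolev_iff)
  have four: "fourier (app (trunc N u) - u) n = (if \<bar>n\<bar> \<le> int N then 0 else - fourier u n)" for n
  proof -
    have "sq_int (- u)" using sq_int_cmult[OF squ, of "-1"] by (simp add: fun_Compl_def)
    then have "fourier (app (trunc N u) + - u) n = fourier (app (trunc N u)) n - fourier u n"
      by (subst fourier_add) (auto simp: sq_int_smooth fourier_uminus)
    then show ?thesis by (simp add: fourier_trunc)
  qed
  have "sob_norm m (app (trunc N u) - u) \<le> e / 2"
  proof (rule sob_norm_leI)
    fix G :: "int set" assume G: "finite G"
    have "sum (sob_term m (app (trunc N u) - u)) G \<le> sum (sob_term m u) (G - F)"
    proof -
      have "sum (sob_term m (app (trunc N u) - u)) G = sum (sob_term m (app (trunc N u) - u)) (G - F)"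
        by (rule sum.mono_neutral_right) (use G N in \<open>auto simp: sob_term_def four abs_le_iff\<close>)
      also have "\<dots> \<le> sum (sob_term m u) (G - F)"
        by (rule sum_mono) (auto simp: sob_term_def four)
      finally show ?thesis .
    qed
    moreover have "sum (sob_term m u) (G - F) + sum (sob_term m u) F = sum (sob_term m u) (G \<union> F)"
    proof -
      have "(G - F) \<inter> F = {}" by blast
      from sum.union_disjoint[OF _ _ this, of "sob_term m u"] G F show ?thesis by simp
    qed
    moreover have "sum (sob_term m u) (G \<union> F) \<le> infsum (sob_term m u) UNIV"
      using G F s by (intro finite_sum_le_infsum) auto
    ultimately have "sum (sob_term m (app (trunc N u) - u)) G \<le> (e / 2)\<^sup>2" using F(2) by linarith
    then have "sqrt (sum (sob_term m (app (trunc N u) - u)) G) \<le> sqrt ((e / 2)\<^sup>2)" by (rule real_sqrt_le_mono)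
    then show "L2_set (wcoeff m (app (trunc N u) - u)) G \<le> e / 2"
      using e by (simp add: L2_set_def sob_term_eq_sq)
  qed
  then show ?thesis using e by (intro exI[of _ N]) linarith
qed

lemma app_cst_mult: "app (cst c * f) = cscale c (app f)"
  by (auto simp: cscale_def)

lemma app_plus: "app (f + g) = app f + app g"
  by (auto simp: fun_eq_iff)

lemma app_minus': "app (f - g) = app f - app g"
  by (auto simp: fun_eq_iff)

interpretation sobd: dense_embedding cscale "sobolev m" "sob_norm m" "\<lambda>c f. cst c * f" app for m
proof
  fix v and e :: real assume "v \<in> sobolev m" "e > 0"
  then show "\<exists>b. sob_norm m (app b - v) < e" using sob_norm_trunc_diff by blast
qed (simp_all add: smooth_in_sobolev app_cst_mult app_plus)

text \<open>The bound is chosen so that induction works: the two new terms of the sum are at most the increment of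
  \<open>- 4 / (N + 1)\<close>. Only its independence of \<open>N\<close> matters.\<close>

lemma sum_inv_sq_le: "(\<Sum>n\<in>{- int N..int N}. 1 / (1 + (real_of_int n)\<^sup>2)) \<le> 5 - 4 / (real N + 1)"
proof (induction N)
  case (Suc N)
  have "{- int (Suc N)..int (Suc N)} = insert (- int (Suc N)) (insert (int (Suc N)) {- int N..int N})" by auto
  then have "(\<Sum>n\<in>{- int (Suc N)..int (Suc N)}. 1 / (1 + (real_of_int n)\<^sup>2))
     = 2 / (1 + (real N + 1)\<^sup>2) + (\<Sum>n\<in>{- int N..int N}. 1 / (1 + (real_of_int n)\<^sup>2))"
    by (simp add: power2_eq_square algebra_simps)
  also have "\<dots> \<le> 2 / (1 + (real N + 1)\<^sup>2) + (5 - 4 / (real N + 1))" using Suc by simp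
  also have "2 / (1 + (real N + 1)\<^sup>2) \<le> 4 / ((real N + 1) * (real N + 2))"
  proof -
    have "(real N + 1) * (real N + 2) \<le> 2 * (1 + (real N + 1)\<^sup>2)"
      by (simp add: power2_eq_square algebra_simps)
    then have "2 / (1 + (real N + 1)\<^sup>2) \<le> 2 / ((real N + 1) * (real N + 2) / 2)"
      by (intro divide_left_mono mult_pos_pos) (auto intro: add_pos_nonneg)
    then show ?thesis by simp
  qed
  also have "4 / ((real N + 1) * (real N + 2)) + (5 - 4 / (real N + 1)) = 5 - 4 / (real (Suc N) + 1)"
    by (simp add: divide_simps) (simp add: algebra_simps)
  finally show ?case by simp
qed simp

definition sup_norm :: "smooth \<Rightarrow> real" where
  "sup_norm f = (SUP x. cmod (app f x))"

lemma app_periodic_int: "app f (x + of_int k) = app f x"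
proof -
  have nat: "app f (y + of_nat n) = app f y" for y n
  proof (induction n)
    case (Suc n)
    have "app f (y + of_nat (Suc n)) = app f ((y + of_nat n) + 1)" by (simp add: add_ac)
    then show ?case using Suc by (simp only: app_periodic)
  qed simp
  show ?thesis
  proof (cases "k \<ge> 0")
    case True
    then show ?thesis using nat[of x "nat k"] by simp
  next
    case False
    then show ?thesis using nat[of "x + of_int k" "nat (- k)"] by simp
  qed
qed

lemma app_bounded: "\<exists>B. \<forall>x. cmod (app f x) \<le> B"
proof -
  have "compact (app f ` {0..1})"
    by (intro compact_continuous_image app_continuous) auto
  then obtain B where B: "\<And>x. x \<in> {0..1} \<Longrightarrow> cmod (app f x) \<le> B"
    using compact_imp_bounded bounded_iff by (metis imageI)
  have "cmod (app f x) \<le> B" for x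
    using B[of "frac x"] app_periodic_int[of f "frac x" "\<lfloor>x\<rfloor>"]
    by (simp add: frac_lt_1 less_imp_le) (simp add: frac_def)
  then show ?thesis by blast
qed

lemma cmod_le_sup_norm: "cmod (app f x) \<le> sup_norm f"
proof -
  obtain B where "\<And>x. cmod (app f x) \<le> B" using app_bounded by blast
  then show ?thesis unfolding sup_norm_def by (intro cSUP_upper bdd_aboveI2) auto
qed

lemma sup_norm_leI: "(\<And>x. cmod (app f x) \<le> B) \<Longrightarrow> sup_norm f \<le> B"
  unfolding sup_norm_def by (intro cSUP_least) auto

lemma sup_norm_nonneg [simp]: "0 \<le> sup_norm f"
  using cmod_le_sup_norm[of f 0] norm_ge_zero order_trans by blast

lemma sup_norm_add: "sup_norm (f + g) \<le> sup_norm f + sup_norm g"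
  by (rule sup_norm_leI) (auto intro: order_trans[OF norm_triangle_ineq] add_mono cmod_le_sup_norm)

lemma sup_norm_mult: "sup_norm (f * g) \<le> sup_norm f * sup_norm g"
  by (rule sup_norm_leI) (auto simp: norm_mult intro!: mult_mono cmod_le_sup_norm)

lemma app_lipschitz: "\<exists>L\<ge>0. \<forall>x y. cmod (app f x - app f y) \<le> L * \<bar>x - y\<bar>"
proof -
  have "cmod (app f x - app f y) \<le> sup_norm (ddx f) * norm (x - y)" for x y
  proof (rule differentiable_bound[of UNIV "app f" "\<lambda>x h. h *\<^sub>R app (ddx f) x"])
    show "(app f has_derivative (\<lambda>h. h *\<^sub>R app (ddx f) x)) (at x within UNIV)" for x
      using app_has_derivative[of f x] by (simp add: has_vector_derivative_def)
    show "onorm (\<lambda>h. h *\<^sub>R app (ddx f) x) \<le> sup_norm (ddx f)" for x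
    proof (rule onorm_le)
      fix h :: real
      show "norm (h *\<^sub>R app (ddx f) x) \<le> sup_norm (ddx f) * norm h"
        using mult_right_mono[OF cmod_le_sup_norm[of "ddx f" x], of "\<bar>h\<bar>"] by (simp add: mult.commute)
    qed
  qed auto
  then show ?thesis by (intro exI[of _ "sup_norm (ddx f)"]) auto
qed

text \<open>The zero of \<open>exp (2 \<pi> \<i> t) - 1\<close> at \<open>t = 0\<close> is simple and the only one in one period.\<close>

lemma cis_minus_1_lower: "\<exists>c>0. \<forall>t. \<bar>t\<bar> \<le> 1 / 2 \<longrightarrow> c * \<bar>t\<bar> \<le> cmod (cis (2 * pi * t) - 1)"
proof -
  have small: "sin x \<ge> x / 2" if "0 \<le> x" "x \<le> pi / 3" for x
  proof -
    have "sin 0 - 0 / 2 \<le> sin x - x / 2"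
    proof (rule DERIV_nonneg_imp_nondecreasing[OF that(1)])
      fix y assume y: "0 \<le> y" "y \<le> x"
      have "cos y \<ge> cos (pi / 3)"
        using y that by (intro cos_monotone_0_pi_le) auto
      then have "cos y - 1 / 2 \<ge> 0" by (simp add: cos_60)
      moreover have "((\<lambda>y. sin y - y / 2) has_real_derivative cos y - 1 / 2) (at y)"
        by (auto intro!: derivative_eq_intros)
      ultimately show "\<exists>d. ((\<lambda>y. sin y - y / 2) has_real_derivative d) (at y) \<and> d \<ge> 0" by blast
    qed
    then show ?thesis by simp
  qed
  have sin_ge: "sin x \<ge> x / 2" if "0 \<le> x" "x \<le> pi / 2" for x
  proof (cases "x \<le> pi / 3")
    case False
    have "x / 2 \<le> pi / 4" using that by simp
    also have "\<dots> \<le> 4 / 5" using pi_less_4 pi_approx by simp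
    also have "4 / 5 \<le> sqrt 3 / 2"
      using real_le_rsqrt[of "8 / 5" 3] by (simp add: power2_eq_square)
    also have "\<dots> = sin (pi / 3)" by (simp add: sin_60)
    also have "\<dots> \<le> sin x" using False that by (intro sin_monotone_2pi_le) auto
    finally show ?thesis .
  qed (use small that in auto)
  have "pi * \<bar>t\<bar> \<le> cmod (cis (2 * pi * t) - 1)" if t: "\<bar>t\<bar> \<le> 1 / 2" for t
  proof -
    have "pi * \<bar>t\<bar> / 2 \<le> sin (pi * \<bar>t\<bar>)" using t by (intro sin_ge) auto
    also have "\<dots> \<le> \<bar>sin (pi * t)\<bar>" by (cases "t \<ge> 0") auto
    finally have "pi * \<bar>t\<bar> \<le> 2 * \<bar>sin (pi * t)\<bar>" by simp
    also have "\<dots> = cmod (cis (2 * pi * t) - 1)"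
      using dist_exp_i_1[of "2 * pi * t"] by (simp add: cis_conv_exp)
    finally show ?thesis .
  qed
  then show ?thesis by (intro exI[of _ pi]) auto
qed

text \<open>Chernoff's argument. Divide \<open>f - f x0\<close> by \<open>exp (2 \<pi> \<i> (x - x0)) - 1\<close>. The quotient \<open>g\<close> is bounded because \<open>f\<close> is
  Lipschitz, and multiplication by the exponential shifts Fourier coefficients, so the coefficients of
  \<open>f - f x0\<close> are differences of consecutive coefficients of \<open>g\<close>. The partial sums of the Fourier series of
  \<open>f\<close> at \<open>x0\<close> telescope to \<open>f x0\<close> up to two coefficients of \<open>g\<close>, which tend to 0 by Bessel's inequality. The
  sum of the absolute values of the coefficients of \<open>f\<close> is bounded by the Cauchy--Schwarz inequality.\<close>

lemma sup_norm_le_sob_norm: "sup_norm f \<le> sqrt 5 * sob_norm 1 (app f)"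
proof (rule sup_norm_leI)
  fix x0
  obtain L where L: "L \<ge> 0" "\<And>x y. cmod (app f x - app f y) \<le> L * \<bar>x - y\<bar>"
    using app_lipschitz by blast
  obtain c where c: "c > 0" "\<And>t. \<bar>t\<bar> \<le> 1 / 2 \<Longrightarrow> c * \<bar>t\<bar> \<le> cmod (cis (2 * pi * t) - 1)"
    using cis_minus_1_lower by blast
  define g where "g x = (app f x - app f x0) / (cis (2 * pi * (x - x0)) - 1)" for x
  have bound: "cmod (app f x - app f x0) \<le> L / c * cmod (cis (2 * pi * (x - x0)) - 1)" for x
  proof -
    \<comment> \<open>reduce to the period centred at \<open>x0\<close>\<close>
    define k where "k = round (x - x0)"
    define t where "t = x - x0 - of_int k"
    have t: "\<bar>t\<bar> \<le> 1 / 2" using of_int_round_abs_le[of "x - x0"] by (simp add: t_def k_def abs_minus_commute)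
    have "app f x = app f (x0 + t)" using app_periodic_int[of f "x0 + t" k] by (simp add: t_def)
    then have "cmod (app f x - app f x0) \<le> L * \<bar>t\<bar>" using L(2)[of "x0 + t" x0] by simp
    also have "\<dots> \<le> L / c * (c * \<bar>t\<bar>)" using c by simp
    also have "\<dots> \<le> L / c * cmod (cis (2 * pi * t) - 1)"
      using c L t by (intro mult_left_mono) auto
    also have "cis (2 * pi * t) = cis (2 * pi * (x - x0))"
    proof -
      have "cis (2 * pi * (x - x0)) = cis (2 * pi * t) * cis (2 * pi * of_int k)"
        by (simp add: t_def cis_mult algebra_simps)
      also have "cis (2 * pi * of_int k) = 1" by (rule cis_multiple_2pi) simp
      finally show ?thesis by simp
    qed
    finally show ?thesis .
  qed
  have g_eq: "app f x - app f x0 = g x * (cis (2 * pi * (x - x0)) - 1)" for x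
    using bound[of x] by (cases "cis (2 * pi * (x - x0)) = 1") (auto simp: g_def)
  have g_meas: "g \<in> borel_measurable torus"
  proof -
    have "(\<lambda>x. cis (2 * pi * (x - x0)) - 1) \<in> borel_measurable torus"
      by (intro borel_measurable_integrable torus_integrable_continuous continuous_intros)
    then show ?thesis unfolding g_def by measurable
  qed
  have sq: "sq_int g"
  proof (rule sq_int_bounded[OF g_meas])
    fix x
    show "cmod (g x) \<le> L / c"
      using bound[of x] L c unfolding g_def by (auto simp: norm_divide divide_simps split: if_splits)
  qed
  define a where "a n = cis (2 * pi * of_int n * x0) * fourier g n" for n
  have tele: "cis (2 * pi * of_int n * x0) * fourier (app f) n - (if n = 0 then app f x0 else 0) = a (n - 1) - a n" for n
  proof -
    have ig: "integrable torus (\<lambda>x. g x * app (expo m) x)" for m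
      by (intro integrable_mult_bounded_smooth sq_int_integrable sq)
    have "fourier (app f) n = (LINT x|torus. app f x0 * app (expo (- n)) x
       + (cis (- 2 * pi * x0) * (g x * app (expo (- (n - 1))) x) - g x * app (expo (- n)) x))"
    proof -
      have "app f x * app (expo (- n)) x = app f x0 * app (expo (- n)) x
       + (cis (- 2 * pi * x0) * (g x * app (expo (- (n - 1))) x) - g x * app (expo (- n)) x)" for x
      proof -
        have "cis (2 * pi * (x - x0)) * app (expo (- n)) x = cis (- 2 * pi * x0) * app (expo (- (n - 1))) x"
          by (simp add: app_expo cis_mult algebra_simps)
        moreover have "app f x = app f x0 + g x * (cis (2 * pi * (x - x0)) - 1)"
          using g_eq[of x] by (simp add: algebra_simps)
        moreover have "(app f x0 + g x * (cis (2 * pi * (x - x0)) - 1)) * app (expo (- n)) x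
          = app f x0 * app (expo (- n)) x + (g x * (cis (2 * pi * (x - x0)) * app (expo (- n)) x) - g x * app (expo (- n)) x)"
          by (simp add: algebra_simps)
        ultimately show ?thesis by (simp only: mult.left_commute)
      qed
      then show ?thesis by (simp add: fourier_expo)
    qed
    also have "\<dots> = app f x0 * torus_int (expo (- n)) + (cis (- 2 * pi * x0) * fourier g (n - 1) - fourier g n)"
      using ig app_integrable[of "expo (- n)"] by (simp add: fourier_expo torus_int_def)
    finally have f_eq: "fourier (app f) n
      = app f x0 * torus_int (expo (- n)) + (cis (- 2 * pi * x0) * fourier g (n - 1) - fourier g n)" .
    have "cis (2 * pi * of_int n * x0) * fourier (app f) n
       = cis (2 * pi * of_int n * x0) * (app f x0 * torus_int (expo (- n)))
         + ((cis (2 * pi * of_int n * x0) * cis (- 2 * pi * x0)) * fourier g (n - 1) - a n)"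
      unfolding f_eq a_def by (simp only: ring_distribs right_diff_distrib mult.assoc)
    also have "cis (2 * pi * of_int n * x0) * cis (- 2 * pi * x0) = cis (2 * pi * of_int (n - 1) * x0)"
      by (simp add: cis_mult algebra_simps)
    finally show ?thesis by (simp add: a_def torus_int_expo)
  qed
  define T where "T n = cis (2 * pi * of_int n * x0) * fourier (app f) n" for n
  have sum_eq: "(\<Sum>n\<in>{- int N..int N}. T n)
     = app f x0 + a (- int N - 1) - a (int N)" for N
  proof (induction N)
    case 0
    show ?case using tele[of 0] by (simp add: T_def algebra_simps)
  next
    case (Suc N)
    have "{- int (Suc N)..int (Suc N)} = insert (- int (Suc N)) (insert (int (Suc N)) {- int N..int N})" by auto
    then have "(\<Sum>n\<in>{- int (Suc N)..int (Suc N)}. T n) = T (- int (Suc N)) + (T (int (Suc N)) + (\<Sum>n\<in>{- int N..int N}. T n))"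
      by simp
    also have "T (- int (Suc N)) = a (- int (Suc N) - 1) - a (- int N - 1)"
      using tele[of "- int (Suc N)"] by (simp add: T_def minus_diff_commute[of "int N"])
    also have "T (int (Suc N)) = a (int N) - a (int (Suc N))"
      using tele[of "int (Suc N)"] by (simp add: T_def)
    finally show ?case using Suc by simp
  qed
  have a_small: "\<exists>N. cmod (a (- int N - 1)) < e \<and> cmod (a (int N)) < e" if e: "e > 0" for e
  proof -
    have lim: "(\<lambda>N. cmod (fourier g (h N))) \<longlonglongrightarrow> 0" if "inj h" for h :: "nat \<Rightarrow> int"
    proof -
      have "summable (\<lambda>N. (cmod (fourier g (h N)))\<^sup>2)"
      proof (rule summableI_nonneg_bounded)
        fix n
        have "(\<Sum>N<n. (cmod (fourier g (h N)))\<^sup>2) = (\<Sum>k\<in>h ` {..<n}. (cmod (fourier g k))\<^sup>2)"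
          using that by (subst sum.reindex) (auto simp: inj_on_def)
        also have "\<dots> \<le> (LINT x|torus. (cmod (g x))\<^sup>2)" by (intro bessel sq) auto
        finally show "(\<Sum>N<n. (cmod (fourier g (h N)))\<^sup>2) \<le> (LINT x|torus. (cmod (g x))\<^sup>2)" .
      qed auto
      from tendsto_real_sqrt[OF summable_LIMSEQ_zero[OF this]] show ?thesis by simp
    qed
    have "(\<lambda>N. cmod (fourier g (int N))) \<longlonglongrightarrow> 0" "(\<lambda>N. cmod (fourier g (- int N - 1))) \<longlonglongrightarrow> 0"
      by (auto intro!: lim simp: inj_def)
    then have "\<forall>\<^sub>F N in sequentially. cmod (fourier g (int N)) < e \<and> cmod (fourier g (- int N - 1)) < e"
      using e by (intro eventually_conj order_tendstoD(2)) auto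
    then obtain N where "cmod (fourier g (int N)) < e \<and> cmod (fourier g (- int N - 1)) < e"
      by (auto simp: eventually_sequentially)
    then show ?thesis by (intro exI[of _ N]) (simp add: a_def norm_mult)
  qed
  have partial: "(\<Sum>n\<in>{- int N..int N}. cmod (fourier (app f) n)) \<le> sqrt 5 * sob_norm 1 (app f)" for N
  proof -
    let ?A = "{- int N..int N}"
    have "(\<Sum>n\<in>?A. cmod (fourier (app f) n)) = (\<Sum>n\<in>?A. \<bar>sqrt (1 / (1 + (of_int n)\<^sup>2))\<bar> * \<bar>wcoeff 1 (app f) n\<bar>)"
    proof (rule sum.cong)
      fix n :: int
      have "1 + (real_of_int n)\<^sup>2 > 0" by (simp add: add_pos_nonneg)
      then show "cmod (fourier (app f) n) = \<bar>sqrt (1 / (1 + (of_int n)\<^sup>2))\<bar> * \<bar>wcoeff 1 (app f) n\<bar>"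
        by (simp add: wcoeff_def real_sqrt_divide abs_mult)
    qed simp
    also have "\<dots> \<le> L2_set (\<lambda>n. sqrt (1 / (1 + (of_int n)\<^sup>2))) ?A * L2_set (wcoeff 1 (app f)) ?A"
      by (rule L2_set_mult_ineq)
    also have "\<dots> \<le> sqrt 5 * sob_norm 1 (app f)"
    proof (intro mult_mono L2_set_wcoeff_le smooth_in_sobolev)
      have "(\<Sum>n\<in>?A. 1 / (1 + (real_of_int n)\<^sup>2)) \<le> 5"
        using sum_inv_sq_le[of N] by (rule order_trans) simp
      then show "L2_set (\<lambda>n. sqrt (1 / (1 + (real_of_int n)\<^sup>2))) ?A \<le> sqrt 5"
        unfolding L2_set_def by (intro real_sqrt_le_mono) (simp add: add_nonneg_nonneg)
    qed auto
    finally show ?thesis .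
  qed
  have "cmod (app f x0) \<le> sqrt 5 * sob_norm 1 (app f) + e" if e: "e > 0" for e
  proof -
    obtain N where N: "cmod (a (- int N - 1)) < e / 2" "cmod (a (int N)) < e / 2"
      using a_small[of "e / 2"] e by auto
    have "app f x0 = (\<Sum>n\<in>{- int N..int N}. T n) - a (- int N - 1) + a (int N)"
      by (simp add: sum_eq)
    also have "cmod \<dots> \<le> cmod (\<Sum>n\<in>{- int N..int N}. T n)
        + cmod (a (- int N - 1)) + cmod (a (int N))"
      by (intro order_trans[OF norm_triangle_ineq] add_right_mono norm_triangle_ineq4)
    also have "cmod (\<Sum>n\<in>{- int N..int N}. T n)
        \<le> sqrt 5 * sob_norm 1 (app f)"
      by (rule order_trans[OF sum_norm_le partial[of N]]) (simp add: T_def norm_mult)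
    finally show ?thesis using N by simp
  qed
  then show "cmod (app f x0) \<le> sqrt 5 * sob_norm 1 (app f)" by (rule field_le_epsilon)
qed

lemma sob_norm_mono:
  assumes u: "u \<in> sobolev m" and k: "k \<le> m"
  shows "u \<in> sobolev k" "sob_norm k u \<le> sob_norm m u"
proof -
  have le: "wcoeff k u n \<le> wcoeff m u n" for n
    unfolding wcoeff_def using k by (intro mult_right_mono real_sqrt_le_mono power_increasing) auto
  have "L2_set (wcoeff k u) F \<le> sob_norm m u" if "finite F" for F
    by (rule order_trans[OF L2_set_mono L2_set_wcoeff_le[OF u that]]) (use le in \<open>auto simp: wcoeff_def\<close>)
  note s = sob_norm_leI[OF this]
  show "sob_norm k u \<le> sob_norm m u" by (rule s)
  show "u \<in> sobolev k" using u s(1) by (simp add: sobolev_iff)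
qed

definition l2_norm :: "smooth \<Rightarrow> real" where
  "l2_norm f = sqrt (LINT x|torus. (cmod (app f x))\<^sup>2)"

lemma integrable_sq: "integrable torus (\<lambda>x. (cmod (app f x))\<^sup>2)"
  using sq_int_smooth by (simp add: sq_int_def)

lemma LINT_sq_nonneg [simp]: "0 \<le> (LINT x|torus. (cmod (u x))\<^sup>2)"
  by (simp add: integral_nonneg_AE)

lemma l2_norm_sq: "(l2_norm f)\<^sup>2 = (LINT x|torus. (cmod (app f x))\<^sup>2)"
  by (simp add: l2_norm_def)

lemma l2_norm_nonneg [simp]: "0 \<le> l2_norm f"
  by (simp add: l2_norm_def)

lemma l2_norm_le_sup: "l2_norm f \<le> sup_norm f"
proof -
  have "(LINT x|torus. (cmod (app f x))\<^sup>2) \<le> (LINT x|torus. (sup_norm f)\<^sup>2)"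
    by (intro integral_mono integrable_sq power_mono cmod_le_sup_norm) auto
  also have "\<dots> = (sup_norm f)\<^sup>2" using measure_torus by (simp add: space_torus)
  finally show ?thesis unfolding l2_norm_def by (intro real_le_lsqrt) auto
qed

text \<open>The nontrivial half of Parseval's identity: the error in Bessel's identity tends to 0, as it is dominated by
  the supremum norm of the truncation error.\<close>

lemma l2_norm_le_sob_norm: "l2_norm f \<le> sob_norm 0 (app f)"
proof -
  have "(l2_norm f)\<^sup>2 \<le> (sob_norm 0 (app f))\<^sup>2 + e" if e: "e > 0" for e
  proof -
    obtain N where N: "sob_norm 1 (app (trunc N (app f)) - app f) < sqrt (e / 5)"
      using sob_norm_trunc_diff[OF smooth_in_sobolev, of "sqrt (e / 5)" 1 f] e by auto
    let ?d = "trunc N (app f) - f"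
    have "l2_norm ?d \<le> sqrt 5 * sob_norm 1 (app ?d)"
      using l2_norm_le_sup sup_norm_le_sob_norm by (rule order_trans)
    also have "\<dots> \<le> sqrt 5 * sqrt (e / 5)"
      using N by (intro mult_left_mono) (auto simp: app_minus')
    also have "\<dots> = sqrt e" by (simp add: real_sqrt_divide)
    finally have "(l2_norm ?d)\<^sup>2 \<le> (sqrt e)\<^sup>2" by (intro power_mono) auto
    then have d: "(LINT x|torus. (cmod (app f x - app (trunc N (app f)) x))\<^sup>2) \<le> e"
      using e by (simp add: l2_norm_sq norm_minus_commute)
    have "(\<Sum>n\<in>{- int N..int N}. (cmod (fourier (app f) n))\<^sup>2) \<le> (sob_norm 0 (app f))\<^sup>2"
      using sum_sob_term_le[OF smooth_in_sobolev, of "{- int N..int N}" 0 f] by (simp add: sob_term_def)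
    with d show ?thesis
      unfolding l2_norm_sq bessel_identity[OF sq_int_smooth, of f N] by simp
  qed
  then have "(l2_norm f)\<^sup>2 \<le> (sob_norm 0 (app f))\<^sup>2" by (rule field_le_epsilon)
  then show ?thesis by (rule power2_le_imp_le) simp
qed

lemma sob_norm_0_le_sup: "sob_norm 0 (app f) \<le> sup_norm f"
proof (rule order_trans[OF _ l2_norm_le_sup])
  show "sob_norm 0 (app f) \<le> l2_norm f"
  proof (rule sob_norm_leI)
    fix F :: "int set" assume "finite F"
    then have "(\<Sum>n\<in>F. (cmod (fourier (app f) n))\<^sup>2) \<le> (LINT x|torus. (cmod (app f x))\<^sup>2)"
      by (intro bessel sq_int_smooth)
    then show "L2_set (wcoeff 0 (app f)) F \<le> l2_norm f"
      by (simp add: L2_set_def wcoeff_def l2_norm_def)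
  qed
qed

text \<open>The Cauchy--Schwarz inequality, from \<open>2 x y \<le> t x^2 + y^2 / t\<close> with \<open>t\<close> close to the quotient of the two norms;
  adding \<open>e\<close> to both norms keeps \<open>t\<close> well-defined and positive.\<close>

lemma cmod_torus_int_mult_le: "cmod (torus_int (f * g)) \<le> sob_norm 0 (app f) * sob_norm 0 (app g)"
proof -
  have "cmod (torus_int (f * g)) \<le> l2_norm f * l2_norm g + e * (l2_norm f + l2_norm g)" if e: "e > 0" for e
  proof -
    define a b where "a = l2_norm f" and "b = l2_norm g"
    have ab: "a \<ge> 0" "b \<ge> 0" by (auto simp: a_def b_def)
    define t where "t = (b + e) / (a + e)"
    have t: "t > 0" using ab e by (simp add: t_def add_nonneg_pos)
    have "cmod (torus_int (f * g)) \<le> (LINT x|torus. cmod (app f x * app g x))"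
      using integral_norm_bound[of torus "app (f * g)"] by (simp add: torus_int_def)
    also have "\<dots> \<le> (LINT x|torus. (t * (cmod (app f x))\<^sup>2 + (cmod (app g x))\<^sup>2 / t) / 2)"
    proof (rule integral_mono)
      show "integrable torus (\<lambda>x. cmod (app f x * app g x))"
        by (intro torus_integrable_continuous continuous_intros)
      show "integrable torus (\<lambda>x. (t * (cmod (app f x))\<^sup>2 + (cmod (app g x))\<^sup>2 / t) / 2)"
        by (intro torus_integrable_continuous continuous_intros) (use t in auto)
      fix x
      have "0 \<le> (t * cmod (app f x) - cmod (app g x))\<^sup>2 / t" using t by simp
      also have "\<dots> = t * (cmod (app f x))\<^sup>2 + (cmod (app g x))\<^sup>2 / t - 2 * cmod (app f x * app g x)"
        using t by (simp add: power2_eq_square norm_mult field_simps)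
      finally show "cmod (app f x * app g x) \<le> (t * (cmod (app f x))\<^sup>2 + (cmod (app g x))\<^sup>2 / t) / 2" by simp
    qed
    also have "\<dots> = (t * a\<^sup>2 + b\<^sup>2 / t) / 2"
      by (simp add: integrable_sq a_def b_def l2_norm_sq)
    also have "\<dots> \<le> ((b + e) * a + b * (a + e)) / 2"
    proof -
      have "t * a\<^sup>2 = (b + e) * a * (a / (a + e))" by (simp add: t_def power2_eq_square)
      also have "\<dots> \<le> (b + e) * a * 1" using ab e by (intro mult_left_mono) auto
      finally have 1: "t * a\<^sup>2 \<le> (b + e) * a" by simp
      have "b\<^sup>2 / t = b * (a + e) * (b / (b + e))" by (simp add: t_def power2_eq_square)
      also have "\<dots> \<le> b * (a + e) * 1" using ab e by (intro mult_left_mono) auto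
      finally have 2: "b\<^sup>2 / t \<le> b * (a + e)" by simp
      show ?thesis by (intro divide_right_mono add_mono 1 2) auto
    qed
    also have "\<dots> \<le> a * b + e * (a + b)" using ab e by (simp add: algebra_simps)
    finally show ?thesis by (simp add: a_def b_def)
  qed
  note A = this
  have "cmod (torus_int (f * g)) \<le> l2_norm f * l2_norm g + e" if e: "e > 0" for e
  proof -
    have p: "l2_norm f + l2_norm g + 1 > 0" by (simp add: add_nonneg_pos)
    have "cmod (torus_int (f * g)) \<le> l2_norm f * l2_norm g + e / (l2_norm f + l2_norm g + 1) * (l2_norm f + l2_norm g)"
      using A[of "e / (l2_norm f + l2_norm g + 1)"] e p by simp
    also have "e / (l2_norm f + l2_norm g + 1) * (l2_norm f + l2_norm g) \<le> e"
      using e p by (simp add: field_simps)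
    finally show ?thesis by simp
  qed
  then have "cmod (torus_int (f * g)) \<le> l2_norm f * l2_norm g" by (rule field_le_epsilon)
  also have "\<dots> \<le> sob_norm 0 (app f) * sob_norm 0 (app g)"
    by (intro mult_mono l2_norm_le_sob_norm) auto
  finally show ?thesis .
qed

lemma sob_norm_D: "sob_norm k (app (ddx f)) \<le> 2 * pi * sob_norm (Suc k) (app f)"
proof (rule sob_norm_leI)
  fix F :: "int set" assume F: "finite F"
  have "wcoeff k (app (ddx f)) n \<le> 2 * pi * wcoeff (Suc k) (app f) n" for n
  proof -
    have "\<bar>real_of_int n\<bar> \<le> sqrt (1 + (of_int n)\<^sup>2)" by (simp add: real_le_rsqrt)
    then have "sqrt ((1 + (of_int n)\<^sup>2) ^ k) * \<bar>real_of_int n\<bar> \<le> sqrt ((1 + (of_int n)\<^sup>2) ^ k) * sqrt (1 + (of_int n)\<^sup>2)"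
      by (intro mult_left_mono) auto
    also have "\<dots> = sqrt ((1 + (of_int n)\<^sup>2) ^ Suc k)" by (simp add: real_sqrt_mult)
    finally have "2 * pi * cmod (fourier (app f) n) * (sqrt ((1 + (of_int n)\<^sup>2) ^ k) * \<bar>real_of_int n\<bar>)
       \<le> 2 * pi * cmod (fourier (app f) n) * sqrt ((1 + (of_int n)\<^sup>2) ^ Suc k)"
      by (intro mult_left_mono) auto
    then show ?thesis by (simp add: wcoeff_def fourier_D norm_mult mult_ac)
  qed
  then have "L2_set (wcoeff k (app (ddx f))) F \<le> L2_set (\<lambda>n. 2 * pi * wcoeff (Suc k) (app f) n) F"
    by (intro L2_set_mono) (auto simp: wcoeff_def)
  also have "\<dots> = 2 * pi * L2_set (wcoeff (Suc k) (app f)) F"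
    by (simp add: L2_set_right_distrib)
  also have "\<dots> \<le> 2 * pi * sob_norm (Suc k) (app f)"
    by (intro mult_left_mono L2_set_wcoeff_le smooth_in_sobolev F) auto
  finally show "L2_set (wcoeff k (app (ddx f))) F \<le> 2 * pi * sob_norm (Suc k) (app f)" .
qed

lemma sob_norm_Dpow: "sob_norm k (app ((ddx ^^ a) f)) \<le> (2 * pi) ^ a * sob_norm (k + a) (app f)"
proof (induction a arbitrary: k)
  case (Suc a)
  have "sob_norm k (app ((ddx ^^ Suc a) f)) \<le> 2 * pi * sob_norm (Suc k) (app ((ddx ^^ a) f))"
    using sob_norm_D by simp
  also have "\<dots> \<le> 2 * pi * ((2 * pi) ^ a * sob_norm (Suc k + a) (app f))"
    by (intro mult_left_mono Suc) auto
  finally show ?case by (simp add: mult_ac)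
qed simp

section \<open>Calculus of locally Lipschitz differentiable maps\<close>

definition is_seminorm :: "('a::ab_group_add \<Rightarrow> real) \<Rightarrow> bool" where
  "is_seminorm p \<longleftrightarrow> p 0 = 0 \<and> (\<forall>x. 0 \<le> p x) \<and> (\<forall>x y. p (x + y) \<le> p x + p y) \<and> (\<forall>x. p (- x) = p x)"

lemma is_seminormD:
  assumes "is_seminorm p"
  shows "p 0 = 0" "0 \<le> p x" "p (x + y) \<le> p x + p y" "p (- x) = p x"
  using assms by (auto simp: is_seminorm_def)

lemma C11_I:
  assumes "\<And>R. \<exists>C\<ge>0. \<forall>v w h. M v \<le> R \<longrightarrow> M w \<le> R \<longrightarrow>
     p (G v) \<le> C \<and> p (G' v h) \<le> C * M h \<and> p (G' v h - G' w h) \<le> C * M (v - w) * M h \<and>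
     p (G w - G v - G' v (w - v)) \<le> C * (M (w - v))\<^sup>2"
  shows "C11 M p G G'"
  unfolding C11_def using assms by blast

lemma C11_linear:
  assumes p: "is_seminorm p" and M: "is_seminorm M" and K: "\<And>h. p (L h) \<le> K * M h" "K \<ge> 0"
    and L: "\<And>v w. L (v - w) = L v - L w"
  shows "C11 M p L (\<lambda>v. L)"
proof (rule C11_I)
  fix R
  have "p (L v) \<le> K * (1 + \<bar>R\<bar>) \<and> p (L h) \<le> K * (1 + \<bar>R\<bar>) * M h \<and>
      p (L h - L h) \<le> K * (1 + \<bar>R\<bar>) * M (v - w) * M h \<and>
     p (L w - L v - L (w - v)) \<le> K * (1 + \<bar>R\<bar>) * (M (w - v))\<^sup>2" if "M v \<le> R" for v w h
  proof (intro conjI)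
    have "K * M v \<le> K * (1 + \<bar>R\<bar>)" using that K by (intro mult_left_mono) auto
    then show "p (L v) \<le> K * (1 + \<bar>R\<bar>)" using K(1)[of v] by linarith
    have "K * M h * 1 \<le> K * M h * (1 + \<bar>R\<bar>)"
      using is_seminormD(2)[OF M] K by (intro mult_left_mono mult_nonneg_nonneg) auto
    then show "p (L h) \<le> K * (1 + \<bar>R\<bar>) * M h" using K(1)[of h] by (simp add: mult_ac)
  qed (use is_seminormD[OF M] K in \<open>auto simp: is_seminormD(1)[OF p] L\<close>)
  then show "\<exists>C\<ge>0. \<forall>v w h. M v \<le> R \<longrightarrow> M w \<le> R \<longrightarrow>
     p (L v) \<le> C \<and> p (L h) \<le> C * M h \<and> p (L h - L h) \<le> C * M (v - w) * M h \<and>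
     p (L w - L v - L (w - v)) \<le> C * (M (w - v))\<^sup>2"
    using K(2) by (intro exI[of _ "K * (1 + \<bar>R\<bar>)"]) auto
qed

lemma C11_const:
  assumes p: "is_seminorm p" and M: "is_seminorm M"
  shows "C11 M p (\<lambda>v. c) (\<lambda>v h. 0)"
  by (rule C11_I, rule exI[of _ "p c"]) (use is_seminormD[OF M] is_seminormD[OF p] in auto)

lemma C11_add:
  assumes p: "is_seminorm p" and M: "is_seminorm M" and G: "C11 M p G G'" and H: "C11 M p H H'"
  shows "C11 M p (\<lambda>v. G v + H v) (\<lambda>v h. G' v h + H' v h)"
proof (rule C11_I)
  fix R
  obtain A where A: "A \<ge> 0" "\<And>v w h. M v \<le> R \<Longrightarrow> M w \<le> R \<Longrightarrow>
     p (G v) \<le> A \<and> p (G' v h) \<le> A * M h \<and> p (G' v h - G' w h) \<le> A * M (v - w) * M h \<and>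
     p (G w - G v - G' v (w - v)) \<le> A * (M (w - v))\<^sup>2"
    using G unfolding C11_def by meson
  obtain B where B: "B \<ge> 0" "\<And>v w h. M v \<le> R \<Longrightarrow> M w \<le> R \<Longrightarrow>
     p (H v) \<le> B \<and> p (H' v h) \<le> B * M h \<and> p (H' v h - H' w h) \<le> B * M (v - w) * M h \<and>
     p (H w - H v - H' v (w - v)) \<le> B * (M (w - v))\<^sup>2"
    using H unfolding C11_def by meson
  have tri: "p z \<le> a + b" if "z = x + y" "p x \<le> a" "p y \<le> b" for x y z a b
    using is_seminormD(3)[OF p, of x y] that by simp
  show "\<exists>C\<ge>0. \<forall>v w h. M v \<le> R \<longrightarrow> M w \<le> R \<longrightarrow>
     p (G v + H v) \<le> C \<and> p (G' v h + H' v h) \<le> C * M h \<and>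
     p (G' v h + H' v h - (G' w h + H' w h)) \<le> C * M (v - w) * M h \<and>
     p (G w + H w - (G v + H v) - (G' v (w - v) + H' v (w - v))) \<le> C * (M (w - v))\<^sup>2"
  proof (intro exI[of _ "A + B"] conjI allI impI)
    fix v w h assume v: "M v \<le> R" and w: "M w \<le> R"
    show "p (G v + H v) \<le> A + B"
      by (rule tri[OF refl]) (use A(2)[OF v w] B(2)[OF v w] in auto)
    show "p (G' v h + H' v h) \<le> (A + B) * M h"
      unfolding ring_distribs by (rule tri[OF refl]) (use A(2)[OF v w] B(2)[OF v w] in auto)
    show "p (G' v h + H' v h - (G' w h + H' w h)) \<le> (A + B) * M (v - w) * M h"
      unfolding ring_distribs
      by (rule tri[of _ "G' v h - G' w h" "H' v h - H' w h"]) (use A(2)[OF v w] B(2)[OF v w] in auto)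
    show "p (G w + H w - (G v + H v) - (G' v (w - v) + H' v (w - v))) \<le> (A + B) * (M (w - v))\<^sup>2"
      unfolding ring_distribs
      by (rule tri[of _ "G w - G v - G' v (w - v)" "H w - H v - H' v (w - v)"])
         (use A(2)[OF v w] B(2)[OF v w] in auto)
  qed (use A B in auto)
qed

text \<open>The product rule. The remainder is
  \<open>B (G w - G v - G' v k) (H w) + B (G' v k) (H w - H v) + B (G v) (H w - H v - H' v k)\<close> with \<open>k = w - v\<close>.\<close>

lemma C11_bilinear:
  assumes M: "is_seminorm M" and p1: "is_seminorm p1" and p2: "is_seminorm p2" and p3: "is_seminorm p3"
    and B: "\<And>x y. p3 (B x y) \<le> p1 x * p2 y"
    and Bl: "\<And>x x' y. B (x + x') y = B x y + B x' y"
    and Br: "\<And>x y y'. B x (y + y') = B x y + B x y'"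
    and G: "C11 M p1 G G'" and H: "C11 M p2 H H'"
  shows "C11 M p3 (\<lambda>v. B (G v) (H v)) (\<lambda>v h. B (G' v h) (H v) + B (G v) (H' v h))"
proof (rule C11_I)
  fix R
  obtain A1 where A1: "A1 \<ge> 0" "\<And>v w h. M v \<le> R \<Longrightarrow> M w \<le> R \<Longrightarrow>
     p1 (G v) \<le> A1 \<and> p1 (G' v h) \<le> A1 * M h \<and> p1 (G' v h - G' w h) \<le> A1 * M (v - w) * M h \<and>
     p1 (G w - G v - G' v (w - v)) \<le> A1 * (M (w - v))\<^sup>2"
    using G unfolding C11_def by meson
  obtain A2 where A2: "A2 \<ge> 0" "\<And>v w h. M v \<le> R \<Longrightarrow> M w \<le> R \<Longrightarrow>
     p2 (H v) \<le> A2 \<and> p2 (H' v h) \<le> A2 * M h \<and> p2 (H' v h - H' w h) \<le> A2 * M (v - w) * M h \<and>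
     p2 (H w - H v - H' v (w - v)) \<le> A2 * (M (w - v))\<^sup>2"
    using H unfolding C11_def by meson
  define A where "A = max A1 A2"
  define L where "L = A * (1 + 2 * \<bar>R\<bar>)"
  have A: "A \<ge> 0" and L: "L \<ge> 0" using A1(1) by (auto simp: A_def L_def)
  have M0: "M x \<ge> 0" for x by (rule is_seminormD(2)[OF M])
  have Bl': "B (x - x') y = B x y - B x' y" for x x' y
    using Bl[of "x - x'" x' y] by simp
  have Br': "B x (y - y') = B x y - B x y'" for x y y'
    using Br[of x "y - y'" y'] by simp
  have Msym: "M (x - y) = M (y - x)" for x y
    using is_seminormD(4)[OF M, of "x - y"] by simp
  have le: "a1 * z \<le> A * z" "a2 * z \<le> A * z" if "a1 = A1" "a2 = A2" "z \<ge> 0" for z a1 a2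
    using that by (auto simp: A_def intro!: mult_right_mono)
  have g: "p1 (G v) \<le> A" "p1 (G' v h) \<le> A * M h" "p1 (G' v h - G' w h) \<le> A * (M (v - w) * M h)"
      "p1 (G w - G v - G' v (w - v)) \<le> A * (M (w - v))\<^sup>2" if "M v \<le> R" "M w \<le> R" for v w h
    using A1(2)[OF that, of h] le(1)[OF refl refl, of "M h"] le(1)[OF refl refl, of "M (v - w) * M h"] M0
      le(1)[OF refl refl, of "(M (w - v))\<^sup>2"] by (auto simp: A_def mult.assoc)
  have h: "p2 (H v) \<le> A" "p2 (H' v h) \<le> A * M h" "p2 (H' v h - H' w h) \<le> A * (M (v - w) * M h)"
      "p2 (H w - H v - H' v (w - v)) \<le> A * (M (w - v))\<^sup>2" if "M v \<le> R" "M w \<le> R" for v w h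
    using A2(2)[OF that, of h] le(2)[OF refl refl, of "M h"] le(2)[OF refl refl, of "M (v - w) * M h"] M0
      le(2)[OF refl refl, of "(M (w - v))\<^sup>2"] by (auto simp: A_def mult.assoc)
  have sq: "A * (M (w - v))\<^sup>2 + A * M (w - v) \<le> L * M (w - v)" if "M v \<le> R" "M w \<le> R" for v w
  proof -
    have "M (w - v) \<le> M w + M v" using is_seminormD(3)[OF M, of w "- v"] is_seminormD(4)[OF M, of v] by simp
    then have "M (w - v) \<le> 2 * \<bar>R\<bar>" using that by linarith
    then have "A * (M (w - v) * M (w - v)) \<le> A * (2 * \<bar>R\<bar> * M (w - v))"
      using A M0 by (intro mult_left_mono mult_right_mono) auto
    then show ?thesis by (simp add: L_def power2_eq_square algebra_simps)
  qed
  have lipG: "p1 (G w - G v) \<le> L * M (w - v)" if "M v \<le> R" "M w \<le> R" for v w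
    using is_seminormD(3)[OF p1, of "G w - G v - G' v (w - v)" "G' v (w - v)"] g(2)[OF that, of "w - v"] g(4)[OF that]
      sq[OF that] by simp
  have lipH: "p2 (H w - H v) \<le> L * M (w - v)" if "M v \<le> R" "M w \<le> R" for v w
    using is_seminormD(3)[OF p2, of "H w - H v - H' v (w - v)" "H' v (w - v)"] h(2)[OF that, of "w - v"] h(4)[OF that]
      sq[OF that] by simp
  have Bb: "p3 (B x y) \<le> a * b" if "p1 x \<le> a" "p2 y \<le> b" for x y a b
    using that is_seminormD(2)[OF p1, of x] is_seminormD(2)[OF p2, of y]
    by (intro order_trans[OF B] mult_mono) auto
  have tri: "p3 (x + y) \<le> a + b" if "p3 x \<le> a" "p3 y \<le> b" for x y a b
    using is_seminormD(3)[OF p3, of x y] that by simp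
  define C where "C = 2 * A * A + 2 * A * L"
  have C: "C \<ge> 0" "A * A \<le> C" "2 * A * A \<le> C" using A L by (auto simp: C_def)
  show "\<exists>C\<ge>0. \<forall>v w h. M v \<le> R \<longrightarrow> M w \<le> R \<longrightarrow>
     p3 (B (G v) (H v)) \<le> C \<and> p3 (B (G' v h) (H v) + B (G v) (H' v h)) \<le> C * M h \<and>
     p3 (B (G' v h) (H v) + B (G v) (H' v h) - (B (G' w h) (H w) + B (G w) (H' w h))) \<le> C * M (v - w) * M h \<and>
     p3 (B (G w) (H w) - B (G v) (H v) - (B (G' v (w - v)) (H v) + B (G v) (H' v (w - v)))) \<le> C * (M (w - v))\<^sup>2"
  proof (intro exI[of _ C] conjI allI impI)
    fix v w h' assume v: "M v \<le> R" and w: "M w \<le> R"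
    show "p3 (B (G v) (H v)) \<le> C"
      using Bb[OF g(1)[OF v w] h(1)[OF v w]] C(2) by linarith
    have "p3 (B (G' v h') (H v) + B (G v) (H' v h')) \<le> A * M h' * A + A * (A * M h')"
      by (intro tri Bb g[OF v w] h[OF v w])
    also have "\<dots> = 2 * A * A * M h'" by simp
    also have "\<dots> \<le> C * M h'" using C M0 by (intro mult_right_mono) auto
    finally show "p3 (B (G' v h') (H v) + B (G v) (H' v h')) \<le> C * M h'" .
    have "p3 (B (G' v h' - G' w h') (H v) + B (G' w h') (H v - H w)
         + (B (G v - G w) (H' v h') + B (G w) (H' v h' - H' w h')))
       \<le> (A * (M (v - w) * M h') * A + (A * M h') * (L * M (v - w)))
         + ((L * M (v - w)) * (A * M h') + A * (A * (M (v - w) * M h')))"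
      by (intro tri Bb g[OF v w] h[OF v w] g[OF w v] h[OF w v] lipG[OF w v] lipH[OF w v])
    also have "\<dots> = C * M (v - w) * M h'" by (simp add: C_def algebra_simps)
    finally show "p3 (B (G' v h') (H v) + B (G v) (H' v h') - (B (G' w h') (H w) + B (G w) (H' w h')))
        \<le> C * M (v - w) * M h'"
      by (simp add: Bl Br Bl' Br' algebra_simps)
    let ?k = "w - v"
    have "p3 (B (G w - G v - G' v ?k) (H w) + (B (G' v ?k) (H w - H v) + B (G v) (H w - H v - H' v ?k)))
      \<le> A * (M ?k)\<^sup>2 * A + (A * M ?k * (L * M ?k) + A * (A * (M ?k)\<^sup>2))"
      by (intro tri Bb g[OF v w] h[OF v w] g[OF w v] h[OF w v] lipH[OF v w])
    also have "\<dots> \<le> C * (M ?k)\<^sup>2"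
      using A L by (simp add: C_def power2_eq_square algebra_simps)
    finally show "p3 (B (G w) (H w) - B (G v) (H v) - (B (G' v ?k) (H v) + B (G v) (H' v ?k))) \<le> C * (M ?k)\<^sup>2"
      by (simp add: Bl Br Bl' Br' algebra_simps)
  qed (use C in auto)
qed

lemma C11_compose_linear:
  assumes G: "C11 M p G G'" and L: "\<And>v w. L (v - w) = L v - L w" and K: "\<And>v. M (L v) \<le> K * M' v" "K \<ge> 0"
    and M: "is_seminorm M" and M': "is_seminorm M'"
  shows "C11 M' p (\<lambda>u. G (L u)) (\<lambda>u h. G' (L u) (L h))"
proof (rule C11_I)
  fix R
  obtain C where C: "C \<ge> 0" "\<And>v w h. M v \<le> K * \<bar>R\<bar> \<Longrightarrow> M w \<le> K * \<bar>R\<bar> \<Longrightarrow>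
     p (G v) \<le> C \<and> p (G' v h) \<le> C * M h \<and> p (G' v h - G' w h) \<le> C * M (v - w) * M h \<and>
     p (G w - G v - G' v (w - v)) \<le> C * (M (w - v))\<^sup>2"
    using G unfolding C11_def by meson
  have bd: "M (L v) \<le> K * \<bar>R\<bar>" if "M' v \<le> R" for v
    using K(1)[of v] mult_left_mono[of "M' v" "\<bar>R\<bar>" K] that K(2) by linarith
  have M0: "M x \<ge> 0" "M' y \<ge> 0" for x y by (auto intro: is_seminormD M M')
  let ?C = "C * (1 + K)\<^sup>2"
  have K1: "K \<le> (1 + K)\<^sup>2" "K\<^sup>2 \<le> (1 + K)\<^sup>2" "1 \<le> (1 + K)\<^sup>2" using K(2) by (auto simp: power2_eq_square algebra_simps)
  show "\<exists>C\<ge>0. \<forall>v w h. M' v \<le> R \<longrightarrow> M' w \<le> R \<longrightarrow>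
     p (G (L v)) \<le> C \<and> p (G' (L v) (L h)) \<le> C * M' h \<and> p (G' (L v) (L h) - G' (L w) (L h)) \<le> C * M' (v - w) * M' h \<and>
     p (G (L w) - G (L v) - G' (L v) (L (w - v))) \<le> C * (M' (w - v))\<^sup>2"
  proof (intro exI[of _ ?C] conjI allI impI)
    fix v w h assume v: "M' v \<le> R" and w: "M' w \<le> R"
    note c = C(2)[OF bd[OF v] bd[OF w]]
    have "p (G (L v)) \<le> C * 1" using c by simp
    also have "\<dots> \<le> ?C" using C K1 by (intro mult_left_mono) auto
    finally show "p (G (L v)) \<le> ?C" .
    have "p (G' (L v) (L h)) \<le> C * M (L h)" using c by simp
    also have "\<dots> \<le> C * (K * M' h)" using C K by (intro mult_left_mono) auto
    also have "\<dots> \<le> C * ((1 + K)\<^sup>2 * M' h)" using C K1 M0 by (intro mult_left_mono mult_right_mono) auto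
    finally show "p (G' (L v) (L h)) \<le> ?C * M' h" by (simp add: mult.assoc)
    have "p (G' (L v) (L h) - G' (L w) (L h)) \<le> C * (M (L v - L w) * M (L h))"
      using c by (simp add: mult.assoc)
    also have "\<dots> \<le> C * ((K * M' (v - w)) * (K * M' h))"
      using C K K(1)[of "v - w"] M0 by (intro mult_left_mono mult_mono mult_nonneg_nonneg) (auto simp: L)
    also have "\<dots> = C * (K\<^sup>2 * (M' (v - w) * M' h))" by (simp add: power2_eq_square)
    also have "\<dots> \<le> C * ((1 + K)\<^sup>2 * (M' (v - w) * M' h))"
      using C K1 M0 by (intro mult_left_mono mult_right_mono) auto
    finally show "p (G' (L v) (L h) - G' (L w) (L h)) \<le> ?C * M' (v - w) * M' h" by (simp add: mult.assoc)
    have "p (G (L w) - G (L v) - G' (L v) (L (w - v))) \<le> C * (M (L w - L v))\<^sup>2"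
      using c by (simp add: L)
    also have "\<dots> \<le> C * (K * M' (w - v))\<^sup>2"
      using C K K(1)[of "w - v"] M0 by (intro mult_left_mono power_mono) (auto simp: L)
    also have "\<dots> \<le> C * ((1 + K)\<^sup>2 * (M' (w - v))\<^sup>2)"
      unfolding power_mult_distrib using C K1 by (intro mult_left_mono mult_right_mono) auto
    finally show "p (G (L w) - G (L v) - G' (L v) (L (w - v))) \<le> ?C * (M' (w - v))\<^sup>2" by (simp add: mult.assoc)
  qed (use C in auto)
qed

lemma is_seminorm_cmod: "is_seminorm cmod"
  by (auto simp: is_seminorm_def norm_triangle_ineq)

lemma is_seminorm_sup: "is_seminorm sup_norm"
  unfolding is_seminorm_def
proof (intro conjI allI)
  show "sup_norm 0 = 0" using sup_norm_leI[of 0 0] sup_norm_nonneg[of 0] by simp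
  show "sup_norm (- f) = sup_norm f" for f by (simp add: sup_norm_def)
qed (auto simp: sup_norm_add)

lemma is_seminorm_sob: "is_seminorm (\<lambda>f. sob_norm m (app f))"
  unfolding is_seminorm_def
proof (intro conjI allI)
  show "sob_norm m (app 0) = 0" using sob.N_0[of m] by (simp add: zero_smooth.rep_eq)
  show "sob_norm m (app (f + g)) \<le> sob_norm m (app f) + sob_norm m (app g)" for f g
    unfolding app_plus by (intro sob.N_triangle smooth_in_sobolev)
  show "sob_norm m (app (- f)) = sob_norm m (app f)" for f
    using sob.N_minus[OF smooth_in_sobolev, of m f] by (simp add: uminus_smooth.rep_eq)
qed simp

lemma seminormed_sobolev2: "seminormed_space cscale2 (sobolev m \<times> sobolev m) (sob_norm2 m)"
proof
  fix v w assume v: "v \<in> sobolev m \<times> sobolev m" and w: "w \<in> sobolev m \<times> sobolev m"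
  have "sob_norm2 m (v + w) \<le> norm (sob_norm m (fst v) + sob_norm m (fst w), sob_norm m (snd v) + sob_norm m (snd w))"
    unfolding sob_norm2_def norm_Pair real_norm_def power2_abs
    using v w by (intro real_sqrt_le_mono add_mono power_mono) (auto intro: sob.N_triangle)
  also have "\<dots> \<le> norm (sob_norm m (fst v), sob_norm m (snd v)) + norm (sob_norm m (fst w), sob_norm m (snd w))"
    using norm_triangle_ineq[of "(sob_norm m (fst v), sob_norm m (snd v))" "(sob_norm m (fst w), sob_norm m (snd w))"] by simp
  finally show "sob_norm2 m (v + w) \<le> sob_norm2 m v + sob_norm2 m w"
    by (simp add: sob_norm2_def norm_Pair)
next
  fix v c assume v: "v \<in> sobolev m \<times> sobolev m"
  have "(cmod c * a)\<^sup>2 + (cmod c * b)\<^sup>2 = (cmod c)\<^sup>2 * (a\<^sup>2 + b\<^sup>2)" for a b :: real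
    by (simp add: power_mult_distrib algebra_simps)
  then show "sob_norm2 m (cscale2 c v) = cmod c * sob_norm2 m v"
    using v by (auto simp: sob_norm2_def cscale2_def sob.N_sc real_sqrt_mult)
qed (auto simp: sob_norm2_def cscale2_def sob.V_0 sob.V_add sob.V_sc sob.sc_0 sob.sc_minus1 sob.sc_add zero_prod_def)

definition sc2 :: "complex \<Rightarrow> smooth \<times> smooth \<Rightarrow> smooth \<times> smooth" where
  "sc2 c v = (cst c * fst v, cst c * snd v)"

definition app2 :: "smooth \<times> smooth \<Rightarrow> tfun \<times> tfun" where
  "app2 v = (app (fst v), app (snd v))"

lemma range_app: "range app = smooth_per"
  by (rule type_definition.Rep_range[OF type_definition_smooth])

lemma range_app2: "range app2 = smooth_per \<times> smooth_per"
proof (intro equalityI subsetI)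
  fix w assume "w \<in> smooth_per \<times> smooth_per"
  then obtain a b where "w = (app a, app b)" by (auto simp: range_app[symmetric])
  then show "w \<in> range app2" by (intro image_eqI[of _ _ "(a, b)"]) (auto simp: app2_def)
qed (auto simp: app2_def)

interpretation sobd2: dense_embedding cscale2 "sobolev m \<times> sobolev m" "sob_norm2 m" sc2 app2 for m
proof -
  interpret seminormed_space cscale2 "sobolev m \<times> sobolev m" "sob_norm2 m" by (rule seminormed_sobolev2)
  show "dense_embedding cscale2 (sobolev m \<times> sobolev m) (sob_norm2 m) sc2 app2"
  proof
    fix v and e :: real assume v: "v \<in> sobolev m \<times> sobolev m" and e: "e > 0"
    obtain a where a: "sob_norm m (app a - fst v) < e / 2"
      using sobd.dense[of "fst v" m "e / 2"] v e by auto
    obtain b where b: "sob_norm m (app b - snd v) < e / 2"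
      using sobd.dense[of "snd v" m "e / 2"] v e by auto
    have "sob_norm2 m (app2 (a, b) - v) \<le> sob_norm m (app a - fst v) + sob_norm m (app b - snd v)"
      unfolding sob_norm2_def app2_def fst_diff snd_diff fst_conv snd_conv by (rule sqrt_sum_squares_le_sum) auto
    with a b show "\<exists>b. sob_norm2 m (app2 b - v) < e" by (intro exI[of _ "(a, b)"]) linarith
  qed (auto simp: app2_def sc2_def cscale2_def smooth_in_sobolev app_cst_mult app_plus)
qed

definition pair_norm :: "nat \<Rightarrow> smooth \<times> smooth \<Rightarrow> real" where
  "pair_norm m v = sob_norm2 m (app2 v)"

lemma sobd2_M: "sobd2.M m = pair_norm m"
  by (simp add: fun_eq_iff sobd2.M_def pair_norm_def)

lemma sobd_M: "sobd.M m = (\<lambda>f. sob_norm m (app f))"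
  by (simp add: fun_eq_iff sobd.M_def)

lemma app2_minus: "app2 (- v) = - app2 v"
  by (simp add: app2_def uminus_smooth.rep_eq uminus_prod_def)

lemma is_seminorm_pair_norm: "is_seminorm (pair_norm m)"
  unfolding is_seminorm_def pair_norm_def
proof (intro conjI allI)
    have "app2 0 = 0" by (simp add: app2_def zero_prod_def zero_smooth.rep_eq)
    then show "sob_norm2 m (app2 0) = 0" using sobd2.N_0[of m] by simp
    show "sob_norm2 m (app2 (v + w)) \<le> sob_norm2 m (app2 v) + sob_norm2 m (app2 w)" for v w
      unfolding sobd2.j_add by (intro sobd2.N_triangle sobd2.j_in)
    show "sob_norm2 m (app2 (- v)) = sob_norm2 m (app2 v)" for v
      unfolding app2_minus by (intro sobd2.N_minus sobd2.j_in)
qed (rule sobd2.N_nonneg)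

section \<open>Differential polynomials and integration by parts\<close>

text \<open>A selector for the two components, so that one rule covers derivatives of either of them.\<close>

definition component :: "bool \<Rightarrow> smooth \<times> smooth \<Rightarrow> smooth" where
  "component c v = (if c then snd v else fst v)"

lemma component_diff: "component c (v - w) = component c v - component c w"
  by (simp add: component_def)

lemma sob_norm_component: "sob_norm m (app (component c v)) \<le> pair_norm m v"
  unfolding pair_norm_def sob_norm2_def component_def app2_def
  by (auto intro!: real_le_rsqrt)

lemma Dpow_diff: "(ddx ^^ a) (f - g) = (ddx ^^ a) f - (ddx ^^ a) g"
  by (induction a) (auto simp: smooth.D_diff)

text \<open>Differential polynomials in a pair of functions, as maps together with their differentials: each derivative has
  order at most \<open>p\<close>, and the orders in each monomial add up to at most \<open>d\<close>. Carrying the differential along as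
  a second argument makes its formula available without differentiating anything.\<close>

inductive diffpoly :: "nat \<Rightarrow> nat \<Rightarrow> (smooth \<times> smooth \<Rightarrow> smooth)
    \<Rightarrow> (smooth \<times> smooth \<Rightarrow> smooth \<times> smooth \<Rightarrow> smooth) \<Rightarrow> bool" where
  diffpoly_const: "diffpoly p d (\<lambda>v. cst c) (\<lambda>v h. 0)"
| diffpoly_mult: "diffpoly p d G G' \<Longrightarrow> a \<le> p \<Longrightarrow>
    diffpoly p (a + d) (\<lambda>v. (ddx ^^ a) (component c v) * G v)
      (\<lambda>v h. (ddx ^^ a) (component c h) * G v + (ddx ^^ a) (component c v) * G' v h)"
| diffpoly_add: "diffpoly p d G G' \<Longrightarrow> diffpoly p d H H' \<Longrightarrow> diffpoly p d (\<lambda>v. G v + H v) (\<lambda>v h. G' v h + H' v h)"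

lemma diffpoly_weaken: "diffpoly p d G G' \<Longrightarrow> p \<le> p' \<Longrightarrow> d \<le> d' \<Longrightarrow> diffpoly p' d' G G'"
proof (induction arbitrary: d' rule: diffpoly.induct)
  case (diffpoly_mult p d G G' a c)
  then have "diffpoly p' (a + (d' - a)) (\<lambda>v. (ddx ^^ a) (component c v) * G v)
      (\<lambda>v h. (ddx ^^ a) (component c h) * G v + (ddx ^^ a) (component c v) * G' v h)"
    by (intro diffpoly.diffpoly_mult) auto
  with diffpoly_mult.prems show ?case by simp
qed (auto intro: diffpoly.intros)

lemma diffpoly_order_le: "diffpoly p d G G' \<Longrightarrow> diffpoly d d G G'"
proof (induction rule: diffpoly.induct)
  case (diffpoly_mult p d G G' a c)
  then show ?case by (intro diffpoly.diffpoly_mult) (auto intro: diffpoly_weaken)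
qed (auto intro: diffpoly.intros)

lemma cst_mult: "cst (a * b) = cst a * cst b"
  by (rule smooth_eqI) simp

lemma diffpoly_cong: "diffpoly p d G G' \<Longrightarrow> (\<And>v. H v = G v) \<Longrightarrow> (\<And>v h. H' v h = G' v h) \<Longrightarrow> diffpoly p d H H'"
proof -
  assume "diffpoly p d G G'" "\<And>v. H v = G v" "\<And>v h. H' v h = G' v h"
  moreover from this have "H = G" "H' = G'" by (auto simp: fun_eq_iff)
  ultimately show "diffpoly p d H H'" by simp
qed

lemma diffpoly_scale: "diffpoly p d G G' \<Longrightarrow> diffpoly p d (\<lambda>v. cst c * G v) (\<lambda>v h. cst c * G' v h)"
proof (induction rule: diffpoly.induct)
  case (diffpoly_const p d c')
  show ?case by (rule diffpoly_cong[OF diffpoly.diffpoly_const[of p d "c * c'"]]) (auto simp: cst_mult)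
next
  case (diffpoly_mult p d G G' a k)
  show ?case
    by (rule diffpoly_cong[OF diffpoly.diffpoly_mult[OF diffpoly_mult.IH diffpoly_mult.hyps(2), of k]]) (auto simp: algebra_simps)
next
  case (diffpoly_add p d G G' H H')
  show ?case
    by (rule diffpoly_cong[OF diffpoly.diffpoly_add[OF diffpoly_add.IH]]) (auto simp: algebra_simps)
qed

lemma diffpoly_prod:
  "diffpoly p d G G' \<Longrightarrow> diffpoly p e H H' \<Longrightarrow> diffpoly p (d + e) (\<lambda>v. G v * H v) (\<lambda>v h. G' v h * H v + G v * H' v h)"
proof (induction rule: diffpoly.induct)
  case (diffpoly_const p d c)
  from diffpoly_weaken[OF diffpoly_scale[OF this, of c], of p "d + e"] show ?case by simp
next
  case (diffpoly_mult p d G G' a c)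
  have "diffpoly p (a + (d + e)) (\<lambda>v. (ddx ^^ a) (component c v) * G v * H v) (\<lambda>v h. ((ddx ^^ a) (component c h) * G v + (ddx ^^ a) (component c v) * G' v h) * H v +
           (ddx ^^ a) (component c v) * G v * H' v h)"
    by (rule diffpoly_cong[OF diffpoly.diffpoly_mult[OF diffpoly_mult.IH[OF diffpoly_mult.prems] diffpoly_mult.hyps(2), of c]])
       (auto simp: algebra_simps)
  then show ?case by (simp add: add.assoc)
next
  case (diffpoly_add p d G G' K K')
  show ?case
    by (rule diffpoly_cong[OF diffpoly.diffpoly_add[OF diffpoly_add.IH[OF diffpoly_add.prems]]]) (auto simp: algebra_simps)
qed

lemma diffpoly_D: "diffpoly p d G G' \<Longrightarrow> diffpoly (Suc p) (Suc d) (\<lambda>v. ddx (G v)) (\<lambda>v h. ddx (G' v h))"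
proof (induction rule: diffpoly.induct)
  case (diffpoly_const p d c)
  show ?case by (rule diffpoly_cong[OF diffpoly.diffpoly_const[of _ _ 0]]) (auto intro: smooth_eqI)
next
  case (diffpoly_mult p d G G' a c)
  have 1: "diffpoly (Suc p) (Suc a + d) (\<lambda>v. (ddx ^^ Suc a) (component c v) * G v)
      (\<lambda>v h. (ddx ^^ Suc a) (component c h) * G v + (ddx ^^ Suc a) (component c v) * G' v h)"
    using diffpoly_mult by (intro diffpoly.diffpoly_mult diffpoly_weaken[OF diffpoly_mult.hyps(1)]) auto
  have 2: "diffpoly (Suc p) (a + Suc d) (\<lambda>v. (ddx ^^ a) (component c v) * ddx (G v))
      (\<lambda>v h. (ddx ^^ a) (component c h) * ddx (G v) + (ddx ^^ a) (component c v) * ddx (G' v h))"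
    using diffpoly_mult by (intro diffpoly.diffpoly_mult) auto
  from 1 2 have "diffpoly (Suc p) (Suc (a + d)) (\<lambda>v. (ddx ^^ Suc a) (component c v) * G v + (ddx ^^ a) (component c v) * ddx (G v))
     (\<lambda>v h. ((ddx ^^ Suc a) (component c h) * G v + (ddx ^^ Suc a) (component c v) * G' v h)
        + ((ddx ^^ a) (component c h) * ddx (G v) + (ddx ^^ a) (component c v) * ddx (G' v h)))"
    by (intro diffpoly.diffpoly_add) auto
  then show ?case
    by (rule diffpoly_cong) (auto simp: smooth.D_mult smooth.D_add algebra_simps)
next
  case (diffpoly_add p d G G' K K')
  show ?case
    by (rule diffpoly_cong[OF diffpoly.diffpoly_add[OF diffpoly_add.IH]]) (auto simp: smooth.D_add)
qed

lemma C11_Dpow_sup: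
  assumes "a < m"
  shows "C11 (pair_norm m) sup_norm (\<lambda>v. (ddx ^^ a) (component c v)) (\<lambda>v h. (ddx ^^ a) (component c h))"
proof (rule C11_linear[OF is_seminorm_sup is_seminorm_pair_norm])
  fix h
  have "sup_norm ((ddx ^^ a) (component c h)) \<le> sqrt 5 * sob_norm 1 (app ((ddx ^^ a) (component c h)))"
    by (rule sup_norm_le_sob_norm)
  also have "\<dots> \<le> sqrt 5 * ((2 * pi) ^ a * sob_norm (1 + a) (app (component c h)))"
    by (intro mult_left_mono sob_norm_Dpow) auto
  also have "\<dots> \<le> sqrt 5 * ((2 * pi) ^ a * sob_norm m (app (component c h)))"
    using assms by (intro mult_left_mono sob_norm_mono(2) smooth_in_sobolev) auto
  also have "\<dots> \<le> sqrt 5 * ((2 * pi) ^ a * pair_norm m h)"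
    by (intro mult_left_mono sob_norm_component) auto
  finally show "sup_norm ((ddx ^^ a) (component c h)) \<le> sqrt 5 * (2 * pi) ^ a * pair_norm m h"
    by (simp add: mult.assoc)
qed (auto simp: component_diff Dpow_diff)

lemma C11_Dpow_L2:
  "C11 (pair_norm m) (\<lambda>f. sob_norm 0 (app f)) (\<lambda>v. (ddx ^^ m) (component c v)) (\<lambda>v h. (ddx ^^ m) (component c h))"
proof (rule C11_linear[OF is_seminorm_sob is_seminorm_pair_norm])
  fix h
  have "sob_norm 0 (app ((ddx ^^ m) (component c h))) \<le> (2 * pi) ^ m * sob_norm (0 + m) (app (component c h))"
    by (rule sob_norm_Dpow)
  also have "\<dots> \<le> (2 * pi) ^ m * pair_norm m h"
    using sob_norm_component by (intro mult_left_mono) auto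
  finally show "sob_norm 0 (app ((ddx ^^ m) (component c h))) \<le> (2 * pi) ^ m * pair_norm m h" .
qed (auto simp: component_diff Dpow_diff)

lemma diffpoly_C11: "diffpoly p d G G' \<Longrightarrow> p < m \<Longrightarrow> C11 (pair_norm m) sup_norm G G'"
proof (induction rule: diffpoly.induct)
  case (diffpoly_const p d c)
  show ?case by (rule C11_const[OF is_seminorm_sup is_seminorm_pair_norm])
next
  case (diffpoly_mult p d G G' a c)
  then show ?case
    by (intro C11_bilinear[where B = "(*)", OF is_seminorm_pair_norm is_seminorm_sup is_seminorm_sup is_seminorm_sup sup_norm_mult])
       (auto simp: algebra_simps intro: C11_Dpow_sup)
next
  case (diffpoly_add p d G G' H H')
  then show ?case by (intro C11_add[OF is_seminorm_sup is_seminorm_pair_norm]) auto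
qed

lemma C11_integral_product:
  assumes G: "C11 (pair_norm m) (\<lambda>f. sob_norm 0 (app f)) G G'" and H: "C11 (pair_norm m) sup_norm H H'"
  shows "C11 (pair_norm m) cmod (\<lambda>v. torus_int (G v * H v)) (\<lambda>v h. torus_int (G' v h * H v + G v * H' v h))"
proof -
  have "cmod (torus_int (x * y)) \<le> sob_norm 0 (app x) * sup_norm y" for x y
    by (rule order_trans[OF cmod_torus_int_mult_le]) (intro mult_left_mono sob_norm_0_le_sup, simp)
  from C11_bilinear[where B = "\<lambda>x y. torus_int (x * y)", OF is_seminorm_pair_norm is_seminorm_sob is_seminorm_sup is_seminorm_cmod this _ _ G H]
  show ?thesis by (simp add: smooth.I_add algebra_simps)
qed

lemma C11_minus:
  assumes "C11 M cmod F F'"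
  shows "C11 M cmod (\<lambda>v. - F v) (\<lambda>v h. - F' v h)"
proof -
  have "cmod (- x - - y) = cmod (x - y)" "cmod (- x - - y - - z) = cmod (x - y - z)" for x y z :: complex
    by (metis minus_diff_minus norm_minus_cancel minus_diff_commute)+
  then show ?thesis using assms unfolding C11_def norm_minus_cancel by simp
qed

text \<open>If one factor carries at least \<open>m\<close> derivatives, the others carry fewer than \<open>m\<close> in total. Integration by parts
  lowers the order of that factor to \<open>m\<close>; then it is measured in \<open>L^2\<close> and the remaining factors, which have
  order less than \<open>m\<close>, in the supremum norm.\<close>

lemma C11_highest_derivative:
  assumes "m \<le> a" "diffpoly p e H H'" "a + e < 2 * m"
  shows "C11 (pair_norm m) cmod (\<lambda>v. torus_int ((ddx ^^ a) (component c v) * H v))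
     (\<lambda>v h. torus_int ((ddx ^^ a) (component c h) * H v + (ddx ^^ a) (component c v) * H' v h))"
  using assms
proof (induction a arbitrary: p e H H' rule: dec_induct)
  case base
  then have "C11 (pair_norm m) sup_norm H H'"
    by (intro diffpoly_C11[OF diffpoly_order_le[OF base(1)]]) simp
  then show ?case by (rule C11_integral_product[OF C11_Dpow_L2])
next
  case (step a)
  have "C11 (pair_norm m) cmod (\<lambda>v. - torus_int ((ddx ^^ a) (component c v) * ddx (H v)))
     (\<lambda>v h. - torus_int ((ddx ^^ a) (component c h) * ddx (H v) + (ddx ^^ a) (component c v) * ddx (H' v h)))"
    by (rule C11_minus[OF step.IH[OF diffpoly_D[OF step.prems(1)]]]) (use step.prems in simp)
  then show ?case by (simp add: smooth.I_add smooth.I_parts)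
qed

text \<open>The factor \<open>H\<close> accumulates the derivatives of order less than \<open>m\<close> met so far while \<open>G\<close> is taken apart. Either
  a derivative of order at least \<open>m\<close> appears, or the whole monomial ends up in \<open>H\<close>.\<close>

lemma C11_integral_diffpoly:
  assumes "diffpoly p d G G'" "diffpoly (m - 1) e H H'" "d + e < 2 * m"
  shows "C11 (pair_norm m) cmod (\<lambda>v. torus_int (G v * H v)) (\<lambda>v h. torus_int (G' v h * H v + G v * H' v h))"
  using assms
proof (induction arbitrary: e H H' rule: diffpoly.induct)
  case (diffpoly_const p d c)
  then have "C11 (pair_norm m) sup_norm H H'" by (intro diffpoly_C11) auto
  from C11_integral_product[OF C11_const[OF is_seminorm_sob is_seminorm_pair_norm] this] show ?case .
next
  case (diffpoly_mult p d G G' a c)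
  show ?case
  proof (cases "a < m")
    case True
    have "diffpoly (m - 1) (a + e) (\<lambda>v. (ddx ^^ a) (component c v) * H v)
      (\<lambda>v h. (ddx ^^ a) (component c h) * H v + (ddx ^^ a) (component c v) * H' v h)"
      using True by (intro diffpoly.diffpoly_mult diffpoly_mult.prems) auto
    from diffpoly_mult.IH[OF this] diffpoly_mult.prems show ?thesis by (simp add: algebra_simps)
  next
    case False
    have "diffpoly (max p (m - 1)) (d + e) (\<lambda>v. G v * H v) (\<lambda>v h. G' v h * H v + G v * H' v h)"
      by (intro diffpoly_prod diffpoly_weaken[OF diffpoly_mult.hyps(1)] diffpoly_weaken[OF diffpoly_mult.prems(1)]) auto
    from C11_highest_derivative[OF _ this, of m a c] False diffpoly_mult.prems show ?thesis
      by (simp add: algebra_simps)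
  qed
next
  case (diffpoly_add p d G G' K K')
  from C11_add[OF is_seminorm_cmod is_seminorm_pair_norm diffpoly_add.IH(1)[OF diffpoly_add.prems] diffpoly_add.IH(2)[OF diffpoly_add.prems]]
  show ?case by (simp add: smooth.I_add algebra_simps)
qed

section \<open>Polynomial structure of the two hierarchies\<close>

lemma diffpoly_zero: "diffpoly p d (\<lambda>v. 0) (\<lambda>v h. 0)"
  by (rule diffpoly_cong[OF diffpoly_const[of p d 0]]) (auto intro: smooth_eqI)

lemma diffpoly_sum:
  assumes "\<And>j. j \<in> A \<Longrightarrow> diffpoly p d (G j) (G' j)"
  shows "diffpoly p d (\<lambda>v. \<Sum>j\<in>A. G j v) (\<lambda>v h. \<Sum>j\<in>A. G' j v h)"
  using assms by (induction A rule: infinite_finite_induct) (auto intro: diffpoly_zero diffpoly_add)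

lemma cst_1: "cst 1 = 1"
  by (rule smooth_eqI) simp

lemma cst_i: "- cst \<i> = cst (- \<i>)"
  by (rule smooth_eqI) simp

lemma diffpoly_nls_nonlinearity:
  assumes "\<And>j. 1 \<le> j \<Longrightarrow> j \<le> n \<Longrightarrow> diffpoly n (j - 1) (\<lambda>v. smooth.nls v j) (\<lambda>v h. smooth.dnls v h j)"
    and n: "n \<ge> 1"
  shows "diffpoly n (n - 1) (\<lambda>v. fst v * (\<Sum>j\<in>{1..n}. smooth.nls v j * smooth.nls v (Suc n - j)))
     (\<lambda>v h. fst h * (\<Sum>j\<in>{1..n}. smooth.nls v j * smooth.nls v (Suc n - j))
     + fst v * (\<Sum>j\<in>{1..n}. smooth.dnls v h j * smooth.nls v (Suc n - j) + smooth.nls v j * smooth.dnls v h (Suc n - j)))"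
proof -
  have "diffpoly n (n - 1) (\<lambda>v. \<Sum>j\<in>{1..n}. smooth.nls v j * smooth.nls v (Suc n - j))
    (\<lambda>v h. \<Sum>j\<in>{1..n}. smooth.dnls v h j * smooth.nls v (Suc n - j) + smooth.nls v j * smooth.dnls v h (Suc n - j))"
  proof (rule diffpoly_sum)
    fix j assume j: "j \<in> {1..n}"
    have "diffpoly n ((j - 1) + (Suc n - j - 1)) (\<lambda>v. smooth.nls v j * smooth.nls v (Suc n - j))
      (\<lambda>v h. smooth.dnls v h j * smooth.nls v (Suc n - j) + smooth.nls v j * smooth.dnls v h (Suc n - j))"
      using j by (intro diffpoly_prod assms(1)) auto
    moreover have "(j - 1) + (Suc n - j - 1) = n - 1" using j by auto
    ultimately show "diffpoly n (n - 1) (\<lambda>v. smooth.nls v j * smooth.nls v (Suc n - j))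
      (\<lambda>v h. smooth.dnls v h j * smooth.nls v (Suc n - j) + smooth.nls v j * smooth.dnls v h (Suc n - j))"
      by simp
  qed
  from diffpoly_mult[OF this, of 0 False] show ?thesis by (simp add: component_def)
qed

lemma diffpoly_nls: "n \<ge> 1 \<Longrightarrow> diffpoly n (n - 1) (\<lambda>v. smooth.nls v n) (\<lambda>v h. smooth.dnls v h n)"
proof (induction n rule: less_induct)
  case (less n)
  consider "n = 1" | k where "n = Suc (Suc k)" using less.prems by (metis One_nat_def not0_implies_Suc not_less_eq_eq zero_less_Suc le_numeral_extra(3) old.nat.exhaust)
  then show ?case
  proof cases
    case 1
    have "diffpoly 1 0 (\<lambda>v. snd v * cst 1) (\<lambda>v h. snd h * cst 1)"
      using diffpoly_mult[OF diffpoly_const[of 1 0 1], of 0 True] by (simp add: component_def)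
    then show ?thesis unfolding 1 by (rule diffpoly_weaken[OF diffpoly_cong]) (auto simp: cst_1)
  next
    case 2
    have "diffpoly (Suc (Suc k)) (Suc k) (\<lambda>v. cst (- \<i>) * ddx (smooth.nls v (Suc k))) (\<lambda>v h. cst (- \<i>) * ddx (smooth.dnls v h (Suc k)))"
      using diffpoly_D[OF less.IH[of "Suc k"]] 2 by (intro diffpoly_scale) simp
    moreover have "diffpoly (Suc (Suc k)) (Suc k) (\<lambda>v. fst v * (\<Sum>j\<in>{1..k}. smooth.nls v j * smooth.nls v (Suc k - j)))
     (\<lambda>v h. fst h * (\<Sum>j\<in>{1..k}. smooth.nls v j * smooth.nls v (Suc k - j))
     + fst v * (\<Sum>j\<in>{1..k}. smooth.dnls v h j * smooth.nls v (Suc k - j) + smooth.nls v j * smooth.dnls v h (Suc k - j)))"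
    proof (cases "k = 0")
      case True
      then show ?thesis by (auto intro: diffpoly_zero)
    next
      case False
      have "diffpoly k (j - 1) (\<lambda>v. smooth.nls v j) (\<lambda>v h. smooth.dnls v h j)" if "1 \<le> j" "j \<le> k" for j
        by (rule diffpoly_weaken[OF less.IH]) (use that 2 in auto)
      then show ?thesis
        by (rule diffpoly_weaken[OF diffpoly_nls_nonlinearity]) (use False in auto)
    qed
    ultimately show ?thesis
      unfolding 2 diff_Suc_1 smooth.nls.simps smooth.dnls.simps cst_i by (rule diffpoly_add)
  qed
qed

text \<open>The linear part of \<open>r_n\<close>.\<close>

definition nls_lin :: "nat \<Rightarrow> smooth \<Rightarrow> smooth" where
  "nls_lin n f = cst ((- \<i>) ^ (n - 1)) * (ddx ^^ (n - 1)) f"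

lemma nls_lin_Suc: "nls_lin (Suc (Suc k)) f = cst (- \<i>) * ddx (nls_lin (Suc k) f)"
  by (simp add: nls_lin_def smooth.D_mult flip: mult.assoc cst_mult)

lemma nls_minus_lin:
  "smooth.nls v (Suc (Suc k)) - nls_lin (Suc (Suc k)) (snd v) =
     cst (- \<i>) * ddx (smooth.nls v (Suc k) - nls_lin (Suc k) (snd v))
     + fst v * (\<Sum>j\<in>{1..k}. smooth.nls v j * smooth.nls v (Suc k - j))"
  unfolding nls_lin_Suc smooth.nls.simps cst_i smooth.D_diff by (simp only: algebra_simps)

lemma dnls_minus_lin:
  "smooth.dnls v h (Suc (Suc k)) - nls_lin (Suc (Suc k)) (snd h) =
     cst (- \<i>) * ddx (smooth.dnls v h (Suc k) - nls_lin (Suc k) (snd h))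
     + (fst h * (\<Sum>j\<in>{1..k}. smooth.nls v j * smooth.nls v (Suc k - j))
     + fst v * (\<Sum>j\<in>{1..k}. smooth.dnls v h j * smooth.nls v (Suc k - j) + smooth.nls v j * smooth.dnls v h (Suc k - j)))"
  unfolding nls_lin_Suc smooth.dnls.simps cst_i smooth.D_diff by (simp only: algebra_simps)

lemma nls_lin_1: "nls_lin (Suc 0) f = f"
  by (simp add: nls_lin_def cst_1)

text \<open>The nonlinear part of \<open>r_n\<close> has two derivatives fewer than the linear part. On the space of index \<open>s\<close> this makes
  room for \<open>S_(2s+1)\<close>, whose quadratic part alone is of total order \<open>2 s\<close> and has to be treated separately.\<close>

lemma diffpoly_nls_minus_lin:
  "diffpoly (k + 3) k (\<lambda>v. smooth.nls v (k + 3) - nls_lin (k + 3) (snd v))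
    (\<lambda>v h. smooth.dnls v h (k + 3) - nls_lin (k + 3) (snd h))"
proof (induction k)
  case 0
  have n: "diffpoly (Suc (Suc 1)) 0 (\<lambda>v. fst v * (\<Sum>j\<in>{1..1}. smooth.nls v j * smooth.nls v (Suc 1 - j)))
     (\<lambda>v h. fst h * (\<Sum>j\<in>{1..1}. smooth.nls v j * smooth.nls v (Suc 1 - j))
     + fst v * (\<Sum>j\<in>{1..1}. smooth.dnls v h j * smooth.nls v (Suc 1 - j) + smooth.nls v j * smooth.dnls v h (Suc 1 - j)))"
    by (rule diffpoly_weaken[OF diffpoly_nls_nonlinearity[of 1]]) (use diffpoly_nls[of 1] in \<open>auto dest: le_antisym\<close>)
  have 1: "smooth.nls v (Suc 1) - nls_lin (Suc 1) (snd v) = 0" "smooth.dnls v h (Suc 1) - nls_lin (Suc 1) (snd h) = 0" for v h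
    using nls_minus_lin[of v 0] dnls_minus_lin[of v h 0] by (simp_all add: nls_lin_1)
  have three: "0 + 3 = Suc (Suc 1)" by simp
  show ?case
    unfolding three nls_minus_lin dnls_minus_lin 1 by (rule diffpoly_cong[OF n]) auto
next
  case (Suc k)
  have e: "Suc k + 3 = Suc (Suc (k + 2))" "k + 3 = Suc (k + 2)" by simp_all
  have "diffpoly (Suc k + 3) (Suc k) (\<lambda>v. fst v * (\<Sum>j\<in>{1..k + 2}. smooth.nls v j * smooth.nls v (Suc (k + 2) - j)))
     (\<lambda>v h. fst h * (\<Sum>j\<in>{1..k + 2}. smooth.nls v j * smooth.nls v (Suc (k + 2) - j))
     + fst v * (\<Sum>j\<in>{1..k + 2}. smooth.dnls v h j * smooth.nls v (Suc (k + 2) - j) + smooth.nls v j * smooth.dnls v h (Suc (k + 2) - j)))"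
  proof (rule diffpoly_weaken[OF diffpoly_nls_nonlinearity])
    show "diffpoly (k + 2) (j - 1) (\<lambda>v. smooth.nls v j) (\<lambda>v h. smooth.dnls v h j)" if "1 \<le> j" "j \<le> k + 2" for j
      by (rule diffpoly_weaken[OF diffpoly_nls]) (use that in auto)
  qed auto
  moreover have "diffpoly (Suc k + 3) (Suc k) (\<lambda>v. cst (- \<i>) * ddx (smooth.nls v (k + 3) - nls_lin (k + 3) (snd v)))
     (\<lambda>v h. cst (- \<i>) * ddx (smooth.dnls v h (k + 3) - nls_lin (k + 3) (snd h)))"
    using diffpoly_D[OF Suc] by (intro diffpoly_scale) simp
  ultimately show ?case
    unfolding e nls_minus_lin dnls_minus_lin by (rule diffpoly_add[rotated])
qed

definition nls_fun :: "nat \<Rightarrow> smooth \<times> smooth \<Rightarrow> complex" where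
  "nls_fun n v = torus_int (fst v * smooth.nls v n)"

definition nls_diff :: "nat \<Rightarrow> smooth \<times> smooth \<Rightarrow> smooth \<times> smooth \<Rightarrow> complex" where
  "nls_diff n v h = torus_int (fst h * smooth.nls v n + fst v * smooth.dnls v h n)"

lemma C11_integral_diffpoly':
  assumes "diffpoly p d G G'" "d < 2 * m"
  shows "C11 (pair_norm m) cmod (\<lambda>v. torus_int (G v)) (\<lambda>v h. torus_int (G' v h))"
  using C11_integral_diffpoly[OF assms(1) diffpoly_const[of _ 0 1]] assms(2) by (simp add: cst_1)

lemma C11_nls_fun_even:
  assumes "m \<ge> 1"
  shows "C11 (pair_norm m) cmod (nls_fun (2 * m)) (nls_diff (2 * m))"
proof -
  have "diffpoly (2 * m) (0 + (2 * m - 1)) (\<lambda>v. (ddx ^^ 0) (component False v) * smooth.nls v (2 * m))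
    (\<lambda>v h. (ddx ^^ 0) (component False h) * smooth.nls v (2 * m) + (ddx ^^ 0) (component False v) * smooth.dnls v h (2 * m))"
    using assms by (intro diffpoly_mult diffpoly_nls) auto
  from C11_integral_diffpoly'[OF this, of m] assms show ?thesis
    by (simp add: nls_fun_def[abs_def] nls_diff_def[abs_def] component_def)
qed

lemma torus_int_Dpow_parts: "torus_int ((ddx ^^ s) f * g) = (-1) ^ s * torus_int (f * (ddx ^^ s) g)"
proof (induction s arbitrary: g)
  case (Suc s)
  have "torus_int ((ddx ^^ Suc s) f * g) = - torus_int ((ddx ^^ s) f * ddx g)" by (simp add: smooth.I_parts)
  also have "\<dots> = (-1) ^ Suc s * torus_int (f * (ddx ^^ Suc s) g)" by (simp only: Suc funpow_Suc_right) simp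
  finally show ?case .
qed simp

lemma torus_int_nls_lin: "torus_int (f * nls_lin (Suc (2 * s)) g) = torus_int ((ddx ^^ s) f * (ddx ^^ s) g)"
proof -
  have "torus_int (f * nls_lin (Suc (2 * s)) g) = (- \<i>) ^ (2 * s) * torus_int (f * (ddx ^^ (2 * s)) g)"
    using torus_int_cst_mult[of "(- \<i>) ^ (2 * s)" "f * (ddx ^^ (2 * s)) g"] by (simp add: nls_lin_def mult.left_commute)
  also have "(- \<i>) ^ (2 * s) = (-1) ^ s" by (simp add: power_mult)
  also have "(-1) ^ s * torus_int (f * (ddx ^^ (2 * s)) g) = torus_int ((ddx ^^ s) f * (ddx ^^ s) g)"
    unfolding torus_int_Dpow_parts by (simp add: mult_2 funpow_add)
  finally show ?thesis .
qed

lemma C11_quadratic: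
  "C11 (pair_norm s) cmod (\<lambda>v. torus_int ((ddx ^^ s) (fst v) * (ddx ^^ s) (snd v)))
     (\<lambda>v h. torus_int ((ddx ^^ s) (fst h) * (ddx ^^ s) (snd v)) + torus_int ((ddx ^^ s) (fst v) * (ddx ^^ s) (snd h)))"
proof -
  from C11_bilinear[where B = "\<lambda>x y. torus_int (x * y)", OF is_seminorm_pair_norm is_seminorm_sob is_seminorm_sob is_seminorm_cmod cmod_torus_int_mult_le _ _
      C11_Dpow_L2[of s False] C11_Dpow_L2[of s True]]
  show ?thesis by (simp add: smooth.I_add algebra_simps component_def)
qed

text \<open>The quadratic part is integrated by parts until the two factors carry \<open>s\<close> derivatives each, so that both are
  measured in \<open>L^2\<close>.\<close>

lemma C11_nls_fun_odd: "C11 (pair_norm s) cmod (nls_fun (Suc (2 * s))) (nls_diff (Suc (2 * s)))"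
proof (cases s)
  case 0
  then show ?thesis using C11_quadratic[of 0] by (simp add: nls_fun_def[abs_def] nls_diff_def[abs_def] smooth.I_add)
next
  case (Suc k)
  let ?n = "Suc (2 * s)"
  have n: "?n = 2 * k + 3" using Suc by simp
  let ?G = "\<lambda>v. smooth.nls v ?n - nls_lin ?n (snd v)" and ?G' = "\<lambda>v h. smooth.dnls v h ?n - nls_lin ?n (snd h)"
  have "diffpoly ?n (0 + 2 * k) (\<lambda>v. (ddx ^^ 0) (component False v) * ?G v)
    (\<lambda>v h. (ddx ^^ 0) (component False h) * ?G v + (ddx ^^ 0) (component False v) * ?G' v h)"
    using diffpoly_nls_minus_lin[of "2 * k"] by (intro diffpoly_mult) (simp_all add: n)
  then have "C11 (pair_norm s) cmod (\<lambda>v. torus_int ((ddx ^^ 0) (component False v) * ?G v))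
    (\<lambda>v h. torus_int ((ddx ^^ 0) (component False h) * ?G v + (ddx ^^ 0) (component False v) * ?G' v h))"
    by (rule C11_integral_diffpoly') (simp add: Suc)
  from C11_add[OF is_seminorm_cmod is_seminorm_pair_norm this C11_quadratic]
  show ?thesis
    unfolding nls_fun_def[abs_def] nls_diff_def[abs_def] torus_int_nls_lin[symmetric]
    by (simp add: component_def smooth.I_add smooth.I_diff right_diff_distrib)
qed

lemma nls_diff_add: "nls_diff n v (h + k) = nls_diff n v h + nls_diff n v k"
  unfolding nls_diff_def smooth.gradient_formula by (simp add: ring_distribs smooth.I_add)

lemma nls_diff_sc2: "nls_diff n v (sc2 c h) = c * nls_diff n v h"
  unfolding nls_diff_def smooth.gradient_formula sc2_def
  by (simp add: torus_int_cst_mult mult.left_commute[of _ "cst c"] ring_distribs)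

lemma S_smooth_app2: "S_smooth n (app2 v) = nls_fun n v"
  by (cases v) (simp add: app2_def S_smooth_eq nls_fun_def)

lemma C11_scale:
  assumes F: "C11 M cmod F F'" and M: "is_seminorm M"
  shows "C11 M cmod (\<lambda>v. c * F v) (\<lambda>v h. c * F' v h)"
proof -
  have p: "is_seminorm (\<lambda>z. cmod c * cmod z)"
    by (auto simp: is_seminorm_def ring_distribs[symmetric] intro!: mult_left_mono norm_triangle_ineq)
  show ?thesis
    using C11_bilinear[where B = "(*)" and G = "\<lambda>v. c" and G' = "\<lambda>v h. 0" and ?p1.0 = cmod and ?p2.0 = cmod and ?p3.0 = cmod,
        OF M is_seminorm_cmod is_seminorm_cmod is_seminorm_cmod _ _ _ C11_const[OF is_seminorm_cmod M] F]
    by (simp add: norm_mult algebra_simps)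
qed

text \<open>One half of the restriction of \<open>S_(2s+1)\<close> to the diagonal. That this is the mKdV Hamiltonian \<open>K_(s+1)\<close> is
  \<open>K_smooth_app\<close>.\<close>

definition mkdv_fun :: "nat \<Rightarrow> smooth \<Rightarrow> complex" where
  "mkdv_fun s f = 1 / 2 * nls_fun (Suc (2 * s)) (f, f)"

definition mkdv_diff :: "nat \<Rightarrow> smooth \<Rightarrow> smooth \<Rightarrow> complex" where
  "mkdv_diff s f h = 1 / 2 * nls_diff (Suc (2 * s)) (f, f) (h, h)"

lemma pair_norm_diag: "pair_norm m (f, f) = sqrt 2 * sob_norm m (app f)"
  by (simp add: pair_norm_def sob_norm2_def app2_def real_sqrt_mult flip: mult_2)

lemma C11_mkdv_fun: "C11 (\<lambda>f. sob_norm s (app f)) cmod (mkdv_fun s) (mkdv_diff s)"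
  unfolding mkdv_fun_def[abs_def] mkdv_diff_def[abs_def]
  by (intro C11_scale C11_compose_linear[OF C11_nls_fun_odd, where L = "\<lambda>f. (f, f)" and K = "sqrt 2"] is_seminorm_pair_norm is_seminorm_sob)
     (auto simp: pair_norm_diag)

lemma K_smooth_app: "K_smooth (Suc s) (app f) = mkdv_fun s f"
  by (simp add: K_smooth_eq mkdv_fun_def nls_fun_def smooth.I_nls_diagonal)

lemma smooth_half:
  fixes f :: smooth
  assumes "2 * f = 0"
  shows "f = 0"
proof (rule smooth_eqI)
  fix x
  have "app (f + f) x = app 0 x" using assms unfolding mult_2 by (rule arg_cong)
  then show "app f x = app 0 x" unfolding app_add app_0 by simp
qed

lemma nls_fun_even_diagonal: "nls_fun (2 * m) (f, f) = 0"
  by (simp add: nls_fun_def smooth.I_nls_diagonal smooth.I_mkdv_even)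

text \<open>The theorem for smooth functions: integration by parts moves the derivative in \<open>a_(2s+2) = - \<i> a_(2s+1)'\<close> and
  \<open>b_(2s+2) = \<i> a_(2s+1)'\<close> to the direction \<open>g\<close>.\<close>

lemma nls_diff_even_diagonal:
  shows "nls_diff (2 * Suc s) (f, f) (g, 0) = \<i> * mkdv_diff s f (ddx g)"
    and "nls_diff (2 * Suc s) (f, f) (0, g) = - \<i> * mkdv_diff s f (ddx g)"
proof -
  let ?n = "Suc (2 * s)"
  let ?a = "smooth.a_s (f, f)" and ?b = "smooth.b_s (f, f)"
  have n: "2 * Suc s = Suc ?n" and odd: "odd ?n" by simp_all
  note grad = smooth.diagonal_gradients[OF smooth_half odd, of f]
  have a2: "fps_nth ?a (2 * Suc s) = - cst \<i> * ddx (fps_nth ?a ?n)"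
    unfolding n by (rule grad(2))
  have b2: "fps_nth ?b (2 * Suc s) = cst \<i> * ddx (fps_nth ?a ?n)"
    unfolding n by (rule grad(3))
  have mkdv_diff: "mkdv_diff s f h = torus_int (fps_nth ?a ?n * h)" for h
    unfolding mkdv_diff_def nls_diff_def smooth.gradient_formula by (simp add: grad(1))
  have ddx: "torus_int (ddx (fps_nth ?a ?n) * g) = - mkdv_diff s f (ddx g)"
    unfolding mkdv_diff smooth.I_parts ..
  have "nls_diff (2 * Suc s) (f, f) (g, 0) = - (\<i> * torus_int (ddx (fps_nth ?a ?n) * g))"
    unfolding nls_diff_def smooth.gradient_formula a2
    by (simp only: fst_conv snd_conv mult_zero_right smooth.I_0 smooth.I_minus smooth.I_i mult_minus_left mult.assoc) simp
  then show "nls_diff (2 * Suc s) (f, f) (g, 0) = \<i> * mkdv_diff s f (ddx g)" unfolding ddx by simp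
  have "nls_diff (2 * Suc s) (f, f) (0, g) = \<i> * torus_int (ddx (fps_nth ?a ?n) * g)"
    unfolding nls_diff_def smooth.gradient_formula b2
    by (simp only: fst_conv snd_conv mult_zero_right smooth.I_0 smooth.I_i mult.assoc) simp
  then show "nls_diff (2 * Suc s) (f, f) (0, g) = - \<i> * mkdv_diff s f (ddx g)" unfolding ddx by simp
qed

lemma nls_S_limits:
  assumes v: "v \<in> sobolev m \<times> sobolev m" and m: "m \<ge> 1" and x: "sobd2.conv m x v"
  shows "(\<lambda>k. nls_fun (2 * m) (x k)) \<longlonglongrightarrow> nls_S (2 * m) v"
    and "(\<lambda>k. nls_diff (2 * m) (x k) h) \<longlonglongrightarrow>
       differential cscale2 (sobolev m \<times> sobolev m) (sob_norm2 m) (nls_S (2 * m)) v (app2 h)"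
proof -
  have C: "C11 (sobd2.M m) cmod (nls_fun (2 * m)) (nls_diff (2 * m))"
    unfolding sobd2_M by (rule C11_nls_fun_even[OF m])
  have eq: "nls_S (2 * m) = cont_extension (sobolev m \<times> sobolev m) (sob_norm2 m) (range app2) (S_smooth (2 * m))"
    by (simp add: nls_S_def range_app2)
  note ext = sobd2.C11_extension[OF C nls_diff_add nls_diff_sc2 S_smooth_app2 v x]
  show "(\<lambda>k. nls_fun (2 * m) (x k)) \<longlonglongrightarrow> nls_S (2 * m) v" unfolding eq by (rule ext(1))
  show "(\<lambda>k. nls_diff (2 * m) (x k) h) \<longlonglongrightarrow>
       differential cscale2 (sobolev m \<times> sobolev m) (sob_norm2 m) (nls_S (2 * m)) v (app2 h)"
    unfolding eq by (rule ext(2))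
qed

lemma mkdv_K_limit:
  assumes u: "u \<in> sobolev s" and x: "sobd.conv s x u"
  shows "(\<lambda>k. mkdv_diff s (x k) h) \<longlonglongrightarrow> differential cscale (sobolev s) (sob_norm s) (mkdv_K (Suc s)) u (app h)"
proof -
  have C: "C11 (sobd.M s) cmod (mkdv_fun s) (mkdv_diff s)"
    unfolding sobd_M by (rule C11_mkdv_fun)
  have eq: "mkdv_K (Suc s) = cont_extension (sobolev s) (sob_norm s) (range app) (K_smooth (Suc s))"
    by (simp add: mkdv_K_def range_app)
  have add: "mkdv_diff s v (h + k) = mkdv_diff s v h + mkdv_diff s v k" for v h k
    using nls_diff_add[of _ _ "(h, h)" "(k, k)"] by (simp add: mkdv_diff_def ring_distribs)
  have hom: "mkdv_diff s v (cst c * h) = c * mkdv_diff s v h" for v h c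
    using nls_diff_sc2[of _ _ c "(h, h)"] by (simp add: mkdv_diff_def sc2_def)
  show ?thesis
    unfolding eq by (rule sobd.C11_extension(2)[OF C add hom K_smooth_app u x])
qed

theorem theorem1p1:
  fixes m :: nat
  assumes "m \<ge> 1"
  shows "(\<forall>u\<in>sobolev m. sharp (ham_X m (nls_S (2 * m))) u
            = (ham_Y (m - 1) (mkdv_K m) u, ham_Y (m - 1) (mkdv_K m) u))
       \<and> (\<forall>u\<in>sobolev m. sharp (nls_S (2 * m)) u = 0)"
proof -
  obtain s where m: "m = Suc s" using assms by (cases m) auto
  have main: "sharp (ham_X m (nls_S (2 * m))) u = (ham_Y (m - 1) (mkdv_K m) u, ham_Y (m - 1) (mkdv_K m) u)
      \<and> sharp (nls_S (2 * m)) u = 0" if u: "u \<in> sobolev m" for u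
  proof -
    \<comment> \<open>smooth functions converging to \<open>u\<close> for index \<open>m\<close>, hence also for index \<open>m - 1\<close>, where \<open>K_m\<close> is differentiated\<close>
    obtain x where x: "sobd.conv m x u" using sobd.conv_exists[OF u] by blast
    have us: "u \<in> sobolev s" using sob_norm_mono(1)[OF u, of s] m by simp
    have xs: "sobd.conv s x u"
      unfolding sobd.conv_def
    proof (rule tendsto_sandwich[OF _ _ tendsto_const x[unfolded sobd.conv_def]])
      show "\<forall>\<^sub>F k in sequentially. sob_norm s (app (x k) - u) \<le> sob_norm m (app (x k) - u)"
        using m u by (intro always_eventually allI sob_norm_mono(2) sob.V_diff smooth_in_sobolev) auto
    qed simp
    have x2: "sobd2.conv m (\<lambda>k. (x k, x k)) (u, u)"
      unfolding sobd2.conv_def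
      using tendsto_mult_right_zero[OF x[unfolded sobd.conv_def], of "sqrt 2"]
      by (simp add: sob_norm2_def app2_def real_sqrt_mult flip: mult_2)
    have uu: "(u, u) \<in> sobolev m \<times> sobolev m" using u by simp
    note lim = nls_S_limits[OF uu assms x2]
    have S0: "nls_S (2 * m) (u, u) = 0"
      using LIMSEQ_unique[OF lim(1)] by (simp add: nls_fun_even_diagonal)
    define dF where "dF = differential cscale2 (sobolev m \<times> sobolev m) (sob_norm2 m) (nls_S (2 * m)) (u, u)"
    define dG where "dG = differential cscale (sobolev s) (sob_norm s) (mkdv_K m) u"
    have app0: "app 0 = 0" by (rule zero_smooth.rep_eq)
    have lK: "(\<lambda>k. mkdv_diff s (x k) (ddx g)) \<longlonglongrightarrow> dG (app (ddx g))" for g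
      using mkdv_K_limit[OF us xs, of "ddx g"] by (simp add: dG_def m)
    have dF1: "dF (h, 0) = \<i> * dG (Dx h)" if h: "h \<in> smooth_per" for h
    proof -
      obtain g where g: "h = app g" using h range_app by blast
      have "(\<lambda>k. \<i> * mkdv_diff s (x k) (ddx g)) \<longlonglongrightarrow> dF (h, 0)"
        using lim(2)[of "(g, 0)"] unfolding dF_def m nls_diff_even_diagonal by (simp add: app2_def g app0)
      from LIMSEQ_unique[OF this tendsto_mult_left[OF lK]] show ?thesis by (simp add: g app_ddx)
    qed
    have dF2: "dF (0, h) = - \<i> * dG (Dx h)" if h: "h \<in> smooth_per" for h
    proof -
      obtain g where g: "h = app g" using h range_app by blast
      have "(\<lambda>k. - \<i> * mkdv_diff s (x k) (ddx g)) \<longlonglongrightarrow> dF (0, h)"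
        using lim(2)[of "(0, g)"] unfolding dF_def m nls_diff_even_diagonal by (simp add: app2_def g app0)
      from LIMSEQ_unique[OF this tendsto_mult_left[OF lK]] show ?thesis by (simp add: g app_ddx)
    qed
    have X: "ham_X m (nls_S (2 * m)) (u, u)
      = (cscale (- \<i>) (as_dist (\<lambda>h. dF (0, h))), cscale (- \<i>) (- as_dist (\<lambda>h. dF (h, 0))))"
      by (simp add: ham_X_def grad2_def J_mult_def cscale2_def dF_def Let_def)
    have Y: "ham_Y (m - 1) (mkdv_K m) u = as_dist (\<lambda>h. - as_dist dG (Dx h))"
      by (simp add: ham_Y_def dist_Dx_def grad_def dG_def m)
    have "cscale (- \<i>) (as_dist (\<lambda>h. dF (0, h))) = as_dist (\<lambda>h. - as_dist dG (Dx h))"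
      by (auto simp: fun_eq_iff cscale_def as_dist_def dF2 smooth_per_Dx)
    moreover have "cscale (- \<i>) (- as_dist (\<lambda>h. dF (h, 0))) = as_dist (\<lambda>h. - as_dist dG (Dx h))"
      by (auto simp: fun_eq_iff cscale_def as_dist_def dF1 smooth_per_Dx)
    ultimately show ?thesis
      unfolding sharp_def X Y S0 by simp
  qed
  then show ?thesis by blast
qed

end
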